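(* Assume the Standing Assumption and that the time constant $\ell$ is differentiable and strictly convex. Then almost surely there is a (random) set $\mathscr U_0\subseteq\mathscr U$ with countable complement, with $\mathbb{P}(\xi\in\mathscr U_0)=1$ for each fixed $\xi\in\mathscr U$, such that for every $\xi\in\mathscr U_0$ and all $x,y\in\mathbb{Z}^2$ the limit $$B^\xi(x,y)=\lim_{n\to\infty}\bigl(L(x,v_n)-L(y,v_n)\bigr)$$ exists for every sequence $v_n\to\xi\cdot\infty$ (and does not depend on the sequence). Moreover, for every $\xi\in\mathscr U$ the limits $B^{\xi+}(x,y)=\lim_{\zeta\to\xi,\ \zeta\cdot e_1>\xi\cdot e_1,\ \zeta\in\mathscr U_0}B^\zeta(x,y)$ and $B^{\xi-}(x,y)=\lim_{\zeta\to\xi,\ \zeta\cdot e_1<\xi\cdot e_1,\ \zeta\in\mathscr U_0}B^\zeta(x,y)$ exist, and for all $x,y,z\in\mathbb{Z}^2$: (i) (cocycle) $B^{\xi\pm}(x,y)=B^{\xi\pm}(x,z)+B^{\xi\pm}(z,y)$; (ii) (ergodicity) the process $\psi^{\xi\pm}_x=(W(x;1),W(x;2),B^{\xi\pm}(x,x+e_1),B^{\xi\pm}(x,x+e_2))$, indexed by $x\in\mathbb{Z}^2,\xi\in\mathscr U$, is stationary and jointly ergodic under lattice translations; (iii) (measurability) $B^{\xi\pm}(x,y)$ is measurable with respect to the weights attached to vertices $z$ with $z\ge x$ or $z\ge y$; (iv) (adaptedness) $\min_{i\in\{1,2\}}\bigl(W(x+e_i;i)-B^{\xi\pm}(x,x+e_i)\bigr)=0$;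 (v) (monotonicity) if $\xi\cdot e_1<\zeta\cdot e_1$ then $B^{\xi-}(x,x+e_1)\le B^{\xi+}(x,x+e_1)\le B^{\zeta-}(x,x+e_1)$ and $B^{\xi-}(x,x+e_2)\ge B^{\xi+}(x,x+e_2)\ge B^{\zeta-}(x,x+e_2)$; (vi) (one-sided continuity) if $\zeta_n\cdot e_1\searrow\xi\cdot e_1$ then $B^{\zeta_n\pm}(x,y)\to B^{\xi+}(x,y)$, and if $\zeta_n\cdot e_1\nearrow\xi\cdot e_1$ then $B^{\zeta_n\pm}(x,y)\to B^{\xi-}(x,y)$; for $\xi\in\mathscr U_0$ these coincide and $\zeta\mapsto B^\zeta(x,y)$ is continuous at $\xi$; (vii) (means) $(\mathbb{E}B^{\xi\pm}(0,e_1),\mathbb{E}B^{\xi\pm}(0,e_2))=\nabla\ell(\xi)$; in particular Busemann functions in two distinct directions have distinct expectations.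
   Context: Directed edge-weight first passage percolation on $\mathbb{Z}^2$: $e_1=(1,0)$, $e_2=(0,1)$, $x\le y$ coordinatewise. Weight $W(x;1)$ sits on edge $(x-e_1,x)$ and $W(x;2)$ on edge $(x-e_2,x)$. $L(x,y)$ is the minimum, over up-right nearest-neighbour paths from $x$ to $y$, of the sum of the edge weights along the path. Standing Assumption: the pairs $(W(x;1),W(x;2))$, $x\in\mathbb{Z}^2$, are i.i.d., non-constant, with $\mathbb{E}|W(0;i)|^{2+\epsilon}<\infty$ for some $\epsilon>0$, and $(0,0)$ is in the support of their joint law. The time constant is the deterministic function $\ell(s,t)=\lim_n L(0,(\lfloor ns\rfloor,\lfloor nt\rfloor))/n$ a.s. on $\mathbb{R}^2_{\ge0}$. $\mathscr U=\{(t,1-t):0<t<1\}$ is the set of directions; $v_n\to\xi\cdot\infty$ means $|v_n|\to\infty$ and $v_n/|v_n|\to\xi$. *)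

theory Defs
  imports "HOL-Probability.Probability"
begin

type_synonym site = "int \<times> int"
type_synonym config = "site \<Rightarrow> real \<times> real"
  (* omega z = (W(z;1), W(z;2)) : the weight pair attached to site z *)

definition e1 :: site where "e1 = (1, 0)"
definition e2 :: site where "e2 = (0, 1)"

definition padd :: "site \<Rightarrow> site \<Rightarrow> site" where
  "padd x y = (fst x + fst y, snd x + snd y)"

definition ple :: "site \<Rightarrow> site \<Rightarrow> bool" where
  "ple x y \<longleftrightarrow> fst x \<le> fst y \<and> snd x \<le> snd y"

definition dirs :: "(real \<times> real) set" where
  "dirs = {(t, 1 - t) | t. 0 < t \<and> t < 1}"

definition W :: "config \<Rightarrow> site \<Rightarrow> nat \<Rightarrow> real" where
  "W \<omega> x i = (if i = 1 then fst (\<omega> x) else snd (\<omega> x))"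

text \<open>Up-right paths encoded as step lists: True = step e1, False = step e2.\<close>
definition stepv :: "bool \<Rightarrow> site" where
  "stepv b = (if b then e1 else e2)"

fun path_end :: "site \<Rightarrow> bool list \<Rightarrow> site" where
  "path_end p [] = p"
| "path_end p (b # s) = path_end (padd p (stepv b)) s"

fun path_wt :: "config \<Rightarrow> site \<Rightarrow> bool list \<Rightarrow> real" where
  "path_wt \<omega> p [] = 0"
| "path_wt \<omega> p (b # s) =
     W \<omega> (padd p (stepv b)) (if b then 1 else 2) + path_wt \<omega> (padd p (stepv b)) s"

text \<open>Passage time L(x,y) (meaningful for x <= y).\<close>
definition passage :: "config \<Rightarrow> site \<Rightarrow> site \<Rightarrow> real" where
  "passage \<omega> x y = Min {path_wt \<omega> x s | s. path_end x s = y}"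

definition norm1 :: "site \<Rightarrow> real" where
  "norm1 v = \<bar>real_of_int (fst v)\<bar> + \<bar>real_of_int (snd v)\<bar>"

definition tends_dir :: "(nat \<Rightarrow> site) \<Rightarrow> real \<times> real \<Rightarrow> bool" where
  "tends_dir v \<xi> \<longleftrightarrow> filterlim (\<lambda>n. norm1 (v n)) at_top sequentially \<and>
     ((\<lambda>n. (real_of_int (fst (v n)) / norm1 (v n), real_of_int (snd (v n)) / norm1 (v n)))
        \<longlongrightarrow> \<xi>) sequentially"

definition standing_assumption :: "(real \<times> real) measure \<Rightarrow> bool" where
  "standing_assumption \<mu> \<longleftrightarrow>
     prob_space \<mu> \<and> sets \<mu> = sets borel \<and>
     (\<forall>c. measure \<mu> {c} \<noteq> 1) \<and>
     (\<exists>\<epsilon>>0. integrable \<mu> (\<lambda>w. \<bar>fst w\<bar> powr (2 + \<epsilon>)) \<and>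
             integrable \<mu> (\<lambda>w. \<bar>snd w\<bar> powr (2 + \<epsilon>))) \<and>
     (\<forall>r>0. emeasure \<mu> (ball (0, 0) r) > 0)"

definition weight_space :: "(real \<times> real) measure \<Rightarrow> config measure" where
  "weight_space \<mu> = PiM UNIV (\<lambda>_. \<mu>)"

definition is_time_constant :: "(real \<times> real) measure \<Rightarrow> (real \<times> real \<Rightarrow> real) \<Rightarrow> bool" where
  "is_time_constant \<mu> ell \<longleftrightarrow> (\<forall>s t. 0 \<le> s \<longrightarrow> 0 \<le> t \<longrightarrow>
     (AE \<omega> in weight_space \<mu>.
        ((\<lambda>n. passage \<omega> (0, 0) (\<lfloor>real n * s\<rfloor>, \<lfloor>real n * t\<rfloor>) / real n) \<longlongrightarrow> ell (s, t))
          sequentially))"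

definition strictly_convex_on :: "(real \<times> real) set \<Rightarrow> (real \<times> real \<Rightarrow> real) \<Rightarrow> bool" where
  "strictly_convex_on S f \<longleftrightarrow> (\<forall>a\<in>S. \<forall>b\<in>S. \<forall>u::real. a \<noteq> b \<longrightarrow> 0 < u \<longrightarrow> u < 1 \<longrightarrow>
     f (u *\<^sub>R a + (1 - u) *\<^sub>R b) < u * f a + (1 - u) * f b)"

definition quadrant_sigma :: "(real \<times> real) measure \<Rightarrow> site \<Rightarrow> site \<Rightarrow> config measure" where
  "quadrant_sigma \<mu> x y =
     vimage_algebra (space (weight_space \<mu>))
       (\<lambda>\<omega>. restrict \<omega> {z. ple x z \<or> ple y z}) (PiM {z. ple x z \<or> ple y z} (\<lambda>_. \<mu>))"

text \<open>Index set of the process psi: (x, xi, sign), sign True = '+', False = '-'.\<close>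
definition psi_index :: "(site \<times> (real \<times> real) \<times> bool) set" where
  "psi_index = UNIV \<times> dirs \<times> UNIV"

definition psi_space :: "(site \<times> (real \<times> real) \<times> bool \<Rightarrow> real \<times> real \<times> real \<times> real) measure" where
  "psi_space = PiM psi_index (\<lambda>_. borel)"

definition psi_shift :: "site \<Rightarrow> (site \<times> (real \<times> real) \<times> bool \<Rightarrow> real \<times> real \<times> real \<times> real)
     \<Rightarrow> (site \<times> (real \<times> real) \<times> bool \<Rightarrow> real \<times> real \<times> real \<times> real)" where
  "psi_shift z f = (\<lambda>(x, \<xi>, s) \<in> psi_index. f (padd x z, \<xi>, s))"

definition psi :: "(config \<Rightarrow> real \<times> real \<Rightarrow> site \<Rightarrow> site \<Rightarrow> real) \<Rightarrow>
                  (config \<Rightarrow> real \<times> real \<Rightarrow> site \<Rightarrow> site \<Rightarrow> real) \<Rightarrow>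
                  config \<Rightarrow> (site \<times> (real \<times> real) \<times> bool \<Rightarrow> real \<times> real \<times> real \<times> real)" where
  "psi Bp Bm \<omega> = (\<lambda>(x, \<xi>, s) \<in> psi_index.
     (W \<omega> x 1, W \<omega> x 2,
      (if s then Bp else Bm) \<omega> \<xi> x (padd x e1),
      (if s then Bp else Bm) \<omega> \<xi> x (padd x e2)))"

end

theory Submission
  imports Defs
begin

text \<open>
  For a target \<open>v\<close> far away in direction \<open>\<eta>\<close>, the increments \<open>B(x, y) = L(x, v) - L(y, v)\<close> form a
  cocycle with \<open>B \<le> L\<close>. Since \<open>L - B\<close> is nonnegative and has small mean along the ray of \<open>\<eta>\<close>, a
  maximal inequality shows that, for most targets, \<open>B(- n \<eta>, 0)\<close> is close to \<open>n \<ell>(\<eta>)\<close> for all \<open>n\<close>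
  at once. A geodesic from \<open>0\<close> to \<open>v\<close> that meets the ray of \<open>u\<close> near \<open>n u\<close> would therefore force
  \<open>n (\<ell>(\<eta>) + \<ell>(u)) \<le> n \<ell>(\<eta> + u) + o(n)\<close>, against strict convexity. So geodesics to far targets stay
  on their side of a ray, and crossing paths show that increments towards targets in direction \<open>\<xi>\<close>
  are eventually below those towards a direction to the right of \<open>\<xi>\<close>. Hence the limits exist
  wherever a random monotone function of the direction is continuous. Fatou's lemma along a
  staircase bounds its mean from below, subadditivity bounds it from above, and together they make
  the mean a tangent vector of \<open>\<ell>\<close>; by differentiability the mean is continuous in the direction, so
  each fixed direction is almost surely a continuity point. Ergodicity follows from the mixing of
  the i.i.d. weights, because the Busemann functions are functionals of the weights that commute
  with shifts.
\<close>

text \<open>Three obstacles shape the construction. The maximal inequality controls targets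
  \<open>k \<eta> + c\<close> only on average over \<open>k\<close>; this suffices because one good
  target beyond a finite box decides all comparisons inside the box, and the box can then grow with
  the constants fixed. Almost sure statements must hold for uncountably many directions and all
  sequences at once; they are derived from countably many lattice cones and spread by monotonicity,
  and the random function of the direction is a limsup along one fixed sequence per direction,
  defined before any limit is known to exist. Finally, the mean is at first a tangent vector only
  where it is continuous, while continuity is what is wanted: one-sided limits of tangent vectors
  are again tangent vectors, and differentiability leaves only one. Squares \<open>i^2\<close>
  appear as indices because second moments then give summable probabilities. Weights may be
  negative, so nonnegative quantities come from the triangle inequality or from absolute
  values.\<close>

section \<open>Lattice order, up-right paths and passage times\<close>

definition upleft :: "site \<Rightarrow> site \<Rightarrow> bool" where
  "upleft x y \<longleftrightarrow> fst x \<le> fst y \<and> snd y \<le> snd x"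

lemma padd_eq: "padd x y = x + y"
  by (simp add: padd_def plus_prod_def)

lemma ple_refl [simp]: "ple x x"
  by (simp add: ple_def)

lemma ple_trans: "ple x y \<Longrightarrow> ple y z \<Longrightarrow> ple x z"
  by (auto simp: ple_def)

lemma ple_add: "ple 0 y \<Longrightarrow> ple x (x + y)"
  by (auto simp: ple_def)

lemma fst_stepv [simp]: "fst (stepv b) = (if b then 1 else 0)"
  and snd_stepv [simp]: "snd (stepv b) = (if b then 0 else 1)"
  by (auto simp: stepv_def e1_def e2_def)

lemma ple_stepv: "ple x (x + stepv b)"
  by (auto simp: ple_def)

lemma path_end_append: "path_end x (s @ t) = path_end (path_end x s) t"
  by (induction s arbitrary: x) auto

lemma path_wt_append: "path_wt \<omega> x (s @ t) = path_wt \<omega> x s + path_wt \<omega> (path_end x s) t"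
  by (induction s arbitrary: x) auto

lemma path_end_ple: "ple x (path_end x s)"
proof (induction s arbitrary: x)
  case (Cons b s)
  then show ?case
    using ple_trans[OF ple_stepv[of x b]] by (simp add: padd_eq)
qed auto

lemma path_end_level:
  "fst (path_end x s) + snd (path_end x s) = fst x + snd x + int (length s)"
  by (induction s arbitrary: x) (auto simp: padd_eq)

lemma finite_paths: "finite {s. path_end x s = y}"
proof (rule finite_subset)
  have "length s = nat (fst y + snd y - fst x - snd x)" if "path_end x s = y" for s
    using path_end_level[of x s] that by auto
  then show "{s. path_end x s = y}
      \<subseteq> {s. set s \<subseteq> UNIV \<and> length s = nat (fst y + snd y - fst x - snd x)}"
    by auto
  show "finite \<dots>"
    by (rule finite_lists_length_eq) auto
qed

lemma path_end_replicate_True: "path_end x (replicate n True) = x + (int n, 0)"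
  by (induction n arbitrary: x) (auto simp: padd_eq prod_eq_iff)

lemma path_end_replicate_False: "path_end x (replicate n False) = x + (0, int n)"
  by (induction n arbitrary: x) (auto simp: padd_eq prod_eq_iff)

definition corner :: "site \<Rightarrow> bool list" where
  "corner v = replicate (nat (fst v)) True @ replicate (nat (snd v)) False"

lemma path_end_corner: "ple 0 v \<Longrightarrow> path_end x (corner v) = x + v"
  by (auto simp: corner_def path_end_append path_end_replicate_True path_end_replicate_False
      ple_def prod_eq_iff)

lemma ex_path:
  assumes "ple x y" obtains s where "path_end x s = y"
proof
  show "path_end x (corner (y - x)) = y"
    using assms by (subst path_end_corner) (auto simp: ple_def)
qed

lemma passage_eq: "passage \<omega> x y = Min (path_wt \<omega> x ` {s. path_end x s = y})"
  unfolding passage_def by (simp add: setcompr_eq_image)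

lemma passage_le: "path_end x s = y \<Longrightarrow> passage \<omega> x y \<le> path_wt \<omega> x s"
  unfolding passage_eq by (intro Min_le) (auto simp: finite_paths)

lemma passage_attained:
  assumes "ple x y"
  obtains s where "path_end x s = y" "passage \<omega> x y = path_wt \<omega> x s"
proof -
  obtain s0 where "path_end x s0 = y" using ex_path[OF assms] .
  then have "passage \<omega> x y \<in> path_wt \<omega> x ` {s. path_end x s = y}"
    unfolding passage_eq by (intro Min_in) (auto simp: finite_paths)
  then show ?thesis using that by auto
qed

lemma passage_triangle:
  assumes "ple x y" "ple y z"
  shows "passage \<omega> x z \<le> passage \<omega> x y + passage \<omega> y z"
proof -
  obtain s t where s: "path_end x s = y" "passage \<omega> x y = path_wt \<omega> x s"
    and t: "path_end y t = z" "passage \<omega> y z = path_wt \<omega> y t"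
    using passage_attained assms by metis
  then show ?thesis
    using passage_le[of x "s @ t" z \<omega>] by (simp add: path_end_append path_wt_append)
qed

lemma passage_refl [simp]: "passage \<omega> x x = 0"
proof -
  have "s = []" if "path_end x s = x" for s
    using path_end_level[of x s] that by auto
  then have "{s. path_end x s = x} = {[]}" by auto
  then show ?thesis by (simp add: passage_eq)
qed

text \<open>Both pieces of an optimal path are optimal, since a cheaper piece would lower the total.
  Crossing and avoidance arguments use geodesics only through this additivity at their
  vertices.\<close>

lemma geodesic_split:
  assumes "path_end x (s @ t) = z" "passage \<omega> x z = path_wt \<omega> x (s @ t)" "path_end x s = y"
  shows "passage \<omega> x z = passage \<omega> x y + passage \<omega> y z"
proof -
  have "passage \<omega> x y + passage \<omega> y z \<le> path_wt \<omega> x s + path_wt \<omega> y t"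
    using assms by (intro add_mono passage_le) (auto simp: path_end_append)
  moreover have "passage \<omega> x z \<le> passage \<omega> x y + passage \<omega> y z"
    using assms path_end_ple[of x s] path_end_ple[of y t]
    by (intro passage_triangle) (auto simp: path_end_append)
  ultimately show ?thesis
    using assms by (auto simp: path_wt_append)
qed

lemma passage_step: "passage \<omega> x (x + e1) = fst (\<omega> (x + e1))"
  "passage \<omega> x (x + e2) = snd (\<omega> (x + e2))"
proof -
  have *: "{s. path_end x s = x + stepv b} = {[b]}" for b
  proof -
    have "s = [b]" if "path_end x s = x + stepv b" for s
    proof -
      have "length s = 1"
        using path_end_level[of x s] that by (auto split: if_splits)
      then obtain c where "s = [c]" by (auto simp: length_Suc_conv)
      then show ?thesis using that
        by (auto simp: padd_eq stepv_def e1_def e2_def split: if_splits)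
    qed
    then show ?thesis by (auto simp: padd_eq)
  qed
  show "passage \<omega> x (x + e1) = fst (\<omega> (x + e1))"
    using *[of True] by (simp add: passage_eq stepv_def padd_eq W_def)
  show "passage \<omega> x (x + e2) = snd (\<omega> (x + e2))"
    using *[of False] by (simp add: passage_eq stepv_def padd_eq W_def)
qed

text \<open>Decomposition by the first step. Both inequalities are strict so that both neighbours of
  \<open>x\<close> can still reach \<open>v\<close>; in the limit this becomes the adaptedness of
  the Busemann functions.\<close>

lemma passage_rec:
  assumes "fst x < fst v" "snd x < snd v"
  shows "passage \<omega> x v =
    min (W \<omega> (padd x e1) 1 + passage \<omega> (padd x e1) v) (W \<omega> (padd x e2) 2 + passage \<omega> (padd x e2) v)"
    (is "_ = min ?a ?b")
proof (rule antisym)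
  have "passage \<omega> x v \<le> ?a"
    using passage_triangle[of x "x + e1" v \<omega>] passage_step[of \<omega> x] assms
    by (simp add: ple_def e1_def padd_eq W_def)
  moreover have "passage \<omega> x v \<le> ?b"
    using passage_triangle[of x "x + e2" v \<omega>] passage_step[of \<omega> x] assms
    by (simp add: ple_def e2_def padd_eq W_def)
  ultimately show "passage \<omega> x v \<le> min ?a ?b" by simp
  obtain s where s: "path_end x s = v" "passage \<omega> x v = path_wt \<omega> x s"
    using passage_attained[of x v] assms by (auto simp: ple_def)
  from s assms obtain b t where t: "s = b # t" by (cases s) auto
  have "passage \<omega> (padd x (stepv b)) v \<le> path_wt \<omega> (padd x (stepv b)) t"
    using s t by (intro passage_le) auto
  then show "min ?a ?b \<le> passage \<omega> x v"
    using s(2) t by (cases b) (auto simp: stepv_def min_le_iff_disj)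
qed

subsection \<open>Crossing paths\<close>

text \<open>The starting points and the end points are in opposite order transversally to the paths,
  so planarity forces a common vertex. The induction advances the lower-right path while
  \<open>p\<close> is strictly higher, and the upper-left path when the heights agree: a unit step
  then cannot reverse the order, so no meeting is jumped over.\<close>

lemma paths_cross:
  assumes "upleft p p'" "upleft (path_end p' t) (path_end p s)"
  shows "\<exists>s1 s2 t1 t2. s = s1 @ s2 \<and> t = t1 @ t2 \<and> path_end p s1 = path_end p' t1"
  using assms
proof (induction "length s + length t" arbitrary: p p' s t rule: less_induct)
  case less
  consider "p = p'" | "p \<noteq> p'" "snd p > snd p'" | "p \<noteq> p'" "snd p = snd p'" "fst p < fst p'"
    using less.prems(1) by (force simp: upleft_def prod_eq_iff)
  then show ?case
  proof cases
    case 1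
    then have "s = [] @ s \<and> t = [] @ t \<and> path_end p [] = path_end p' []" by simp
    then show ?thesis by blast
  next
    case 2
    \<comment> \<open>An empty \<open>t\<close> would put the end of the other path at height at
      most \<open>snd p' < snd p\<close>, although that path never descends.\<close>
    obtain b t' where t: "t = b # t'"
      using 2 less.prems(2) path_end_ple[of p s] by (cases t) (auto simp: upleft_def ple_def)
    have "upleft p (padd p' (stepv b))"
      using 2 less.prems(1) by (auto simp: upleft_def padd_eq)
    then have "\<exists>s1 s2 t1 t2. s = s1 @ s2 \<and> t' = t1 @ t2
        \<and> path_end p s1 = path_end (padd p' (stepv b)) t1"
      using less.prems(2) t by (intro less.hyps) auto
    then obtain s1 s2 t1 t2 where "s = s1 @ s2" "t' = t1 @ t2"
        "path_end p s1 = path_end (padd p' (stepv b)) t1" by blast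
    then have "s = s1 @ s2 \<and> t = (b # t1) @ t2 \<and> path_end p s1 = path_end p' (b # t1)"
      using t by simp
    then show ?thesis by blast
  next
    case 3
    obtain b s' where s: "s = b # s'"
      using 3 less.prems(2) path_end_ple[of p' t] by (cases s) (auto simp: upleft_def ple_def)
    have "upleft (padd p (stepv b)) p'"
      using 3 less.prems(1) by (auto simp: upleft_def padd_eq)
    then have "\<exists>s1 s2 t1 t2. s' = s1 @ s2 \<and> t = t1 @ t2
        \<and> path_end (padd p (stepv b)) s1 = path_end p' t1"
      using less.prems(2) s by (intro less.hyps) auto
    then obtain s1 s2 t1 t2 where "s' = s1 @ s2" "t = t1 @ t2"
        "path_end (padd p (stepv b)) s1 = path_end p' t1" by blast
    then have "s = (b # s1) @ s2 \<and> t = t1 @ t2 \<and> path_end p (b # s1) = path_end p' t1"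
      using s by simp
    then show ?thesis by blast
  qed
qed

text \<open>The two geodesics share a vertex \<open>z\<close>; exchanging their tails there gives
  paths from \<open>p\<close> to \<open>q'\<close> and from \<open>p'\<close> to \<open>q\<close>
  with the same total weight.\<close>

lemma passage_swap_at_crossing:
  assumes cross: "upleft p p'" "upleft q' q"
    and g: "ple p q" "ple p' q'"
  shows "passage \<omega> p q' + passage \<omega> p' q \<le> passage \<omega> p q + passage \<omega> p' q'"
proof -
  obtain s where s: "path_end p s = q" "passage \<omega> p q = path_wt \<omega> p s"
    using passage_attained[OF g(1)] .
  obtain t where t: "path_end p' t = q'" "passage \<omega> p' q' = path_wt \<omega> p' t"
    using passage_attained[OF g(2)] .
  obtain s1 s2 t1 t2 where *: "s = s1 @ s2" "t = t1 @ t2" "path_end p s1 = path_end p' t1"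
    using paths_cross[of p p' t s] cross unfolding s(1) t(1) by blast
  define z where "z = path_end p s1"
  have z: "path_end p' t1 = z" using * by (simp add: z_def)
  have "passage \<omega> p q = passage \<omega> p z + passage \<omega> z q"
    using s * by (intro geodesic_split[of _ s1 s2]) (auto simp: z_def)
  moreover have "passage \<omega> p' q' = passage \<omega> p' z + passage \<omega> z q'"
    using t * z by (intro geodesic_split[of _ t1 t2]) simp_all
  moreover have "ple p z" "ple p' z"
    using path_end_ple[of p s1] path_end_ple[of p' t1] z by (auto simp: z_def)
  moreover have "ple z q" "ple z q'"
    using path_end_ple[of z s2] path_end_ple[of z t2] s(1) t(1) *(1,2) z z_def
    by (simp_all add: path_end_append)
  ultimately show ?thesis
    using passage_triangle[of p z q' \<omega>] passage_triangle[of p' z q \<omega>] by linarith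
qed

text \<open>Here \<open>q\<close> lies on a geodesic from \<open>x\<close> to \<open>v'\<close> and
  on the lower right of \<open>v\<close>, so that geodesic crosses any path from \<open>y\<close> to
  \<open>v\<close> before \<open>q\<close>. The crossing transfers the increment from the target
  \<open>v\<close> to the target \<open>v'\<close>.\<close>

lemma passage_compare_left:
  assumes "upleft x y" "ple x q" "ple q v'" "ple y v" "upleft v q"
    and geo: "passage \<omega> x v' = passage \<omega> x q + passage \<omega> q v'"
  shows "passage \<omega> x v - passage \<omega> y v \<le> passage \<omega> x v' - passage \<omega> y v'"
proof -
  have "passage \<omega> x v + passage \<omega> y q \<le> passage \<omega> x q + passage \<omega> y v"
    using assms by (intro passage_swap_at_crossing) auto
  moreover have "ple y q"
    using assms by (auto simp: ple_def upleft_def)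
  then have "passage \<omega> y v' \<le> passage \<omega> y q + passage \<omega> q v'"
    using assms by (intro passage_triangle) auto
  ultimately show ?thesis using geo by linarith
qed

text \<open>The mirror case: the geodesic starts at \<open>y\<close> and passes on the upper left of
  \<open>w\<close>.\<close>

lemma passage_compare_right:
  assumes "upleft x y" "ple y q" "ple q v'" "ple x w" "upleft q w"
    and geo: "passage \<omega> y v' = passage \<omega> y q + passage \<omega> q v'"
  shows "passage \<omega> x v' - passage \<omega> y v' \<le> passage \<omega> x w - passage \<omega> y w"
proof -
  have "passage \<omega> x q + passage \<omega> y w \<le> passage \<omega> x w + passage \<omega> y q"
    using assms by (intro passage_swap_at_crossing) auto
  moreover have "ple x q"
    using assms by (auto simp: ple_def upleft_def)
  then have "passage \<omega> x v' \<le> passage \<omega> x q + passage \<omega> q v'"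
    using assms by (intro passage_triangle) auto
  ultimately show ?thesis using geo by linarith
qed

subsection \<open>Shifts\<close>

definition shift :: "site \<Rightarrow> config \<Rightarrow> config" where
  "shift z \<omega> = (\<lambda>x. \<omega> (x + z))"

lemma path_end_shift: "path_end (x + z) s = path_end x s + z"
proof (induction s arbitrary: x)
  case (Cons b s)
  have *: "x + z + stepv b = x + stepv b + z" by (simp add: algebra_simps)
  show ?case unfolding path_end.simps padd_eq * by (rule Cons)
qed auto

lemma path_wt_shift: "path_wt (shift z \<omega>) x s = path_wt \<omega> (x + z) s"
proof (induction s arbitrary: x)
  case (Cons b s)
  have *: "x + z + stepv b = x + stepv b + z" by (simp add: algebra_simps)
  show ?case unfolding path_wt.simps padd_eq * Cons by (simp add: shift_def W_def)
qed auto

lemma passage_shift: "passage (shift z \<omega>) x y = passage \<omega> (x + z) (y + z)"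
  unfolding passage_eq by (simp add: path_wt_shift path_end_shift)

text \<open>The weight at the starting vertex is never collected, hence \<open>z \<noteq> x\<close>.
  This is what makes rectangles that touch at a corner independent.\<close>

lemma path_wt_cong:
  assumes "\<And>z. ple x z \<Longrightarrow> z \<noteq> x \<Longrightarrow> ple z (path_end x s) \<Longrightarrow> \<omega> z = \<omega>' z"
  shows "path_wt \<omega> x s = path_wt \<omega>' x s"
  using assms
proof (induction s arbitrary: x)
  case (Cons b s)
  let ?y = "x + stepv b"
  have "?y \<noteq> x" by (cases b) (auto simp: stepv_def e1_def e2_def prod_eq_iff)
  then have "\<omega> ?y = \<omega>' ?y"
    using path_end_ple[of ?y s] by (intro Cons.prems) (auto simp: ple_stepv padd_eq)
  moreover have "path_wt \<omega> ?y s = path_wt \<omega>' ?y s"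
  proof (intro Cons.IH Cons.prems)
    fix z assume z: "ple ?y z" "z \<noteq> ?y" "ple z (path_end ?y s)"
    show "ple x z" using z(1) ple_trans ple_stepv by blast
    show "z \<noteq> x" using z(1) by (auto simp: ple_def split: if_splits)
    show "ple z (path_end x (b # s))" using z by (simp add: padd_eq)
  qed
  ultimately show ?case by (simp add: padd_eq W_def)
qed simp

lemma passage_cong:
  assumes "\<And>z. ple x z \<Longrightarrow> z \<noteq> x \<Longrightarrow> ple z y \<Longrightarrow> \<omega> z = \<omega>' z"
  shows "passage \<omega> x y = passage \<omega>' x y"
  unfolding passage_eq using assms by (intro arg_cong[of _ _ Min] image_cong path_wt_cong) auto

text \<open>The last summand covers the empty set, where \<open>Min\<close> is an unspecified
  constant; thus passage times are integrable for all pairs of sites, comparable or not.\<close>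

lemma abs_Min_le_sum:
  fixes f :: "'a \<Rightarrow> real"
  assumes "finite A"
  shows "\<bar>Min (f ` A)\<bar> \<le> (\<Sum>a\<in>A. \<bar>f a\<bar>) + \<bar>Min {}\<bar>"
proof (cases "A = {}")
  case False
  then have "Min (f ` A) \<in> f ` A" using assms by (intro Min_in) auto
  then obtain a where "a \<in> A" "Min (f ` A) = f a" by auto
  then show ?thesis
    using member_le_sum[of a A "\<lambda>a. \<bar>f a\<bar>"] assms by auto
qed auto

lemma fst_borel [measurable]: "fst \<in> borel_measurable (borel :: (real \<times> real) measure)"
  and snd_borel [measurable]: "snd \<in> borel_measurable (borel :: (real \<times> real) measure)"
  by (intro borel_measurable_continuous_onI continuous_on_fst continuous_on_snd continuous_on_id)+

section \<open>The space of i.i.d. weights\<close>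

locale fpp_weights =
  fixes \<mu> :: "(real \<times> real) measure"
  assumes SA: "standing_assumption \<mu>"
begin

abbreviation "M \<equiv> weight_space \<mu>"

lemma prob_mu: "prob_space \<mu>"
  using SA by (simp add: standing_assumption_def)

lemma sets_mu [measurable_cong]: "sets \<mu> = sets borel"
  using SA by (simp add: standing_assumption_def)

lemma space_mu [simp]: "space \<mu> = UNIV"
  using sets_eq_imp_space_eq[OF sets_mu] by simp

end

sublocale fpp_weights \<subseteq> prod: product_prob_space "\<lambda>_::site. \<mu>" UNIV
proof -
  interpret prob_space \<mu> by (rule prob_mu)
  show "product_prob_space (\<lambda>_::site. \<mu>)" by unfold_locales
qed

sublocale fpp_weights \<subseteq> prob_space "weight_space \<mu>"
  unfolding weight_space_def by (rule prob_space_PiM) (rule prob_mu)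

context fpp_weights
begin

lemma space_M [simp]: "space M = UNIV"
  by (simp add: weight_space_def space_PiM)

lemma measurable_coord:
  assumes "z \<in> K" shows "(\<lambda>\<omega>. \<omega> z) \<in> PiM K (\<lambda>_. \<mu>) \<rightarrow>\<^sub>M borel"
proof -
  have "(\<lambda>\<omega>. \<omega> z) \<in> PiM K (\<lambda>_. \<mu>) \<rightarrow>\<^sub>M \<mu>" using assms by simp
  then show ?thesis by (simp add: measurable_cong_sets[OF refl sets_mu])
qed

lemma measurable_W:
  assumes "z \<in> K" shows "(\<lambda>\<omega>. W \<omega> z i) \<in> borel_measurable (PiM K (\<lambda>_. \<mu>))"
  unfolding W_def using measurable_compose[OF measurable_coord[OF assms] fst_borel]
    measurable_compose[OF measurable_coord[OF assms] snd_borel]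
  by auto

lemma path_wt_measurable_PiM:
  assumes "{z. ple x z \<and> z \<noteq> x \<and> ple z (path_end x s)} \<subseteq> K"
  shows "(\<lambda>\<omega>. path_wt \<omega> x s) \<in> borel_measurable (PiM K (\<lambda>_. \<mu>))"
  using assms
proof (induction s arbitrary: x)
  case (Cons b s)
  let ?y = "x + stepv b"
  have "?y \<noteq> x" by (cases b) (auto simp: stepv_def e1_def e2_def prod_eq_iff)
  then have "?y \<in> K"
    using path_end_ple[of ?y s] Cons.prems by (auto simp: ple_stepv padd_eq)
  moreover have "{z. ple ?y z \<and> z \<noteq> ?y \<and> ple z (path_end ?y s)} \<subseteq> K"
  proof safe
    fix u v assume z: "ple ?y (u,v)" "(u,v) \<noteq> ?y" "ple (u,v) (path_end ?y s)"
    have "ple x (u,v)" using z(1) ple_trans ple_stepv by blast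
    moreover have "(u,v) \<noteq> x" using z(1) by (auto simp: ple_def split: if_splits)
    ultimately show "(u,v) \<in> K" using z Cons.prems by (auto simp: padd_eq)
  qed
  ultimately show ?case
    using Cons.IH[of ?y] by (auto simp: padd_eq intro!: borel_measurable_add measurable_W)
qed simp

text \<open>The index set \<open>K\<close> is kept free: \<open>UNIV\<close> gives measurability on
  the whole space, a single rectangle gives independence, and a union of two quadrants gives the
  measurability asked of the Busemann functions.\<close>

lemma passage_measurable_PiM:
  assumes "{z. ple x z \<and> z \<noteq> x \<and> ple z y} \<subseteq> K"
  shows "(\<lambda>\<omega>. passage \<omega> x y) \<in> borel_measurable (PiM K (\<lambda>_. \<mu>))"
  unfolding passage_eq using assms
  by (intro borel_measurable_Min finite_paths path_wt_measurable_PiM) auto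

lemma passage_measurable [measurable]: "(\<lambda>\<omega>. passage \<omega> x y) \<in> borel_measurable M"
  unfolding weight_space_def by (rule passage_measurable_PiM) auto

lemma W_measurable [measurable]: "(\<lambda>\<omega>. W \<omega> x i) \<in> borel_measurable M"
  unfolding weight_space_def by (rule measurable_W) auto

lemma shift_measurable [measurable]: "shift z \<in> M \<rightarrow>\<^sub>M M"
  unfolding weight_space_def shift_def
  by (rule measurable_PiM_single') (auto simp: space_PiM)

lemma distr_shift: "distr M M (shift z) = M"
proof -
  have "distr (PiM UNIV (\<lambda>_::site. \<mu>)) (PiM UNIV (\<lambda>_. \<mu>)) (\<lambda>\<omega>. \<lambda>n\<in>UNIV. \<omega> (n + z)) = PiM UNIV (\<lambda>_. \<mu>)"
    by (rule distr_PiM_reindex) (auto simp: prob_mu inj_on_def)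
  then show ?thesis by (simp add: weight_space_def shift_def[abs_def] restrict_UNIV)
qed

lemma AE_shift:
  assumes "AE \<omega> in M. P \<omega>" shows "AE \<omega> in M. P (shift z \<omega>)"
  by (rule AE_distrD[of "shift z" M M]) (unfold distr_shift, use assms in \<open>simp_all\<close>)

lemma prob_shift:
  assumes [measurable]: "A \<in> sets M" shows "prob {\<omega>. shift z \<omega> \<in> A} = prob A"
proof -
  have "prob A = measure (distr M M (shift z)) A" by (simp add: distr_shift)
  also have "\<dots> = prob {\<omega>. shift z \<omega> \<in> A}"
    by (subst measure_distr) (auto simp: vimage_def)
  finally show ?thesis by simp
qed

lemma integral_shift:
  fixes f :: "config \<Rightarrow> real"
  assumes [measurable]: "f \<in> borel_measurable M"
  shows "expectation (\<lambda>\<omega>. f (shift z \<omega>)) = expectation f"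
  using integral_distr[of "shift z" M M f] by (simp add: distr_shift)

lemma integrable_shift_iff:
  fixes f :: "config \<Rightarrow> real"
  assumes [measurable]: "f \<in> borel_measurable M"
  shows "integrable M (\<lambda>\<omega>. f (shift z \<omega>)) \<longleftrightarrow> integrable M f"
  using integrable_distr_eq[of "shift z" M M f] by (simp add: distr_shift)

subsection \<open>Square integrability\<close>

text \<open>Measurability is included because it does not follow from integrability of the
  square.\<close>

definition sq_integrable :: "(config \<Rightarrow> real) \<Rightarrow> bool" where
  "sq_integrable f \<longleftrightarrow> f \<in> borel_measurable M \<and> integrable M (\<lambda>\<omega>. (f \<omega>)\<^sup>2)"

lemma sq_integrable_bound:
  assumes "sq_integrable g" "f \<in> borel_measurable M" "\<And>\<omega>. \<bar>f \<omega>\<bar> \<le> \<bar>g \<omega>\<bar>"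
  shows "sq_integrable f"
  unfolding sq_integrable_def
proof
  show "integrable M (\<lambda>\<omega>. (f \<omega>)\<^sup>2)"
    using assms(1) assms(2)
    by (rule_tac Bochner_Integration.integrable_bound[of _ "\<lambda>\<omega>. (g \<omega>)\<^sup>2"])
       (auto simp: sq_integrable_def abs_le_square_iff[symmetric] assms(3))
qed fact

lemma sq_integrable_add:
  assumes "sq_integrable f" "sq_integrable g"
  shows "sq_integrable (\<lambda>\<omega>. f \<omega> + g \<omega>)"
proof -
  have [measurable]: "f \<in> borel_measurable M" "g \<in> borel_measurable M"
    using assms by (auto simp: sq_integrable_def)
  have i: "integrable M (\<lambda>\<omega>. 2 * (f \<omega>)\<^sup>2 + 2 * (g \<omega>)\<^sup>2)"
    using assms by (intro Bochner_Integration.integrable_add integrable_mult_right)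
      (auto simp: sq_integrable_def)
  have "(f \<omega> + g \<omega>)\<^sup>2 \<le> 2 * (f \<omega>)\<^sup>2 + 2 * (g \<omega>)\<^sup>2" for \<omega>
    using zero_le_power2[of "f \<omega> - g \<omega>"] by (simp add: power2_sum power2_diff)
  then have "norm ((f \<omega> + g \<omega>)\<^sup>2) \<le> norm (2 * (f \<omega>)\<^sup>2 + 2 * (g \<omega>)\<^sup>2)" for \<omega>
    by (metis abs_of_nonneg order_trans real_norm_def zero_le_power2)
  then have "integrable M (\<lambda>\<omega>. (f \<omega> + g \<omega>)\<^sup>2)"
    by (intro Bochner_Integration.integrable_bound[OF i] AE_I2) measurable
  then show ?thesis by (simp add: sq_integrable_def)
qed

lemma sq_integrable_const: "sq_integrable (\<lambda>_. c)"
  by (simp add: sq_integrable_def)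

lemma sq_integrable_sum:
  "finite I \<Longrightarrow> (\<And>i. i \<in> I \<Longrightarrow> sq_integrable (f i)) \<Longrightarrow> sq_integrable (\<lambda>\<omega>. \<Sum>i\<in>I. f i \<omega>)"
  by (induction I rule: finite_induct) (auto intro: sq_integrable_add sq_integrable_const)

lemma sq_integrable_abs: "sq_integrable f \<Longrightarrow> sq_integrable (\<lambda>\<omega>. \<bar>f \<omega>\<bar>)"
  by (auto simp: sq_integrable_def)

lemma sq_integrable_imp_integrable: "sq_integrable f \<Longrightarrow> integrable M f"
  unfolding sq_integrable_def by (auto intro: square_integrable_imp_integrable)

lemma integrable_square_mu: "integrable \<mu> (\<lambda>w. (fst w)\<^sup>2)" "integrable \<mu> (\<lambda>w. (snd w)\<^sup>2)"
proof -
  interpret mu: prob_space \<mu> by (rule prob_mu)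
  obtain e where e: "e > 0" and
    i: "integrable \<mu> (\<lambda>w. \<bar>fst w\<bar> powr (2 + e))" "integrable \<mu> (\<lambda>w. \<bar>snd w\<bar> powr (2 + e))"
    using SA by (auto simp: standing_assumption_def)
  have *: "x\<^sup>2 \<le> 1 + \<bar>x\<bar> powr (2 + e)" for x :: real
  proof (cases "\<bar>x\<bar> \<le> 1")
    case True
    then have "x\<^sup>2 \<le> 1" by (simp add: abs_square_le_1)
    then show ?thesis by (simp add: add_increasing2)
  next
    case False
    then have "\<bar>x\<bar> powr 2 \<le> \<bar>x\<bar> powr (2 + e)" using e by (intro powr_mono) auto
    then show ?thesis using False by (simp add: powr_numeral)
  qed
  show "integrable \<mu> (\<lambda>w. (fst w)\<^sup>2)"
    by (rule Bochner_Integration.integrable_bound[of _ "\<lambda>w. 1 + \<bar>fst w\<bar> powr (2 + e)"])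
       (use i * in \<open>auto simp: measurable_cong_sets[OF sets_mu refl]\<close>)
  show "integrable \<mu> (\<lambda>w. (snd w)\<^sup>2)"
    by (rule Bochner_Integration.integrable_bound[of _ "\<lambda>w. 1 + \<bar>snd w\<bar> powr (2 + e)"])
       (use i * in \<open>auto simp: measurable_cong_sets[OF sets_mu refl]\<close>)
qed

lemma distr_coord: "distr M \<mu> (\<lambda>\<omega>. \<omega> z) = \<mu>"
  unfolding weight_space_def by (rule distr_PiM_component) (auto simp: prob_mu)

lemma coord_measurable [measurable]: "(\<lambda>\<omega>. \<omega> z) \<in> M \<rightarrow>\<^sub>M \<mu>"
  unfolding weight_space_def by simp

lemma sq_integrable_W: "sq_integrable (\<lambda>\<omega>. W \<omega> z i)"
proof -
  have "integrable M (\<lambda>\<omega>. (fst (\<omega> z))\<^sup>2)"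
    using integrable_square_mu(1) by (subst (asm) distr_coord[of z, symmetric]) (auto dest: integrable_distr[OF coord_measurable])
  moreover have "integrable M (\<lambda>\<omega>. (snd (\<omega> z))\<^sup>2)"
    using integrable_square_mu(2) by (subst (asm) distr_coord[of z, symmetric]) (auto dest: integrable_distr[OF coord_measurable])
  ultimately show ?thesis
    using W_measurable[of z i] by (cases "i = 1") (auto simp: sq_integrable_def W_def)
qed

lemma sq_integrable_path_wt: "sq_integrable (\<lambda>\<omega>. path_wt \<omega> x s)"
proof (induction s arbitrary: x)
  case (Cons b s)
  show ?case unfolding path_wt.simps by (intro sq_integrable_add sq_integrable_W Cons)
qed (simp add: sq_integrable_const)

lemma sq_integrable_passage: "sq_integrable (\<lambda>\<omega>. passage \<omega> x y)"
proof (rule sq_integrable_bound)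
  let ?S = "{s. path_end x s = y}"
  let ?g = "\<lambda>\<omega>. (\<Sum>s\<in>?S. \<bar>path_wt \<omega> x s\<bar>) + \<bar>Min {} :: real\<bar>"
  show "sq_integrable ?g"
    by (intro sq_integrable_add sq_integrable_sum sq_integrable_abs sq_integrable_path_wt
        sq_integrable_const finite_paths)
  show "\<bar>passage \<omega> x y\<bar> \<le> \<bar>?g \<omega>\<bar>" for \<omega>
    using abs_Min_le_sum[OF finite_paths, of "path_wt \<omega> x" x y] by (simp add: passage_eq)
qed measurable

lemma integrable_passage [simp]: "integrable M (\<lambda>\<omega>. passage \<omega> x y)"
  by (rule sq_integrable_imp_integrable[OF sq_integrable_passage])

text \<open>Mean passage times are subadditive in the displacement and stand in for
  \<open>ell\<close> in estimates at finite scale; along large square multiples of a vector they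
  agree with it to first order.\<close>

definition EL :: "site \<Rightarrow> real" where
  "EL v = expectation (\<lambda>\<omega>. passage \<omega> 0 v)"

lemma expectation_passage: "expectation (\<lambda>\<omega>. passage \<omega> x y) = EL (y - x)"
  using integral_shift[of "\<lambda>\<omega>. passage \<omega> 0 (y - x)" x] by (simp add: EL_def passage_shift)

lemma EL_triangle:
  assumes "ple 0 v" "ple 0 w" shows "EL (v + w) \<le> EL v + EL w"
proof -
  have "EL (v + w) \<le> expectation (\<lambda>\<omega>. passage \<omega> 0 v + passage \<omega> v (v + w))"
    unfolding EL_def using assms by (intro integral_mono) (auto intro: passage_triangle ple_add)
  also have "\<dots> = EL v + EL w"
    by (simp add: expectation_passage)
  finally show ?thesis .
qed

end

subsection \<open>Block sums and the time constant\<close>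

definition sc :: "nat \<Rightarrow> site \<Rightarrow> site" where
  "sc n v = (int n * fst v, int n * snd v)"

lemma fst_sc [simp]: "fst (sc n v) = int n * fst v"
  and snd_sc [simp]: "snd (sc n v) = int n * snd v"
  by (auto simp: sc_def)

lemma sc_0 [simp]: "sc 0 v = 0"
  by (simp add: sc_def zero_prod_def)

lemma sc_Suc: "sc (Suc n) v = sc n v + v"
  by (simp add: prod_eq_iff algebra_simps)

lemma sc_add: "sc (m + n) v = sc m v + sc n v"
  by (simp add: prod_eq_iff algebra_simps)

lemma sc_plus: "sc n (v + w) = sc n v + sc n w"
  by (simp add: prod_eq_iff algebra_simps)

lemma ple_0_sc: "ple 0 v \<Longrightarrow> ple 0 (sc n v)"
  by (auto simp: ple_def)

lemma sc_mono: "ple 0 v \<Longrightarrow> m \<le> n \<Longrightarrow> ple (sc m v) (sc n v)"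
  by (auto simp: ple_def intro: mult_right_mono)

text \<open>The base point \<open>a\<close> is free because later it recedes to
  \<open>- n \<eta>\<close> as the number of blocks grows.\<close>

definition blk :: "site \<Rightarrow> site \<Rightarrow> nat \<Rightarrow> config \<Rightarrow> real" where
  "blk a v j \<omega> = passage \<omega> (a + sc j v) (a + sc (Suc j) v)"

lemma passage_le_blocks:
  assumes "ple 0 v"
  shows "passage \<omega> a (a + sc n v) \<le> (\<Sum>j<n. blk a v j \<omega>)"
proof (induction n)
  case (Suc n)
  have "ple a (a + sc n v)" by (intro ple_add ple_0_sc assms)
  moreover have "ple (a + sc n v) (a + sc (Suc n) v)"
    using sc_mono[OF assms, of n "Suc n"] by (auto simp: ple_def)
  ultimately have "passage \<omega> a (a + sc (Suc n) v) \<le> passage \<omega> a (a + sc n v) + blk a v n \<omega>"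
    unfolding blk_def by (rule passage_triangle)
  then show ?case using Suc by simp
qed simp

context fpp_weights
begin

lemma prob_UNIV [simp]: "prob UNIV = 1"
  using prob_space by simp

lemma emeasure_UNIV [simp]: "emeasure M UNIV = 1"
  using emeasure_space_1 by simp

lemma indep_coords: "indep_vars (\<lambda>_. \<mu>) (\<lambda>z \<omega>. \<omega> z) UNIV"
proof (subst indep_vars_iff_distr_eq_PiM)
  show "distr M (Pi\<^sub>M UNIV (\<lambda>_. \<mu>)) (\<lambda>x. \<lambda>i\<in>UNIV. x i)
      = Pi\<^sub>M UNIV (\<lambda>i. distr M \<mu> (\<lambda>\<omega>. \<omega> i))"
    unfolding distr_coord by (simp add: restrict_UNIV weight_space_def)
qed auto

lemma integrable_mult_sq:
  assumes "sq_integrable f" "sq_integrable g"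
  shows "integrable M (\<lambda>\<omega>. f \<omega> * g \<omega>)"
proof -
  have [measurable]: "f \<in> borel_measurable M" "g \<in> borel_measurable M"
    using assms by (auto simp: sq_integrable_def)
  have i: "integrable M (\<lambda>\<omega>. (f \<omega>)\<^sup>2 + (g \<omega>)\<^sup>2)"
    using assms by (intro Bochner_Integration.integrable_add) (auto simp: sq_integrable_def)
  have "\<bar>f \<omega> * g \<omega>\<bar> \<le> (f \<omega>)\<^sup>2 + (g \<omega>)\<^sup>2" for \<omega>
    using zero_le_power2[of "\<bar>f \<omega>\<bar> - \<bar>g \<omega>\<bar>"] mult_nonneg_nonneg[of "\<bar>f \<omega>\<bar>" "\<bar>g \<omega>\<bar>"]
    unfolding power2_diff power2_abs abs_mult by linarith
  then show ?thesis
    by (intro Bochner_Integration.integrable_bound[OF i] AE_I2) (auto intro: order_trans)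
qed

text \<open>Each passage time is a function of the weights in its rectangle without the starting
  corner, and disjoint sets of coordinates are independent.\<close>

lemma passage_uncorrelated:
  assumes disj: "{z. ple x z \<and> z \<noteq> x \<and> ple z y} \<inter> {z. ple x' z \<and> z \<noteq> x' \<and> ple z y'} = {}"
  shows "expectation (\<lambda>\<omega>. (passage \<omega> x y - c) * (passage \<omega> x' y' - d))
    = (EL (y - x) - c) * (EL (y' - x') - d)"
proof -
  let ?A = "{z. ple x z \<and> z \<noteq> x \<and> ple z y}" and ?B = "{z. ple x' z \<and> z \<noteq> x' \<and> ple z y'}"
  have "indep_var (PiM ?A (\<lambda>_. \<mu>)) (\<lambda>\<omega>. restrict (\<lambda>i. \<omega> i) ?A)
      (PiM ?B (\<lambda>_. \<mu>)) (\<lambda>\<omega>. restrict (\<lambda>i. \<omega> i) ?B)"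
    using disj by (intro indep_var_restrict[OF indep_coords]) auto
  then have "indep_var borel ((\<lambda>\<omega>. passage \<omega> x y - c) \<circ> (\<lambda>\<omega>. restrict (\<lambda>i. \<omega> i) ?A))
      borel ((\<lambda>\<omega>. passage \<omega> x' y' - d) \<circ> (\<lambda>\<omega>. restrict (\<lambda>i. \<omega> i) ?B))"
    by (rule indep_var_compose) (intro borel_measurable_diff passage_measurable_PiM; simp)+
  moreover have "passage (restrict (\<lambda>i. \<omega> i) ?A) x y = passage \<omega> x y"
      "passage (restrict (\<lambda>i. \<omega> i) ?B) x' y' = passage \<omega> x' y'" for \<omega>
    by (intro passage_cong; simp)+
  ultimately have "indep_var borel (\<lambda>\<omega>. passage \<omega> x y - c) borel (\<lambda>\<omega>. passage \<omega> x' y' - d)"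
    by (simp add: comp_def)
  then have "expectation (\<lambda>\<omega>. (passage \<omega> x y - c) * (passage \<omega> x' y' - d))
      = expectation (\<lambda>\<omega>. passage \<omega> x y - c) * expectation (\<lambda>\<omega>. passage \<omega> x' y' - d)"
    by (rule indep_var_lebesgue_integral) auto
  then show ?thesis by (simp add: expectation_passage prob_space)
qed

lemma blk_measurable [measurable]: "blk a v j \<in> borel_measurable M"
  unfolding blk_def[abs_def] by measurable

lemma sq_integrable_blk: "sq_integrable (blk a v j)"
  unfolding blk_def[abs_def] by (rule sq_integrable_passage)

lemma integrable_blk [simp]: "integrable M (blk a v j)"
  by (rule sq_integrable_imp_integrable[OF sq_integrable_blk])

lemma expectation_blk [simp]: "expectation (blk a v j) = EL v"
  unfolding blk_def[abs_def] by (simp add: expectation_passage sc_Suc)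

text \<open>Two blocks on the same ray share at most the corner where one ends and the other starts,
  and the later block does not use the weight there.\<close>

lemma blk_uncorrelated:
  assumes "ple 0 v" "i < j"
  shows "expectation (\<lambda>\<omega>. (blk a v i \<omega> - EL v) * (blk a v j \<omega> - EL v)) = 0"
proof -
  have "ple (sc (Suc i) v) (sc j v)" using assms by (intro sc_mono) auto
  then have *: "ple (a + sc (Suc i) v) (a + sc j v)" by (auto simp: ple_def)
  have "z = a + sc j v" if "ple z (a + sc (Suc i) v)" "ple (a + sc j v) z" for z
    using ple_trans[OF that(1) *] that(2) by (auto simp: ple_def prod_eq_iff)
  then have "{z. ple (a + sc i v) z \<and> z \<noteq> a + sc i v \<and> ple z (a + sc (Suc i) v)} \<inter>
      {z. ple (a + sc j v) z \<and> z \<noteq> a + sc j v \<and> ple z (a + sc (Suc j) v)} = {}"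
    by blast
  from passage_uncorrelated[OF this] show ?thesis
    by (simp add: blk_def sc_Suc)
qed

definition var_L :: "site \<Rightarrow> real" where
  "var_L v = expectation (\<lambda>\<omega>. (passage \<omega> 0 v - EL v)\<^sup>2)"

lemma variance_blk: "expectation (\<lambda>\<omega>. (blk a v j \<omega> - EL v)\<^sup>2) = var_L v"
  using integral_shift[of "\<lambda>\<omega>. (passage \<omega> 0 v - EL v)\<^sup>2" "a + sc j v"]
  by (simp add: blk_def sc_Suc var_L_def passage_shift ac_simps)

lemma sq_integrable_diff_const: "sq_integrable f \<Longrightarrow> sq_integrable (\<lambda>\<omega>. f \<omega> - c)"
  using sq_integrable_add[OF _ sq_integrable_const[of "- c"]] by simp

lemma variance_blocks:
  assumes "ple 0 v"
  shows "expectation (\<lambda>\<omega>. (\<Sum>j<n. blk a v j \<omega> - EL v)\<^sup>2) = real n * var_L v"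
proof (induction n)
  case (Suc n)
  let ?Y = "\<lambda>j \<omega>. blk a v j \<omega> - EL v"
  let ?S = "\<lambda>\<omega>. \<Sum>j<n. ?Y j \<omega>"
  have sq: "sq_integrable (?Y j)" for j
    by (intro sq_integrable_diff_const sq_integrable_blk)
  have sqS: "sq_integrable ?S" by (intro sq_integrable_sum sq) auto
  have "(\<lambda>\<omega>. (\<Sum>j<Suc n. ?Y j \<omega>)\<^sup>2)
      = (\<lambda>\<omega>. (?S \<omega>)\<^sup>2 + (?Y n \<omega>)\<^sup>2 + 2 * (\<Sum>j<n. ?Y j \<omega> * ?Y n \<omega>))"
    unfolding sum.lessThan_Suc power2_sum sum_distrib_right[symmetric] mult.assoc ..
  moreover have "expectation (\<lambda>\<omega>. \<Sum>j<n. ?Y j \<omega> * ?Y n \<omega>) = 0"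
    using integrable_mult_sq[OF sq sq] blk_uncorrelated[OF assms]
    by (subst Bochner_Integration.integral_sum) auto
  moreover have "integrable M (\<lambda>\<omega>. \<Sum>j<n. ?Y j \<omega> * ?Y n \<omega>)"
    by (intro Bochner_Integration.integrable_sum integrable_mult_sq sq)
  moreover have "integrable M (\<lambda>\<omega>. (?S \<omega>)\<^sup>2)" "integrable M (\<lambda>\<omega>. (?Y n \<omega>)\<^sup>2)"
    using sq sqS by (auto simp: sq_integrable_def)
  ultimately have "expectation (\<lambda>\<omega>. (\<Sum>j<Suc n. ?Y j \<omega>)\<^sup>2)
      = expectation (\<lambda>\<omega>. (?S \<omega>)\<^sup>2) + expectation (\<lambda>\<omega>. (?Y n \<omega>)\<^sup>2)"
    by (simp only:) simp
  then show ?case using Suc by (simp add: variance_blk algebra_simps)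
qed simp

lemma AE_eventually_inverse_square:
  assumes [measurable]: "\<And>i. Measurable.pred M (P i)"
    and le: "\<And>i. i > 0 \<Longrightarrow> prob {\<omega>. P i \<omega>} \<le> C / (real i)\<^sup>2"
  shows "AE \<omega> in M. \<forall>\<^sub>F i in sequentially. \<not> P i \<omega>"
proof -
  have "summable (\<lambda>i. C * inverse ((real i)\<^sup>2))"
    by (intro summable_mult inverse_power_summable) auto
  then have "summable (\<lambda>i. prob {\<omega>\<in>space M. P i \<omega>})"
  proof (rule summable_comparison_test_ev[rotated])
    show "\<forall>\<^sub>F i in sequentially. norm (prob {\<omega>\<in>space M. P i \<omega>}) \<le> C * inverse ((real i)\<^sup>2)"
      using le by (intro eventually_sequentiallyI[of 1]) (simp add: divide_inverse)
  qed
  then have "AE \<omega> in M. \<forall>\<^sub>F i in sequentially. \<omega> \<in> space M - {\<omega>\<in>space M. P i \<omega>}"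
    using assms(1) by (intro borel_cantelli_AE1) (simp_all add: pred_def emeasure_eq_measure)
  then show ?thesis by simp
qed

text \<open>Chebyshev at \<open>n = i^2\<close>: the variance of the average is
  \<open>var_L v / n\<close>, so the exceptional probabilities are of order \<open>1 / i^2\<close>
  and Borel-Cantelli applies. Since the base point may change with \<open>i\<close>, a law of large
  numbers for one fixed sequence of blocks would not suffice.\<close>

lemma blocks_AE:
  assumes v: "ple 0 v" and g: "g > 0"
  shows "AE \<omega> in M. \<forall>\<^sub>F i in sequentially.
    \<bar>(\<Sum>j<i\<^sup>2. blk (a i) v j \<omega>) - real (i\<^sup>2) * EL v\<bar> < real (i\<^sup>2) * g"
proof -
  let ?P = "\<lambda>i \<omega>. real (i\<^sup>2) * g \<le> \<bar>(\<Sum>j<i\<^sup>2. blk (a i) v j \<omega>) - real (i\<^sup>2) * EL v\<bar>"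
  have "AE \<omega> in M. \<forall>\<^sub>F i in sequentially. \<not> ?P i \<omega>"
  proof (rule AE_eventually_inverse_square)
    fix i :: nat assume i: "i > 0"
    let ?f = "\<lambda>\<omega>. \<Sum>j<i\<^sup>2. blk (a i) v j \<omega>"
    have E: "expectation ?f = real (i\<^sup>2) * EL v"
      by (subst Bochner_Integration.integral_sum) auto
    have "sq_integrable ?f" by (intro sq_integrable_sum sq_integrable_blk) auto
    then have "prob {\<omega>\<in>space M. real (i\<^sup>2) * g \<le> \<bar>?f \<omega> - expectation ?f\<bar>}
        \<le> expectation (\<lambda>\<omega>. (?f \<omega> - expectation ?f)\<^sup>2) / (real (i\<^sup>2) * g)\<^sup>2"
      using i g by (intro Chebyshev_inequality) (auto simp: sq_integrable_def)
    also have "expectation (\<lambda>\<omega>. (?f \<omega> - expectation ?f)\<^sup>2) = real (i\<^sup>2) * var_L v"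
      unfolding E variance_blocks[OF v, of "a i" "i\<^sup>2", symmetric] by (simp add: sum_subtractf)
    also have "real (i\<^sup>2) * var_L v / (real (i\<^sup>2) * g)\<^sup>2 = (var_L v / g\<^sup>2) / (real i)\<^sup>2"
      using i g by (simp add: power2_eq_square)
    finally show "prob {\<omega>. ?P i \<omega>} \<le> (var_L v / g\<^sup>2) / (real i)\<^sup>2"
      unfolding E by simp
  qed measurable
  then show ?thesis by (simp add: not_le)
qed

lemma blocks_AE_LIMSEQ:
  assumes v: "ple 0 v"
  shows "AE \<omega> in M. (\<lambda>i. (\<Sum>j<i\<^sup>2. blk (a i) v j \<omega>) / real (i\<^sup>2)) \<longlonglongrightarrow> EL v"
proof -
  have "AE \<omega> in M. \<forall>m::nat. \<forall>\<^sub>F i in sequentially.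
    \<bar>(\<Sum>j<i\<^sup>2. blk (a i) v j \<omega>) - real (i\<^sup>2) * EL v\<bar> < real (i\<^sup>2) * inverse (real (Suc m))"
    unfolding AE_all_countable by (intro allI blocks_AE v) simp
  then show ?thesis
  proof eventually_elim
    case (elim \<omega>)
    show ?case
    proof (rule tendstoI)
      fix e :: real assume "e > 0"
      then obtain m where m: "inverse (real (Suc m)) < e" using reals_Archimedean by blast
      have "\<forall>\<^sub>F i in sequentially. i > 0 \<and>
          \<bar>(\<Sum>j<i\<^sup>2. blk (a i) v j \<omega>) - real (i\<^sup>2) * EL v\<bar> < real (i\<^sup>2) * inverse (real (Suc m))"
        using elim eventually_gt_at_top[of 0] by (intro eventually_conj) auto
      then show "\<forall>\<^sub>F i in sequentially. dist ((\<Sum>j<i\<^sup>2. blk (a i) v j \<omega>) / real (i\<^sup>2)) (EL v) < e"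
      proof eventually_elim
        case (elim i)
        let ?s = "\<Sum>j<i\<^sup>2. blk (a i) v j \<omega>"
        have "dist (?s / real (i\<^sup>2)) (EL v) = \<bar>?s - real (i\<^sup>2) * EL v\<bar> / real (i\<^sup>2)"
        proof -
          have "?s / real (i\<^sup>2) - EL v = (?s - real (i\<^sup>2) * EL v) / real (i\<^sup>2)"
            using elim by (simp add: field_simps)
          then show ?thesis by (simp add: dist_real_def)
        qed
        also have "\<dots> < inverse (real (Suc m))"
          using elim by (simp add: divide_less_eq mult.commute)
        finally show ?case using m by simp
      qed
    qed
  qed
qed

end

locale fpp_time_constant = fpp_weights +
  fixes ell :: "real \<times> real \<Rightarrow> real"
  assumes TC: "is_time_constant \<mu> ell"
begin

definition ellv :: "site \<Rightarrow> real" where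
  "ellv v = ell (real_of_int (fst v), real_of_int (snd v))"

lemma TC_AE:
  assumes "ple 0 v"
  shows "AE \<omega> in M. (\<lambda>n. passage \<omega> 0 (sc n v) / real n) \<longlonglongrightarrow> ellv v"
proof -
  have "\<lfloor>real n * real_of_int k\<rfloor> = int n * k" for n k
    by (metis floor_of_int of_int_mult of_int_of_nat_eq)
  then show ?thesis
    using TC[unfolded is_time_constant_def, rule_format, of "real_of_int (fst v)" "real_of_int (snd v)"]
      assms
    by (simp add: ple_def sc_def zero_prod_def ellv_def)
qed

text \<open>Sampling the defining limit for \<open>(s, t)\<close> along the multiples
  \<open>m * n\<close> gives the limit for \<open>(n s, n t)\<close>. For \<open>n = 0\<close> the
  value \<open>ell (0, 0) = 0\<close> comes from the empty path.\<close>

lemma ell_scale: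
  assumes "0 \<le> s" "0 \<le> t"
  shows "ell (real n * s, real n * t) = real n * ell (s, t)"
proof -
  have 1: "AE \<omega> in M. (\<lambda>m. passage \<omega> (0, 0) (\<lfloor>real m * s\<rfloor>, \<lfloor>real m * t\<rfloor>) / real m) \<longlonglongrightarrow> ell (s, t)"
    using TC assms by (auto simp: is_time_constant_def)
  have 2: "AE \<omega> in M. (\<lambda>m. passage \<omega> (0, 0) (\<lfloor>real m * (real n * s)\<rfloor>, \<lfloor>real m * (real n * t)\<rfloor>) / real m)
      \<longlonglongrightarrow> ell (real n * s, real n * t)"
    using TC assms by (auto simp: is_time_constant_def)
  have "AE \<omega> in M. ell (real n * s, real n * t) = real n * ell (s, t)"
    using 1 2
  proof eventually_elim
    case (elim \<omega>)
    let ?f = "\<lambda>m. passage \<omega> (0, 0) (\<lfloor>real m * s\<rfloor>, \<lfloor>real m * t\<rfloor>) / real m"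
    show ?case
    proof (cases "n = 0")
      case True
      then have "(\<lambda>m. 0) \<longlonglongrightarrow> ell (0, 0)"
        using elim(2) passage_refl[of \<omega> "(0,0)"] by simp
      then have "ell (0, 0) = 0" by (simp add: LIMSEQ_const_iff)
      then show ?thesis using True by simp
    next
      case False
      have "(\<lambda>m. real n * ?f (m * n)) \<longlonglongrightarrow> real n * ell (s, t)"
        using False by (intro tendsto_mult tendsto_const filterlim_compose[OF elim(1)])
          (rule filterlim_at_top_mono[OF filterlim_ident], simp)
      also have "(\<lambda>m. real n * ?f (m * n))
          = (\<lambda>m. passage \<omega> (0, 0) (\<lfloor>real m * (real n * s)\<rfloor>, \<lfloor>real m * (real n * t)\<rfloor>) / real m)"
        using False by (simp add: fun_eq_iff mult.assoc)
      finally show ?thesis using elim(2) LIMSEQ_unique by blast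
    qed
  qed
  then show ?thesis by simp
qed

lemma ellv_sc: "ple 0 v \<Longrightarrow> ellv (sc n v) = real n * ellv v"
  using ell_scale[of "real_of_int (fst v)" "real_of_int (snd v)" n] by (simp add: ellv_def ple_def)

lemma filterlim_square: "filterlim (\<lambda>i::nat. i\<^sup>2) at_top sequentially"
  by (rule filterlim_at_top_mono[OF filterlim_ident]) (auto simp: power2_eq_square)

lemma ellv_le_EL:
  assumes "ple 0 v" shows "ellv v \<le> EL v"
proof -
  have "AE \<omega> in M. ellv v \<le> EL v"
    using TC_AE[OF assms] blocks_AE_LIMSEQ[OF assms, of "\<lambda>_. 0"]
  proof eventually_elim
    case (elim \<omega>)
    have "(\<lambda>i. passage \<omega> 0 (sc (i\<^sup>2) v) / real (i\<^sup>2)) \<longlonglongrightarrow> ellv v"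
      by (rule filterlim_compose[OF elim(1) filterlim_square])
    then show ?case
      using elim(2) passage_le_blocks[OF assms, of \<omega> 0]
      by (rule_tac LIMSEQ_le) (auto intro!: divide_right_mono)
  qed
  then show ?thesis by simp
qed

text \<open>The converse of \<open>ellv_le_EL\<close> to first order. Fatou takes the place of
  domination: \<open>Y i\<close>, the average excess of the block sum over the passage time, is
  nonnegative and converges almost surely, so its mean is bounded from below in the limit.\<close>

lemma EL_eventually_le:
  assumes v: "ple 0 v" and \<epsilon>: "\<epsilon> > 0"
  shows "\<forall>\<^sub>F i in sequentially. EL (sc (i\<^sup>2) v) \<le> real (i\<^sup>2) * (ellv v + \<epsilon>)"
proof -
  define Y where "Y i \<omega> = ((\<Sum>j<i\<^sup>2. blk 0 v j \<omega>) - passage \<omega> 0 (sc (i\<^sup>2) v)) / real (i\<^sup>2)" for i \<omega>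
  have [measurable]: "Y i \<in> borel_measurable M" for i
    unfolding Y_def[abs_def] by measurable
  have Y0: "0 \<le> Y i \<omega>" for i \<omega>
    using passage_le_blocks[OF v, of \<omega> 0 "i\<^sup>2"] by (simp add: Y_def)
  have Yint: "integrable M (Y i)" for i
    unfolding Y_def[abs_def] by auto
  have EY: "expectation (Y i) = EL v - EL (sc (i\<^sup>2) v) / real (i\<^sup>2)" if "i > 0" for i
    unfolding Y_def[abs_def] using that by (simp add: expectation_passage field_simps)
  have "AE \<omega> in M. (\<lambda>i. Y i \<omega>) \<longlonglongrightarrow> EL v - ellv v"
    using TC_AE[OF v] blocks_AE_LIMSEQ[OF v, of "\<lambda>_. 0"]
  proof eventually_elim
    case (elim \<omega>)
    have "(\<lambda>i. passage \<omega> 0 (sc (i\<^sup>2) v) / real (i\<^sup>2)) \<longlonglongrightarrow> ellv v"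
      by (rule filterlim_compose[OF elim(1) filterlim_square])
    from tendsto_diff[OF elim(2) this] show ?case
      by (simp add: Y_def diff_divide_distrib)
  qed
  then have *: "AE \<omega> in M. ennreal (EL v - ellv v) = liminf (\<lambda>i. ennreal (Y i \<omega>))"
  proof eventually_elim
    case (elim \<omega>)
    have "(\<lambda>i. ennreal (Y i \<omega>)) \<longlonglongrightarrow> ennreal (EL v - ellv v)" by (rule tendsto_ennrealI[OF elim])
    then show ?case by (simp add: lim_imp_Liminf)
  qed
  have "ennreal (EL v - ellv v) = (\<integral>\<^sup>+\<omega>. ennreal (EL v - ellv v) \<partial>M)"
    by (simp add: emeasure_space_1)
  also have "\<dots> = (\<integral>\<^sup>+\<omega>. liminf (\<lambda>i. ennreal (Y i \<omega>)) \<partial>M)"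
    by (intro nn_integral_cong_AE *)
  also have "\<dots> \<le> liminf (\<lambda>i. \<integral>\<^sup>+\<omega>. ennreal (Y i \<omega>) \<partial>M)"
    by (intro nn_integral_liminf) measurable
  also have "\<dots> = liminf (\<lambda>i. ennreal (expectation (Y i)))"
    using Y0 Yint by (simp add: nn_integral_eq_integral)
  finally have le: "ennreal (EL v - ellv v) \<le> liminf (\<lambda>i. ennreal (expectation (Y i)))" .
  have "\<forall>\<^sub>F i in sequentially. EL v - ellv v - \<epsilon> \<le> expectation (Y i)"
  \<comment> \<open>A negative bound holds trivially, but \<open>ennreal\<close> would truncate it
    to zero, so it is treated separately.\<close>
  proof (cases "EL v - ellv v - \<epsilon> < 0")
    case True
    have "0 \<le> expectation (Y i)" for i using Y0 by (intro integral_nonneg_AE) auto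
    then show ?thesis using True by (auto intro!: always_eventually intro: order_trans[of _ 0])
  next
    case False
    then have "ennreal (EL v - ellv v - \<epsilon>) < ennreal (EL v - ellv v)"
      using \<epsilon> by (intro ennreal_lessI) auto
    then have "\<forall>\<^sub>F i in sequentially. ennreal (EL v - ellv v - \<epsilon>) < ennreal (expectation (Y i))"
      using le less_LiminfD by (metis less_le_trans)
    then show ?thesis
      by eventually_elim (use False in \<open>auto simp: ennreal_less_iff\<close>)
  qed
  then show ?thesis
    using eventually_gt_at_top[of 0]
  proof eventually_elim
    case (elim i)
    then have "EL (sc (i\<^sup>2) v) / real (i\<^sup>2) \<le> ellv v + \<epsilon>" using EY by simp
    then show ?case using elim by (simp add: divide_le_eq ac_simps)
  qed
qed

end

subsection \<open>Geodesics to far targets avoid rays\<close>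

text \<open>Each index in the set on the left ends a block of \<open>n\<close> indices on which \<open>b\<close> sums to more
  than \<open>l * n\<close>; these blocks can be chosen disjoint.\<close>

lemma card_large_averages_le:
  fixes b :: "nat \<Rightarrow> real"
  assumes l: "l > 0" and b: "\<And>m. m < K \<Longrightarrow> 0 \<le> b m"
  shows "l * card {i. i \<le> K \<and> (\<exists>n\<in>{1..i}. l * real n < (\<Sum>m=i-n..<i. b m))} \<le> (\<Sum>m<K. b m)"
  using b
proof (induction K rule: less_induct)
  case (less K)
  let ?P = "\<lambda>i. \<exists>n\<in>{1..i}. l * real n < (\<Sum>m=i-n..<i. b m)"
  let ?S = "\<lambda>K. {i. i \<le> K \<and> ?P i}"
  have fin: "finite (?S K)" for K by simp
  show ?case
  proof (cases "?P K")
    case True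
    then obtain n where n: "1 \<le> n" "n \<le> K" "l * real n < (\<Sum>m=K-n..<K. b m)" by auto
    \<comment> \<open>The window that ends at \<open>K\<close> pays for all \<open>n\<close> indices
      it covers, and the induction continues to the left of it.\<close>
    have "?S K \<subseteq> ?S (K - n) \<union> {K - n<..K}" by (auto simp: not_le)
    then have "card (?S K) \<le> card (?S (K - n) \<union> {K - n<..K})"
      by (intro card_mono) auto
    also have "\<dots> \<le> card (?S (K - n)) + n"
      using card_Un_le[of "?S (K - n)" "{K - n<..K}"] n by simp
    finally have "l * card (?S K) \<le> l * (card (?S (K - n)) + n)"
      using l by (intro mult_left_mono) auto
    also have "\<dots> = l * card (?S (K - n)) + l * n"
      by (simp add: algebra_simps)
    also have "\<dots> \<le> (\<Sum>m<K-n. b m) + (\<Sum>m=K-n..<K. b m)"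
      using n less.prems by (intro add_mono less.IH) auto
    also have "\<dots> = (\<Sum>m<K. b m)"
      using n by (simp add: lessThan_atLeast0 sum.atLeastLessThan_concat)
    finally show ?thesis .
  next
    case False
    show ?thesis
    proof (cases K)
      case 0
      then have "?S K = {}" by auto
      then show ?thesis unfolding \<open>?S K = {}\<close> using 0 by simp
    next
      case (Suc K')
      then have "?S K = ?S K'" using False by (auto simp: le_Suc_eq)
      then have "l * card (?S K) \<le> (\<Sum>m<K'. b m)"
        using less.IH[of K'] less.prems Suc by simp
      also have "\<dots> \<le> (\<Sum>m<K. b m)" using less.prems Suc by simp
      finally show ?thesis .
    qed
  qed
qed

text \<open>With nonnegative weights a subpath costs at most as much as the whole path, so one
  estimate for a ray piece bounds both parts into which a meeting point divides it.\<close>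

definition abs_config :: "config \<Rightarrow> config" where
  "abs_config \<omega> = (\<lambda>z. (\<bar>fst (\<omega> z)\<bar>, \<bar>snd (\<omega> z)\<bar>))"

lemma path_wt_abs_nonneg: "0 \<le> path_wt (abs_config \<omega>) x s"
  by (induction s arbitrary: x) (auto simp: abs_config_def W_def)

lemma path_wt_le_abs: "path_wt \<omega> x s \<le> path_wt (abs_config \<omega>) x s"
proof (induction s arbitrary: x)
  case (Cons b s)
  show ?case unfolding path_wt.simps
    by (intro add_mono Cons) (simp add: abs_config_def W_def abs_ge_self)
qed simp

text \<open>A lattice path along the ray through \<open>u\<close>, assembled from corner-shaped pieces that join
  \<open>i\<^sup>2 u\<close> to \<open>(i + 1)\<^sup>2 u\<close>; the quadratic spacing makes second moments summable
  while the pieces are of lower order.\<close>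

definition ray_piece :: "site \<Rightarrow> nat \<Rightarrow> bool list" where
  "ray_piece u i = corner (sc (2 * i + 1) u)"

lemma square_Suc_split: "(Suc i)\<^sup>2 = i\<^sup>2 + (2 * i + 1)"
  by (simp add: power2_eq_square)

lemma path_end_ray_piece:
  assumes "ple 0 u" shows "path_end (sc (i\<^sup>2) u) (ray_piece u i) = sc ((Suc i)\<^sup>2) u"
  unfolding ray_piece_def square_Suc_split sc_add[of "i\<^sup>2"] using assms
  by (intro path_end_corner ple_0_sc)

lemma length_ray_piece:
  assumes "ple 0 u" shows "length (ray_piece u i) = (2 * i + 1) * nat (fst u + snd u)"
proof -
  have "nat (int (2 * i + 1) * k) = (2 * i + 1) * nat k" for k
    by (simp only: nat_mult_distrib nat_int of_nat_0_le_iff)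
  then show ?thesis
    using assms by (simp add: ray_piece_def corner_def ple_def nat_add_distrib algebra_simps
        del: of_nat_add of_nat_Suc)
qed

context fpp_weights
begin

text \<open>Continuity from above turns an almost surely eventual property into one threshold
  \<open>m\<close> that fails only with small probability.\<close>

lemma prob_eventually_small:
  assumes [measurable]: "\<And>i. Measurable.pred M (Q i)"
    and ae: "AE \<omega> in M. \<forall>\<^sub>F i in sequentially. Q i \<omega>" and "\<delta> > 0"
  shows "\<exists>m. prob {\<omega>. \<exists>i\<ge>m. \<not> Q i \<omega>} \<le> \<delta>"
proof -
  let ?A = "\<lambda>m. {\<omega>\<in>space M. \<exists>i\<ge>m. \<not> Q i \<omega>}"
  have "(\<lambda>m. prob (?A m)) \<longlonglongrightarrow> prob (\<Inter>m. ?A m)"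
  proof (rule finite_Lim_measure_decseq)
    have "?A m \<in> events" for m by measurable
    then show "range ?A \<subseteq> events" by blast
    show "decseq ?A" by (auto simp: decseq_def intro: order_trans)
  qed
  moreover have "prob (\<Inter>m. ?A m) = 0"
  proof -
    have "AE \<omega> in M. \<omega> \<notin> (\<Inter>m. ?A m)"
      using ae by eventually_elim (auto simp: eventually_sequentially)
    moreover have "(\<Inter>m. ?A m) \<in> events" by measurable
    ultimately have "(\<Inter>m. ?A m) \<in> null_sets M" by (subst AE_iff_null_sets)
    then show ?thesis by (rule measure_eq_0_null_sets)
  qed
  ultimately have "\<forall>\<^sub>F m in sequentially. prob (?A m) < \<delta>"
    using \<open>\<delta> > 0\<close> by (auto intro: order_tendstoD)
  then obtain m where "prob (?A m) < \<delta>" by (auto simp: eventually_sequentially)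
  then show ?thesis by (intro exI[of _ m]) simp
qed

lemma abs_config_measurable_path [measurable]:
  "(\<lambda>\<omega>. path_wt (abs_config \<omega>) x s) \<in> borel_measurable M"
proof (induction s arbitrary: x)
  case (Cons b s)
  have *: "W (abs_config \<omega>) z i = \<bar>W \<omega> z i\<bar>" for z i \<omega>
    by (auto simp: W_def abs_config_def)
  show ?case unfolding path_wt.simps *
    by (intro borel_measurable_add Cons) measurable
qed simp

definition m2 :: real where
  "m2 = expectation (\<lambda>\<omega>. (W \<omega> 0 1)\<^sup>2) + expectation (\<lambda>\<omega>. (W \<omega> 0 2)\<^sup>2)"

lemma second_moment_W: "expectation (\<lambda>\<omega>. (W \<omega> z i)\<^sup>2) \<le> m2"
proof -
  have "W (shift z \<omega>) 0 i = W \<omega> z i" for \<omega> by (simp add: shift_def W_def)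
  moreover have "expectation (\<lambda>\<omega>. (W (shift z \<omega>) 0 i)\<^sup>2) = expectation (\<lambda>\<omega>. (W \<omega> 0 i)\<^sup>2)"
    by (rule integral_shift) measurable
  ultimately have "expectation (\<lambda>\<omega>. (W \<omega> z i)\<^sup>2) = expectation (\<lambda>\<omega>. (W \<omega> 0 i)\<^sup>2)"
    by simp
  also have "\<dots> = expectation (\<lambda>\<omega>. (W \<omega> 0 (if i = 1 then 1 else 2))\<^sup>2)"
    by (simp add: W_def)
  also have "\<dots> \<le> m2"
    by (auto simp: m2_def intro!: integral_nonneg_AE)
  finally show ?thesis .
qed

text \<open>Minkowski's inequality in squared form; the quadratic growth in the length requires no
  independence along the path.\<close>

lemma second_moment_path_abs:
  "integrable M (\<lambda>\<omega>. (path_wt (abs_config \<omega>) x s)\<^sup>2) \<and>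
   expectation (\<lambda>\<omega>. (path_wt (abs_config \<omega>) x s)\<^sup>2) \<le> (real (length s))\<^sup>2 * m2"
proof (induction s arbitrary: x)
  case (Cons b s)
  let ?y = "padd x (stepv b)"
  let ?n = "real (length s)"
  define a S where "a \<omega> = \<bar>W \<omega> ?y (if b then 1 else 2)\<bar>" and "S \<omega> = path_wt (abs_config \<omega>) ?y s" for \<omega>
  have eq: "path_wt (abs_config \<omega>) x (b # s) = a \<omega> + S \<omega>" for \<omega>
    by (auto simp: a_def S_def W_def abs_config_def)
  have sqa: "sq_integrable a" unfolding a_def[abs_def]
    by (intro sq_integrable_abs sq_integrable_W)
  have sqS: "sq_integrable S"
    using Cons[of ?y] unfolding S_def[abs_def] by (auto simp: sq_integrable_def)
  have ia: "integrable M (\<lambda>\<omega>. (a \<omega>)\<^sup>2)" and iS: "integrable M (\<lambda>\<omega>. (S \<omega>)\<^sup>2)"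
    using sqa sqS by (auto simp: sq_integrable_def)
  have sqaS: "integrable M (\<lambda>\<omega>. (a \<omega> + S \<omega>)\<^sup>2)"
    using sq_integrable_add[OF sqa sqS] by (auto simp: sq_integrable_def)
  have ea: "expectation (\<lambda>\<omega>. (a \<omega>)\<^sup>2) \<le> m2"
    unfolding a_def by (simp add: second_moment_W)
  have eS: "expectation (\<lambda>\<omega>. (S \<omega>)\<^sup>2) \<le> ?n\<^sup>2 * m2"
    using Cons[of ?y] unfolding S_def by auto
  have "expectation (\<lambda>\<omega>. (a \<omega> + S \<omega>)\<^sup>2) \<le> (real (length (b # s)))\<^sup>2 * m2"
  proof (cases "s = []")
    case True
    then show ?thesis using ea by (simp add: S_def)
  next
    case False
    then have n: "?n > 0" by simp
    \<comment> \<open>Young's inequality with the weights for which the induction closes: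
      \<open>(n + 1) + (1 + 1 / n) n^2 = (n + 1)^2\<close>.\<close>
    have pw: "(a \<omega> + S \<omega>)\<^sup>2 \<le> (?n + 1) * (a \<omega>)\<^sup>2 + (1 + 1 / ?n) * (S \<omega>)\<^sup>2" for \<omega>
    proof -
      have "0 \<le> (?n * a \<omega> - S \<omega>)\<^sup>2 / ?n" using n by simp
      also have "\<dots> = ?n * (a \<omega>)\<^sup>2 - 2 * a \<omega> * S \<omega> + (S \<omega>)\<^sup>2 / ?n"
        using n by (simp add: power2_eq_square field_simps)
      finally show ?thesis by (simp add: power2_sum algebra_simps)
    qed
    have "expectation (\<lambda>\<omega>. (a \<omega> + S \<omega>)\<^sup>2)
        \<le> expectation (\<lambda>\<omega>. (?n + 1) * (a \<omega>)\<^sup>2 + (1 + 1 / ?n) * (S \<omega>)\<^sup>2)"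
      using ia iS by (intro integral_mono sqaS pw) auto
    also have "\<dots> = (?n + 1) * expectation (\<lambda>\<omega>. (a \<omega>)\<^sup>2) + (1 + 1 / ?n) * expectation (\<lambda>\<omega>. (S \<omega>)\<^sup>2)"
      using ia iS by simp
    also have "\<dots> \<le> (?n + 1) * m2 + (1 + 1 / ?n) * (?n\<^sup>2 * m2)"
      using ea eS n by (intro add_mono mult_left_mono) auto
    also have "\<dots> = (real (length (b # s)))\<^sup>2 * m2"
      using n by (simp add: power2_eq_square field_simps)
    finally show ?thesis .
  qed
  then show ?case unfolding eq using sqaS by blast
qed simp

text \<open>A piece has length of order \<open>i\<close>, hence a second moment of order
  \<open>i^2\<close>; by Markov it reaches \<open>i^2 g\<close> with probability of order
  \<open>1 / i^2\<close>, which is summable.\<close>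

lemma ray_piece_AE:
  assumes u: "ple 0 u" and g: "g > 0"
  shows "AE \<omega> in M. \<forall>\<^sub>F i in sequentially.
    path_wt (abs_config \<omega>) (sc (i\<^sup>2) u) (ray_piece u i) < real (i\<^sup>2) * g"
proof -
  let ?T = "\<lambda>i \<omega>. path_wt (abs_config \<omega>) (sc (i\<^sup>2) u) (ray_piece u i)"
  let ?c = "real (nat (fst u + snd u))"
  have m2: "m2 \<ge> 0" by (auto simp: m2_def intro!: add_nonneg_nonneg integral_nonneg_AE)
  have "AE \<omega> in M. \<forall>\<^sub>F i in sequentially. \<not> real (i\<^sup>2) * g \<le> ?T i \<omega>"
  proof (rule AE_eventually_inverse_square)
    fix i :: nat assume i: "i > 0"
    have "prob {\<omega>\<in>space M. (real (i\<^sup>2) * g)\<^sup>2 \<le> (?T i \<omega>)\<^sup>2}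
        \<le> expectation (\<lambda>\<omega>. (?T i \<omega>)\<^sup>2) / (real (i\<^sup>2) * g)\<^sup>2"
      using i g second_moment_path_abs by (intro integral_Markov_inequality_measure[of _ _ "{}"]) auto
    also have "\<dots> \<le> ((real (2 * i + 1) * ?c)\<^sup>2 * m2) / (real (i\<^sup>2) * g)\<^sup>2"
      using second_moment_path_abs[of "sc (i\<^sup>2) u" "ray_piece u i"]
      by (intro divide_right_mono) (simp_all only: length_ray_piece[OF u] of_nat_mult zero_le_power2)
    also have "\<dots> \<le> ((3 * real i * ?c)\<^sup>2 * m2) / (real (i\<^sup>2) * g)\<^sup>2"
      using i m2 by (intro divide_right_mono mult_right_mono power_mono) auto
    also have "\<dots> = (9 * ?c\<^sup>2 * m2 / g\<^sup>2) / (real i)\<^sup>2"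
      using i g by (simp add: power2_eq_square mult_ac)
    finally have "prob {\<omega>. (real (i\<^sup>2) * g)\<^sup>2 \<le> (?T i \<omega>)\<^sup>2} \<le> (9 * ?c\<^sup>2 * m2 / g\<^sup>2) / (real i)\<^sup>2"
      by simp
    moreover have "prob {\<omega>. real (i\<^sup>2) * g \<le> ?T i \<omega>} \<le> prob {\<omega>. (real (i\<^sup>2) * g)\<^sup>2 \<le> (?T i \<omega>)\<^sup>2}"
    proof (rule finite_measure_mono)
      show "{\<omega>. real (i\<^sup>2) * g \<le> ?T i \<omega>} \<subseteq> {\<omega>. (real (i\<^sup>2) * g)\<^sup>2 \<le> (?T i \<omega>)\<^sup>2}"
        using g by (auto intro!: power_mono)
      have "{\<omega>\<in>space M. (real (i\<^sup>2) * g)\<^sup>2 \<le> (?T i \<omega>)\<^sup>2} \<in> events" by measurable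
      then show "{\<omega>. (real (i\<^sup>2) * g)\<^sup>2 \<le> (?T i \<omega>)\<^sup>2} \<in> events" by simp
    qed
    ultimately show "prob {\<omega>. real (i\<^sup>2) * g \<le> ?T i \<omega>} \<le> (9 * ?c\<^sup>2 * m2 / g\<^sup>2) / (real i)\<^sup>2"
      by linarith
  qed measurable
  then show ?thesis by (simp add: not_le)
qed

end

context fpp_time_constant
begin

text \<open>In terms of \<open>B(x, y) = L(x, v) - L(y, v)\<close>, the right-hand side is the block
  sum from \<open>- n \<eta>\<close> to \<open>0\<close> minus \<open>B(- n \<eta>, 0)\<close>: on
  this event \<open>B\<close> lags behind the blocks at linear rate \<open>l\<close>.\<close>

definition backlog :: "site \<Rightarrow> site \<Rightarrow> real \<Rightarrow> nat \<Rightarrow> config set" where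
  "backlog \<eta> v l J = {\<omega>. \<exists>n\<in>{1..J}. l * real n <
     (\<Sum>j<n. blk (- sc n \<eta>) \<eta> j \<omega>) - passage \<omega> (- sc n \<eta>) v + passage \<omega> 0 v}"

lemma backlog_measurable [measurable]: "backlog \<eta> v l J \<in> events"
proof -
  have "{\<omega>\<in>space M. \<exists>n\<in>{1..J}. l * real n <
     (\<Sum>j<n. blk (- sc n \<eta>) \<eta> j \<omega>) - passage \<omega> (- sc n \<eta>) v + passage \<omega> 0 v} \<in> events"
    by measurable
  then show ?thesis by (simp add: backlog_def)
qed

text \<open>Stationarity replaces the targets \<open>sc k \<eta> + c\<close> seen from
  \<open>0\<close> by one target \<open>t\<close> seen from the points \<open>sc i \<eta>\<close>
  with \<open>i = K - k\<close>. The backlog becomes a sum of the triangle deficits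
  \<open>b m\<close> over a window that ends at \<open>i\<close>, and the maximal inequality bounds
  the number of bad \<open>i\<close> by the total deficit, which telescopes. The offset
  \<open>c\<close> later allows geodesics from two starting points to share one target.\<close>

lemma sum_prob_backlog:
  assumes \<eta>: "ple 0 \<eta>" and c: "ple 0 c" "ple c \<eta>" and l: "l > 0"
  shows "l * (\<Sum>k=1..N. prob (backlog \<eta> (sc k \<eta> + c) l J))
    \<le> real (N + J) * (EL \<eta> - ellv \<eta>) + (EL c + EL (\<eta> - c) - ellv \<eta>)"
proof -
  \<comment> \<open>The extra \<open>J\<close> makes every \<open>i = K - k\<close> with
    \<open>k \<le> N\<close> at least \<open>J\<close>, so no window reaches below index
    \<open>0\<close>.\<close>
  define K where "K = N + J"
  define t where "t = sc K \<eta> + c"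
  define b where "b m \<omega> = passage \<omega> (sc m \<eta>) (sc (Suc m) \<eta>) - passage \<omega> (sc m \<eta>) t
      + passage \<omega> (sc (Suc m) \<eta>) t" for m \<omega>
  have b_int [simp]: "integrable M (b m)" for m unfolding b_def[abs_def] by simp
  have b0: "0 \<le> b m \<omega>" if "m < K" for m \<omega>
  proof -
    have "ple (sc (Suc m) \<eta>) (sc K \<eta>)" using that \<eta> by (intro sc_mono) auto
    then have "ple (sc (Suc m) \<eta>) t" unfolding t_def using c(1) ple_trans ple_add by blast
    then show ?thesis
      using passage_triangle[of "sc m \<eta>" "sc (Suc m) \<eta>" t \<omega>] sc_mono[OF \<eta>, of m "Suc m"]
      by (simp add: b_def)
  qed
  have b_sum: "(\<Sum>m=p..<p+n. b m \<omega>) = (\<Sum>j<n. passage \<omega> (sc (p + j) \<eta>) (sc (Suc (p + j)) \<eta>))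
      - passage \<omega> (sc p \<eta>) t + passage \<omega> (sc (p + n) \<eta>) t" for p n \<omega>
    by (induction n) (auto simp: b_def)
  let ?P = "\<lambda>i \<omega>. \<exists>n\<in>{1..i}. l * real n < (\<Sum>m=i-n..<i. b m \<omega>)"
  let ?A = "\<lambda>i. {\<omega>. ?P i \<omega>}"
  have A[measurable]: "?A i \<in> events" for i
  proof -
    have "{\<omega>\<in>space M. ?P i \<omega>} \<in> events" unfolding b_def by measurable
    then show ?thesis by simp
  qed
  have shifted: "prob (backlog \<eta> (sc k \<eta> + c) l J) \<le> prob (?A (K - k))" if k: "k \<in> {1..N}" for k
  proof -
    define i where "i = K - k"
    have i: "i \<ge> J" "i + k = K" using k by (auto simp: i_def K_def)
    have "shift (sc i \<eta>) \<omega> \<in> backlog \<eta> (sc k \<eta> + c) l J \<Longrightarrow> \<omega> \<in> ?A i" for \<omega>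
    proof -
      assume "shift (sc i \<eta>) \<omega> \<in> backlog \<eta> (sc k \<eta> + c) l J"
      then obtain n where n: "n \<in> {1..J}" and less: "l * real n <
        (\<Sum>j<n. blk (- sc n \<eta>) \<eta> j (shift (sc i \<eta>) \<omega>))
          - passage (shift (sc i \<eta>) \<omega>) (- sc n \<eta>) (sc k \<eta> + c)
          + passage (shift (sc i \<eta>) \<omega>) 0 (sc k \<eta> + c)"
        by (auto simp: backlog_def)
      define p where "p = i - n"
      have p: "i = p + n" using n i by (auto simp: p_def)
      have t: "sc k \<eta> + c + sc i \<eta> = t"
        using i(2) by (simp add: t_def ac_simps flip: sc_add)
      have s1: "- sc n \<eta> + sc j \<eta> + sc i \<eta> = sc (p + j) \<eta>" for j
        by (simp add: p sc_add)
      have s2: "- sc n \<eta> + sc i \<eta> = sc p \<eta>" by (simp add: p sc_add)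
      have s3: "0 + sc i \<eta> = sc (p + n) \<eta>" by (simp add: p)
      have "l * real n < (\<Sum>m=p..<p+n. b m \<omega>)"
        using less unfolding blk_def passage_shift s1 s2 s3 t b_sum add_Suc_right .
      then have "l * real n < (\<Sum>m=i-n..<i. b m \<omega>)" by (simp add: p)
      then show "\<omega> \<in> ?A i" using n i by auto
    qed
    then have "prob {\<omega>. shift (sc i \<eta>) \<omega> \<in> backlog \<eta> (sc k \<eta> + c) l J} \<le> prob (?A i)"
      by (intro finite_measure_mono A) auto
    then show ?thesis by (simp add: prob_shift i_def)
  qed
  have inj: "inj_on (\<lambda>k. K - k) {1..N}" by (auto simp: inj_on_def K_def)
  have "(\<Sum>k=1..N. prob (backlog \<eta> (sc k \<eta> + c) l J)) \<le> (\<Sum>k=1..N. prob (?A (K - k)))"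
    by (intro sum_mono shifted)
  also have "\<dots> = (\<Sum>i\<in>(\<lambda>k. K - k) ` {1..N}. prob (?A i))"
    by (simp only: sum.reindex[OF inj] comp_def)
  also have "\<dots> \<le> (\<Sum>i\<le>K. prob (?A i))"
    by (intro sum_mono2) auto
  also have "\<dots> = expectation (\<lambda>\<omega>. \<Sum>i\<le>K. indicat_real (?A i) \<omega>)"
    using A by (subst Bochner_Integration.integral_sum) (simp_all add: emeasure_eq_measure del: One_nat_def)
  finally have "l * (\<Sum>k=1..N. prob (backlog \<eta> (sc k \<eta> + c) l J))
      \<le> expectation (\<lambda>\<omega>. l * (\<Sum>i\<le>K. indicat_real (?A i) \<omega>))"
    using l by simp
  also have "\<dots> \<le> expectation (\<lambda>\<omega>. \<Sum>m<K. b m \<omega>)"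
  proof (rule integral_mono)
    show "integrable M (\<lambda>\<omega>. l * (\<Sum>i\<le>K. indicat_real (?A i) \<omega>))"
      by (intro integrable_mult_right Bochner_Integration.integrable_sum integrable_real_indicator)
        (use A in \<open>simp_all add: emeasure_eq_measure del: One_nat_def\<close>)
    fix \<omega>
    have "(\<Sum>i\<le>K. indicat_real (?A i) \<omega>) = (\<Sum>i\<le>K. if ?P i \<omega> then 1 else 0)"
      by (intro sum.cong) (auto simp: indicator_def)
    also have "\<dots> = card {i. i \<le> K \<and> ?P i \<omega>}"
      by (subst sum.inter_filter[symmetric]) (auto intro: arg_cong[of _ _ card])
    finally show "l * (\<Sum>i\<le>K. indicat_real (?A i) \<omega>) \<le> (\<Sum>m<K. b m \<omega>)"
      using card_large_averages_le[of l K "\<lambda>m. b m \<omega>"] l b0 by simp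
  qed simp
  also have "\<dots> = real K * EL \<eta> - EL t + EL c"
  proof -
    have "(\<lambda>\<omega>. \<Sum>m<K. b m \<omega>) = (\<lambda>\<omega>. (\<Sum>j<K. passage \<omega> (sc j \<eta>) (sc (Suc j) \<eta>))
        - passage \<omega> 0 t + passage \<omega> (sc K \<eta>) t)"
      using b_sum[of _ 0 K] by (simp add: lessThan_atLeast0 fun_eq_iff)
    then show ?thesis
      by (simp add: expectation_passage sc_Suc t_def)
  qed
  \<comment> \<open>A lower bound for \<open>EL t\<close>: subadditivity along
    \<open>sc (Suc K) \<eta> = t + (\<eta> - c)\<close>, combined with \<open>ellv \<le> EL\<close>
    and homogeneity.\<close>
  also have "\<dots> \<le> real K * EL \<eta> - (real (Suc K) * ellv \<eta> - EL (\<eta> - c)) + EL c"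
  proof -
    have "real (Suc K) * ellv \<eta> \<le> EL (sc (Suc K) \<eta>)"
      using ellv_le_EL[OF ple_0_sc[OF \<eta>], of "Suc K"] ellv_sc[OF \<eta>, of "Suc K"] by simp
    also have "sc (Suc K) \<eta> = t + (\<eta> - c)" by (simp add: t_def sc_Suc)
    also have "EL (t + (\<eta> - c)) \<le> EL t + EL (\<eta> - c)"
      using c \<eta> by (intro EL_triangle) (auto simp: t_def ple_def)
    finally show ?thesis by simp
  qed
  also have "\<dots> = real (N + J) * (EL \<eta> - ellv \<eta>) + (EL c + EL (\<eta> - c) - ellv \<eta>)"
    by (simp add: K_def algebra_simps)
  finally show ?thesis .
qed

text \<open>If a geodesic from \<open>0\<close> to a far target \<open>v\<close> in direction \<open>\<eta>\<close> met the ray through \<open>u\<close>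
  near \<open>n u\<close>, then going from \<open>- n \<eta>\<close> through \<open>0\<close> towards \<open>v\<close> would be almost optimal, and
  \<open>n (ellv \<eta> + ellv u)\<close> could not exceed the cost \<open>n ellv (\<eta> + u)\<close> of the direct connection.\<close>

lemma geodesics_avoid_ray:
  assumes \<eta>: "ple 0 \<eta>" and u: "ple 0 u" "0 < fst u" and c: "ple 0 c" "ple c \<eta>"
    and C: "fst \<eta> \<le> int C * fst u"
    and l: "l > 0" and g: "g > 0" and gap: "EL (\<eta> + u) + l + 6 * g \<le> ellv \<eta> + ellv u"
    and \<delta>: "\<delta> > 0"
  obtains I :: nat and N0 :: nat and Z :: "nat \<Rightarrow> config set" where
    "\<And>k. Z k \<in> events"
    "\<And>N. N \<ge> N0 \<Longrightarrow>
      (\<Sum>k=1..N. prob (Z k)) \<le> real N * ((1 + real C) * (EL \<eta> - ellv \<eta>) / l + \<delta>)"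
    "\<And>k \<omega> i s t. \<omega> \<notin> Z k \<Longrightarrow> i \<ge> I \<Longrightarrow> ray_piece u i = s @ t \<Longrightarrow>
      ple (path_end (sc (i\<^sup>2) u) s) (sc k \<eta> + c) \<Longrightarrow>
      passage \<omega> 0 (sc k \<eta> + c) \<noteq> passage \<omega> 0 (path_end (sc (i\<^sup>2) u) s)
        + passage \<omega> (path_end (sc (i\<^sup>2) u) s) (sc k \<eta> + c)"
proof -
  define e where "e = EL \<eta> - ellv \<eta>"
  have e: "e \<ge> 0" using ellv_le_EL[OF \<eta>] by (simp add: e_def)
  define D where "D = EL c + EL (\<eta> - c) - ellv \<eta>"
  have \<eta>u: "ple 0 (\<eta> + u)" using \<eta> u by (auto simp: ple_def)
  let ?T = "\<lambda>i \<omega>. path_wt (abs_config \<omega>) (sc (i\<^sup>2) u) (ray_piece u i)"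
  let ?h = "ellv u - g"
  \<comment> \<open>All estimates at scale \<open>n = i^2\<close> in one predicate, so that a single
    exceptional event \<open>F\<close> serves every target. The last conjunct is deterministic and
    absorbs the distance between consecutive squares.\<close>
  define Q where "Q i \<omega> \<longleftrightarrow> i > 0 \<and>
      \<bar>(\<Sum>j<i\<^sup>2. blk (- sc (i\<^sup>2) \<eta>) \<eta> j \<omega>) - real (i\<^sup>2) * EL \<eta>\<bar> < real (i\<^sup>2) * g \<and>
      \<bar>(\<Sum>j<i\<^sup>2. blk (- sc (i\<^sup>2) \<eta>) (\<eta> + u) j \<omega>) - real (i\<^sup>2) * EL (\<eta> + u)\<bar> < real (i\<^sup>2) * g \<and>
      ?T i \<omega> < real (i\<^sup>2) * g \<and>
      real ((Suc i)\<^sup>2) * ?h \<le> passage \<omega> 0 (sc ((Suc i)\<^sup>2) u) \<and>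
      \<bar>real (2 * i + 1) * ?h\<bar> \<le> real (i\<^sup>2) * g" for i \<omega>
  have Q_meas [measurable]: "Measurable.pred M (Q i)" for i
    unfolding Q_def by measurable
  have ev: "\<forall>\<^sub>F i in sequentially. \<bar>real (2 * i + 1) * ?h\<bar> \<le> real (i\<^sup>2) * g"
  proof -
    obtain m :: nat where m: "3 * \<bar>?h\<bar> / g \<le> real m" using real_arch_simple by blast
    show ?thesis
    proof (rule eventually_sequentiallyI[of "max m 1"])
      fix i :: nat assume i: "max m 1 \<le> i"
      have "\<bar>real (2 * i + 1) * ?h\<bar> = real (2 * i + 1) * \<bar>?h\<bar>" by (simp add: abs_mult)
      also have "\<dots> \<le> real (3 * i) * \<bar>?h\<bar>" using i by (intro mult_right_mono) auto
      also have "\<dots> = real i * (3 * \<bar>?h\<bar>)" by simp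
      also have "\<dots> \<le> real i * (real i * g)"
      proof (intro mult_left_mono)
        have "3 * \<bar>?h\<bar> \<le> real m * g" using m g by (simp add: divide_le_eq)
        also have "\<dots> \<le> real i * g" using i g by (intro mult_right_mono) auto
        finally show "3 * \<bar>?h\<bar> \<le> real i * g" .
      qed simp
      finally show "\<bar>real (2 * i + 1) * ?h\<bar> \<le> real (i\<^sup>2) * g" by (simp add: power2_eq_square)
    qed
  qed
  have "AE \<omega> in M. \<forall>\<^sub>F i in sequentially. Q i \<omega>"
    using blocks_AE[OF \<eta> g, of "\<lambda>i. - sc (i\<^sup>2) \<eta>"] blocks_AE[OF \<eta>u g, of "\<lambda>i. - sc (i\<^sup>2) \<eta>"]
      ray_piece_AE[OF u(1) g] TC_AE[OF u(1)]
  proof eventually_elim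
    case (elim \<omega>)
    have "(\<lambda>i. passage \<omega> 0 (sc ((Suc i)\<^sup>2) u) / real ((Suc i)\<^sup>2)) \<longlonglongrightarrow> ellv u"
      by (rule filterlim_compose[OF elim(4) filterlim_compose[OF filterlim_square filterlim_Suc]])
    then have "\<forall>\<^sub>F i in sequentially. ?h < passage \<omega> 0 (sc ((Suc i)\<^sup>2) u) / real ((Suc i)\<^sup>2)"
      using g by (auto intro: order_tendstoD)
    then have "\<forall>\<^sub>F i in sequentially. real ((Suc i)\<^sup>2) * ?h \<le> passage \<omega> 0 (sc ((Suc i)\<^sup>2) u)"
    proof eventually_elim
      case (elim i)
      have "real ((Suc i)\<^sup>2) > 0" by simp
      then show ?case using elim by (simp only: pos_less_divide_eq mult.commute[of "?h"])
    qed
    then show ?case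
      unfolding Q_def using elim(1-3) ev
      by (intro eventually_conj eventually_gt_at_top)
  qed
  from prob_eventually_small[OF Q_meas this, of "\<delta> / 2"] \<delta>
  obtain I where I: "prob {\<omega>. \<exists>i\<ge>I. \<not> Q i \<omega>} \<le> \<delta> / 2" by auto
  define F where "F = {\<omega>. \<exists>i\<ge>I. \<not> Q i \<omega>}"
  have F [measurable]: "F \<in> events"
  proof -
    have "{\<omega>\<in>space M. \<exists>i\<ge>I. \<not> Q i \<omega>} \<in> events" by measurable
    then show ?thesis by (simp add: F_def)
  qed
  \<comment> \<open>A ray piece that starts at \<open>n u\<close> and has a vertex below the target
    \<open>sc k \<eta> + c\<close> satisfies \<open>n \<le> C (k + 1)\<close>, so longer backlogs
    need not be excluded.\<close>
  define Z where "Z k = backlog \<eta> (sc k \<eta> + c) l (C * (k + 1)) \<union> F" for k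
  \<comment> \<open>Large enough for the terms of \<open>sum_prob_backlog\<close> that do not grow
    with \<open>N\<close> to cost at most \<open>\<delta> / 2\<close> per target; the other
    \<open>\<delta> / 2\<close> is spent on \<open>F\<close>.\<close>
  obtain N0 :: nat where N0: "2 * (real C * e + D) / (l * \<delta>) \<le> real N0" using real_arch_simple by blast
  show ?thesis
  proof (rule that[of Z N0 I])
    show "Z k \<in> events" for k unfolding Z_def by measurable
    fix N assume N: "N \<ge> N0"
    have mono: "backlog \<eta> (sc k \<eta> + c) l (C * (k + 1)) \<subseteq> backlog \<eta> (sc k \<eta> + c) l (C * (N + 1))"
      if "k \<le> N" for k
    proof -
      have "C * (k + 1) \<le> C * (N + 1)" using that by (intro mult_le_mono) auto
      then have "{1..C * (k + 1)} \<subseteq> {1..C * (N + 1)}" by (rule atLeastatMost_subset_iff[THEN iffD2, OF disjI2, OF conjI[OF order_refl]])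
      then show ?thesis unfolding backlog_def by blast
    qed
    have "(\<Sum>k=1..N. prob (Z k))
        \<le> (\<Sum>k=1..N. prob (backlog \<eta> (sc k \<eta> + c) l (C * (N + 1))) + \<delta> / 2)"
    proof (rule sum_mono)
      fix k assume "k \<in> {1..N}"
      then have "prob (Z k) \<le> prob (backlog \<eta> (sc k \<eta> + c) l (C * (N + 1)) \<union> F)"
        unfolding Z_def using mono[of k] by (intro finite_measure_mono) auto
      also have "\<dots> \<le> prob (backlog \<eta> (sc k \<eta> + c) l (C * (N + 1))) + prob F"
        by (intro measure_Un_le) auto
      finally show "prob (Z k) \<le> prob (backlog \<eta> (sc k \<eta> + c) l (C * (N + 1))) + \<delta> / 2"
        using I by (simp add: F_def)
    qed
    also have "\<dots> = (\<Sum>k=1..N. prob (backlog \<eta> (sc k \<eta> + c) l (C * (N + 1)))) + real N * (\<delta> / 2)"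
      by (simp add: sum.distrib)
    also have "(\<Sum>k=1..N. prob (backlog \<eta> (sc k \<eta> + c) l (C * (N + 1))))
        \<le> (real (N + C * (N + 1)) * e + D) / l"
      using sum_prob_backlog[OF \<eta> c l, of "C * (N + 1)" N] l
      by (simp add: e_def D_def pos_le_divide_eq mult.commute)
    also have "(real (N + C * (N + 1)) * e + D) / l
        = real N * ((1 + real C) * e / l) + (real C * e + D) / l"
      using l by (simp add: field_simps)
    also have "(real C * e + D) / l \<le> real N * (\<delta> / 2)"
    proof -
      have "2 * (real C * e + D) / (l * \<delta>) \<le> real N" using N0 N by linarith
      then show ?thesis using l \<delta> by (simp add: field_simps)
    qed
    finally show "(\<Sum>k=1..N. prob (Z k)) \<le> real N * ((1 + real C) * (EL \<eta> - ellv \<eta>) / l + \<delta>)"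
      by (simp add: e_def algebra_simps)
  next
    fix k \<omega> i s t
    assume \<omega>: "\<omega> \<notin> Z k" and i: "i \<ge> I" and st: "ray_piece u i = s @ t"
    define v where "v = sc k \<eta> + c"
    define z where "z = path_end (sc (i\<^sup>2) u) s"
    define n where "n = i\<^sup>2"
    assume "ple (path_end (sc (i\<^sup>2) u) s) (sc k \<eta> + c)"
    then have zv: "ple z v" by (simp add: z_def v_def)
    have "Q i \<omega>" using \<omega> i by (auto simp: Z_def F_def)
    then have n: "n > 0"
      and Q1: "real n * (EL \<eta> - g) < (\<Sum>j<n. blk (- sc n \<eta>) \<eta> j \<omega>)"
      and Q2: "(\<Sum>j<n. blk (- sc n \<eta>) (\<eta> + u) j \<omega>) < real n * (EL (\<eta> + u) + g)"
      and Q3: "?T i \<omega> < real n * g"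
      and Q4: "real ((Suc i)\<^sup>2) * ?h \<le> passage \<omega> 0 (sc ((Suc i)\<^sup>2) u)"
      and Q5: "\<bar>real (2 * i + 1) * ?h\<bar> \<le> real n * g"
      by (auto simp: Q_def n_def algebra_simps abs_less_iff)
    have n_le: "n \<le> C * (k + 1)"
    proof -
      have "int n * fst u \<le> fst z"
        using path_end_ple[of "sc (i\<^sup>2) u" s] by (simp add: z_def n_def ple_def)
      also have "\<dots> \<le> int (k + 1) * fst \<eta>"
        using zv c(2) by (simp add: ple_def v_def algebra_simps)
      also have "\<dots> \<le> int (k + 1) * (int C * fst u)"
        by (intro mult_left_mono C) simp
      finally have "int n * fst u \<le> int (C * (k + 1)) * fst u" by (simp add: algebra_simps)
      then have "int n \<le> int (C * (k + 1))"
        using u(2) mult_le_cancel_right_pos by blast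
      then show ?thesis by (simp only: of_nat_le_iff)
    qed
    have bl: "(\<Sum>j<n. blk (- sc n \<eta>) \<eta> j \<omega>) + passage \<omega> 0 v \<le> l * real n + passage \<omega> (- sc n \<eta>) v"
    proof (rule ccontr)
      assume "\<not> ?thesis"
      then have "\<omega> \<in> backlog \<eta> v l (C * (k + 1))"
        unfolding backlog_def using n n_le by (intro CollectI bexI[of _ n]) auto
      then show False using \<omega> by (simp add: Z_def v_def)
    qed
    have nz: "ple (sc n u) z" by (simp add: z_def n_def path_end_ple)
    have neg: "ple (- sc n \<eta>) (sc n u)"
      using ple_0_sc[OF \<eta>u, of n] by (auto simp: ple_def algebra_simps)
    have p1: "passage \<omega> (- sc n \<eta>) v \<le> passage \<omega> (- sc n \<eta>) (sc n u) + passage \<omega> (sc n u) z + passage \<omega> z v"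
      using passage_triangle[OF neg nz, of \<omega>] passage_triangle[OF ple_trans[OF neg nz] zv, of \<omega>] by linarith
    have p2: "passage \<omega> (- sc n \<eta>) (sc n u) \<le> (\<Sum>j<n. blk (- sc n \<eta>) (\<eta> + u) j \<omega>)"
      using passage_le_blocks[OF \<eta>u, of \<omega> "- sc n \<eta>" n] by (simp add: sc_plus)
    have T: "path_wt (abs_config \<omega>) (sc n u) s + path_wt (abs_config \<omega>) z t = ?T i \<omega>"
      by (simp add: st n_def z_def path_wt_append)
    have p3: "passage \<omega> (sc n u) z \<le> ?T i \<omega>"
      using passage_le[of "sc n u" s z \<omega>] path_wt_le_abs[of \<omega> "sc n u" s]
        path_wt_abs_nonneg[of \<omega> z t] T by (simp add: z_def n_def)
    have zt: "path_end z t = sc ((Suc i)\<^sup>2) u"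
      using path_end_ray_piece[OF u(1), of i] st by (simp add: z_def path_end_append)
    have p4: "passage \<omega> z (sc ((Suc i)\<^sup>2) u) \<le> ?T i \<omega>"
      using passage_le[OF zt, of \<omega>] path_wt_le_abs[of \<omega> z t]
        path_wt_abs_nonneg[of \<omega> "sc n u" s] T by linarith
    have p5: "passage \<omega> 0 (sc ((Suc i)\<^sup>2) u) \<le> passage \<omega> 0 z + passage \<omega> z (sc ((Suc i)\<^sup>2) u)"
      using path_end_ple[of z t] zt ple_trans[OF ple_0_sc[OF u(1)] nz]
      by (intro passage_triangle) auto
    have sq: "real ((Suc i)\<^sup>2) * ?h = real n * ?h + real (2 * i + 1) * ?h"
      unfolding square_Suc_split n_def by (simp add: algebra_simps)
    show "passage \<omega> 0 (sc k \<eta> + c) \<noteq> passage \<omega> 0 (path_end (sc (i\<^sup>2) u) s)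
        + passage \<omega> (path_end (sc (i\<^sup>2) u) s) (sc k \<eta> + c)"
    proof
      assume "passage \<omega> 0 (sc k \<eta> + c) = passage \<omega> 0 (path_end (sc (i\<^sup>2) u) s)
        + passage \<omega> (path_end (sc (i\<^sup>2) u) s) (sc k \<eta> + c)"
      then have "passage \<omega> 0 v = passage \<omega> 0 z + passage \<omega> z v" by (simp add: z_def v_def)
      \<comment> \<open>The six units of \<open>g\<close>: one for each of the two block sums, one
        in \<open>?h\<close>, one for the spacing of squares, and two for the two parts of the ray
        piece.\<close>
      then have "real n * (EL \<eta> - g) + real n * ?h - real n * g
          < l * real n + real n * (EL (\<eta> + u) + g) + 2 * (real n * g)"
        using bl p1 p2 p3 p4 p5 Q1 Q2 Q3 Q4 Q5 unfolding sq by linarith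
      then have "real n * (EL \<eta> + ellv u) < real n * (EL (\<eta> + u) + l + 6 * g)"
        by (simp add: algebra_simps)
      then have "EL \<eta> + ellv u < EL (\<eta> + u) + l + 6 * g"
        using n by (simp only: mult_less_cancel_left_pos of_nat_0_less_iff)
      then show False using gap ellv_le_EL[OF \<eta>] by linarith
    qed
  qed
qed

end

text \<open>Comparison of slopes without division; for positive vectors \<open>a\<close> is the
  steeper one.\<close>

definition dir_less :: "site \<Rightarrow> site \<Rightarrow> bool" where
  "dir_less a b \<longleftrightarrow> fst a * snd b < fst b * snd a"

definition site_pos :: "site \<Rightarrow> bool" where
  "site_pos v \<longleftrightarrow> 0 < fst v \<and> 0 < snd v"

subsection \<open>Geodesics and the ray path\<close>

fun ray_path :: "site \<Rightarrow> nat \<Rightarrow> nat \<Rightarrow> bool list" where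
  "ray_path u i 0 = []"
| "ray_path u i (Suc n) = ray_piece u i @ ray_path u (Suc i) n"

lemma path_end_ray_path:
  assumes "ple 0 u" shows "path_end (sc (i\<^sup>2) u) (ray_path u i n) = sc ((i + n)\<^sup>2) u"
  by (induction n arbitrary: i) (simp_all add: path_end_append path_end_ray_piece[OF assms])

text \<open>A crossing is found somewhere on a concatenation of pieces, while avoidance is stated
  piece by piece; every vertex reached lies on one piece of index at least \<open>i\<close>.\<close>

lemma ray_path_prefix:
  assumes u: "ple 0 u" and "ray_path u i n = t1 @ t2" "n > 0"
  shows "\<exists>j\<ge>i. \<exists>s t. ray_piece u j = s @ t \<and> path_end (sc (i\<^sup>2) u) t1 = path_end (sc (j\<^sup>2) u) s"
  using assms(2,3)
proof (induction n arbitrary: i t1)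
  case (Suc n)
  have "ray_piece u i @ ray_path u (Suc i) n = t1 @ t2" using Suc.prems(1) by simp
  then consider us where "ray_piece u i = t1 @ us"
    | us where "ray_piece u i @ us = t1" "ray_path u (Suc i) n = us @ t2"
    unfolding append_eq_append_conv2 by metis
  then show ?case
  proof cases
    case 1
    then show ?thesis by (intro exI[of _ i] conjI exI[of _ t1] exI[of _ us]) auto
  next
    case 2
    show ?thesis
    proof (cases "n = 0")
      case True
      then have "us = []" using 2(2) by simp
      then show ?thesis
        using 2(1) by (intro exI[of _ i] conjI exI[of _ "ray_piece u i"] exI[of _ "[]"]) auto
    next
      case False
      then obtain j s t where "j \<ge> Suc i" "ray_piece u j = s @ t"
          "path_end (sc ((Suc i)\<^sup>2) u) us = path_end (sc (j\<^sup>2) u) s"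
        using Suc.IH[OF 2(2)] by blast
      then show ?thesis
        by (intro exI[of _ j] conjI exI[of _ s] exI[of _ t])
          (auto simp: 2(1)[symmetric] path_end_append path_end_ray_piece[OF u])
    qed
  qed
qed simp

lemma path_at_height:
  assumes "snd x \<le> h" "h \<le> snd (path_end x s)"
  shows "\<exists>s1 s2. s = s1 @ s2 \<and> snd (path_end x s1) = h"
  using assms
proof (induction s arbitrary: x)
  case (Cons b s)
  show ?case
  proof (cases "snd x = h")
    case True
    then show ?thesis by (intro exI[of _ "[]"] exI[of _ "b # s"]) auto
  next
    case False
    then have "snd (padd x (stepv b)) \<le> h" using Cons.prems(1) by (auto simp: padd_eq)
    then obtain s1 s2 where "s = s1 @ s2" "snd (path_end (padd x (stepv b)) s1) = h"
      using Cons.IH[of "padd x (stepv b)"] Cons.prems(2) by auto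
    then show ?thesis by (intro exI[of _ "b # s1"] exI[of _ s2]) auto
  qed
qed auto

lemma path_at_abscissa:
  assumes "fst x \<le> h" "h \<le> fst (path_end x s)"
  shows "\<exists>s1 s2. s = s1 @ s2 \<and> fst (path_end x s1) = h"
  using assms
proof (induction s arbitrary: x)
  case (Cons b s)
  show ?case
  proof (cases "fst x = h")
    case True
    then show ?thesis by (intro exI[of _ "[]"] exI[of _ "b # s"]) auto
  next
    case False
    then have "fst (padd x (stepv b)) \<le> h" using Cons.prems(1) by (auto simp: padd_eq)
    then obtain s1 s2 where "s = s1 @ s2" "fst (path_end (padd x (stepv b)) s1) = h"
      using Cons.IH[of "padd x (stepv b)"] Cons.prems(2) by auto
    then show ?thesis by (intro exI[of _ "b # s1"] exI[of _ s2]) auto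
  qed
qed auto

text \<open>For a point between \<open>0\<close> and \<open>V\<close>, additivity of passage times
  means that it lies on some geodesic; so the condition concerns all geodesics from \<open>0\<close>
  to \<open>V\<close>, not a chosen one.\<close>

definition avoids_ray :: "config \<Rightarrow> site \<Rightarrow> nat \<Rightarrow> site \<Rightarrow> bool" where
  "avoids_ray \<omega> u I V \<longleftrightarrow> (\<forall>i s t. i \<ge> I \<longrightarrow> ray_piece u i = s @ t \<longrightarrow>
     ple (path_end (sc (i\<^sup>2) u) s) V \<longrightarrow>
     passage \<omega> 0 V \<noteq> passage \<omega> 0 (path_end (sc (i\<^sup>2) u) s) + passage \<omega> (path_end (sc (i\<^sup>2) u) s) V)"

lemma avoids_ray_no_crossing:
  assumes av: "avoids_ray \<omega> u I V" and u: "ple 0 u" and "i0 < i1" "I \<le> i0"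
    and s: "path_end 0 (s1 @ s2) = V" "passage \<omega> 0 V = path_wt \<omega> 0 (s1 @ s2)"
    and z: "s2 = s3 @ s4" "ray_path u i0 (i1 - i0) = t1 @ t2"
      "path_end (path_end 0 s1) s3 = path_end (sc (i0\<^sup>2) u) t1"
  shows False
proof -
  obtain j s t where j: "j \<ge> i0" "ray_piece u j = s @ t"
      "path_end (sc (i0\<^sup>2) u) t1 = path_end (sc (j\<^sup>2) u) s"
    using ray_path_prefix[OF u z(2)] assms(3) by auto
  define p where "p = path_end (sc (j\<^sup>2) u) s"
  have p: "path_end 0 (s1 @ s3) = p" using z(3) j(3) by (simp add: path_end_append p_def)
  have "path_end p s4 = V" using s(1) z(1) p by (simp add: path_end_append)
  then have "ple p V" using path_end_ple by metis
  moreover have "passage \<omega> 0 V = passage \<omega> 0 p + passage \<omega> p V"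
    using s z(1) p by (intro geodesic_split[of 0 "s1 @ s3" s4]) auto
  ultimately show False using av j assms(4) unfolding avoids_ray_def p_def by fastforce
qed

text \<open>The geodesic is followed to the height of \<open>v\<close>. The ray point with index
  \<open>i0\<close> is on the lower right of \<open>v\<close>, the one with index \<open>i1\<close>
  on the upper left of \<open>V\<close>; a geodesic that passed on the left of \<open>v\<close>
  would have to cross the ray between the two.\<close>

lemma geodesic_right_of:
  assumes av: "avoids_ray \<omega> u I V" and u: "ple 0 u" "0 < snd u" and V: "ple 0 V" and v: "0 \<le> snd v" "fst v \<le> fst V"
    and i0: "I \<le> i0" "int (i0\<^sup>2) * snd u \<le> snd v" "fst v \<le> int (i0\<^sup>2) * fst u"
    and i1: "int (i1\<^sup>2) * fst u \<le> fst V" "snd V \<le> int (i1\<^sup>2) * snd u"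
  shows "\<exists>q. ple 0 q \<and> ple q V \<and> upleft v q \<and> passage \<omega> 0 V = passage \<omega> 0 q + passage \<omega> q V"
proof (cases "snd V \<le> snd v")
  case True
  then show ?thesis using V v by (intro exI[of _ V]) (auto simp: upleft_def)
next
  case False
  obtain s where s: "path_end 0 s = V" "passage \<omega> 0 V = path_wt \<omega> 0 s"
    using passage_attained[OF V] .
  obtain s1 s2 where s12: "s = s1 @ s2" "snd (path_end 0 s1) = snd v"
    using path_at_height[of 0 "snd v" s] False v s by auto
  define q where "q = path_end 0 s1"
  have q: "ple 0 q" "path_end q s2 = V"
    using path_end_ple[of 0 s1] s s12 by (auto simp: q_def path_end_append)
  have "fst v \<le> fst q"
  proof (rule ccontr)
    assume c: "\<not> fst v \<le> fst q"
    have "int (i0\<^sup>2) * snd u < int (i1\<^sup>2) * snd u" using i0 i1 False by linarith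
    then have "int (i0\<^sup>2) < int (i1\<^sup>2)" using u(2) by (simp only: mult_less_cancel_right_pos)
    then have "i0\<^sup>2 < i1\<^sup>2" by (simp only: of_nat_less_iff)
    then have lt: "i0 < i1" by (rule power_less_imp_less_base) simp
    have "upleft q (sc (i0\<^sup>2) u)" using c i0 s12 by (auto simp: upleft_def q_def)
    moreover have "path_end (sc (i0\<^sup>2) u) (ray_path u i0 (i1 - i0)) = sc (i1\<^sup>2) u"
      using path_end_ray_path[OF u(1)] lt by simp
    moreover have "upleft (sc (i1\<^sup>2) u) V" using i1 by (auto simp: upleft_def)
    ultimately obtain s3 s4 t1 t2 where *: "s2 = s3 @ s4" "ray_path u i0 (i1 - i0) = t1 @ t2"
        "path_end q s3 = path_end (sc (i0\<^sup>2) u) t1"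
      using paths_cross[of q "sc (i0\<^sup>2) u" "ray_path u i0 (i1 - i0)" s2] q by auto
    show False
      using avoids_ray_no_crossing[OF av u(1) lt i0(1) s[unfolded s12(1)] *(1,2)] *(3) by (simp add: q_def)
  qed
  moreover have "passage \<omega> 0 V = passage \<omega> 0 q + passage \<omega> q V"
    using s s12 by (intro geodesic_split[of 0 s1 s2]) (auto simp: q_def)
  moreover have "ple q V" using path_end_ple[of q s2] q by simp
  ultimately show ?thesis using q s12 by (intro exI[of _ q]) (auto simp: upleft_def q_def)
qed

text \<open>The mirror image, with the geodesic followed to the abscissa of
  \<open>v\<close>.\<close>

lemma geodesic_left_of:
  assumes av: "avoids_ray \<omega> u I V" and u: "ple 0 u" "0 < fst u" and V: "ple 0 V" and v: "0 \<le> fst v" "snd v \<le> snd V"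
    and i0: "I \<le> i0" "int (i0\<^sup>2) * fst u \<le> fst v" "snd v \<le> int (i0\<^sup>2) * snd u"
    and i1: "int (i1\<^sup>2) * snd u \<le> snd V" "fst V \<le> int (i1\<^sup>2) * fst u"
  shows "\<exists>q. ple 0 q \<and> ple q V \<and> upleft q v \<and> passage \<omega> 0 V = passage \<omega> 0 q + passage \<omega> q V"
proof (cases "fst V \<le> fst v")
  case True
  then show ?thesis using V v by (intro exI[of _ V]) (auto simp: upleft_def)
next
  case False
  obtain s where s: "path_end 0 s = V" "passage \<omega> 0 V = path_wt \<omega> 0 s"
    using passage_attained[OF V] .
  obtain s1 s2 where s12: "s = s1 @ s2" "fst (path_end 0 s1) = fst v"
    using path_at_abscissa[of 0 "fst v" s] False v s by auto
  define q where "q = path_end 0 s1"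
  have q: "ple 0 q" "path_end q s2 = V"
    using path_end_ple[of 0 s1] s s12 by (auto simp: q_def path_end_append)
  have "snd v \<le> snd q"
  proof (rule ccontr)
    assume c: "\<not> snd v \<le> snd q"
    have "int (i0\<^sup>2) * fst u < int (i1\<^sup>2) * fst u" using i0 i1 False by linarith
    then have "int (i0\<^sup>2) < int (i1\<^sup>2)" using u(2) by (simp only: mult_less_cancel_right_pos)
    then have "i0\<^sup>2 < i1\<^sup>2" by (simp only: of_nat_less_iff)
    then have lt: "i0 < i1" by (rule power_less_imp_less_base) simp
    have "upleft (sc (i0\<^sup>2) u) q" using c i0 s12 by (auto simp: upleft_def q_def)
    moreover have "path_end (sc (i0\<^sup>2) u) (ray_path u i0 (i1 - i0)) = sc (i1\<^sup>2) u"
      using path_end_ray_path[OF u(1)] lt by simp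
    moreover have "upleft V (sc (i1\<^sup>2) u)" using i1 by (auto simp: upleft_def)
    ultimately obtain s3 s4 t1 t2 where *: "s2 = s3 @ s4" "ray_path u i0 (i1 - i0) = t1 @ t2"
        "path_end q s3 = path_end (sc (i0\<^sup>2) u) t1"
      using paths_cross[of "sc (i0\<^sup>2) u" q s2 "ray_path u i0 (i1 - i0)"] q by metis
    show False
      using avoids_ray_no_crossing[OF av u(1) lt i0(1) s[unfolded s12(1)] *(1,2)] *(3) by (simp add: q_def)
  qed
  moreover have "passage \<omega> 0 V = passage \<omega> 0 q + passage \<omega> q V"
    using s s12 by (intro geodesic_split[of 0 s1 s2]) (auto simp: q_def)
  moreover have "ple q V" using path_end_ple[of q s2] q by simp
  ultimately show ?thesis using q s12 by (intro exI[of _ q]) (auto simp: upleft_def q_def)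
qed

text \<open>Ray pieces start at square multiples only, so such a multiple of \<open>u\<close> on the
  lower right of \<open>v\<close> has to be found. The largest \<open>i\<close> with
  \<open>i^2 u2 \<le> v2\<close> works: passing to the next square costs a term linear in
  \<open>i\<close>, while the strict inequality between integers gains \<open>i^2\<close>. The slack
  \<open>b\<close> allows \<open>v\<close> to be moved by a bounded amount.\<close>

lemma square_index:
  fixes a1 a2 u1 u2 b :: int and I :: nat
  assumes pos: "0 < a1" "0 < a2" "0 < u1" "0 < u2" "0 \<le> b" and lt: "u2 * a1 < u1 * a2"
  shows "\<exists>R. \<forall>v1 v2. R \<le> v2 \<longrightarrow> v1 * a2 \<le> (v2 + b) * a1 \<longrightarrow>
    (\<exists>i\<ge>I. int (i\<^sup>2) * u2 \<le> v2 \<and> v1 \<le> int (i\<^sup>2) * u1)"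
proof -
  \<comment> \<open>From this index on, the linear term is at most \<open>i^2\<close>.\<close>
  define J where "J = max (max I 1) (nat (3 * u2 * a1 + b * a1))"
  show ?thesis
  proof (intro exI[of _ "int (J\<^sup>2) * u2"] allI impI)
    fix v1 v2 assume v2: "int (J\<^sup>2) * u2 \<le> v2" and v: "v1 * a2 \<le> (v2 + b) * a1"
    have "\<exists>j. v2 < int (j\<^sup>2) * u2"
    proof
      have 0: "0 \<le> v2" using v2 pos by (meson mult_nonneg_nonneg of_nat_0_le_iff order_trans less_imp_le)
      have "v2 < (v2 + 1) * (v2 + 1)"
        using 0 mult_nonneg_nonneg[OF 0 0] unfolding distrib_left distrib_right by linarith
      also have "\<dots> \<le> (v2 + 1) * (v2 + 1) * u2"
        using mult_left_mono[of 1 u2 "(v2 + 1) * (v2 + 1)"] 0 pos by simp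
      also have "(v2 + 1) * (v2 + 1) = int ((nat v2 + 1)\<^sup>2)"
        using 0 by (simp add: power2_eq_square algebra_simps)
      finally show "v2 < int ((nat v2 + 1)\<^sup>2) * u2" .
    qed
    then obtain j where j: "v2 < int (j\<^sup>2) * u2" "\<And>m. m < j \<Longrightarrow> \<not> v2 < int (m\<^sup>2) * u2"
      using exists_least_iff[of "\<lambda>j. v2 < int (j\<^sup>2) * u2"] by blast
    have "J < j"
    proof (rule ccontr)
      assume "\<not> J < j"
      then have "int (j\<^sup>2) \<le> int (J\<^sup>2)" by (simp only: of_nat_le_iff power_mono not_less)
      then have "int (j\<^sup>2) * u2 \<le> int (J\<^sup>2) * u2" using pos by (intro mult_right_mono) auto
      then show False using j(1) v2 by linarith
    qed
    then obtain i where i: "j = Suc i" "J \<le> i" by (cases j) auto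
    have i1: "int (i\<^sup>2) * u2 \<le> v2" using j(2)[of i] i by simp
    have big: "3 * u2 * a1 + b * a1 \<le> int i" "1 \<le> int i" using i(2) unfolding J_def by linarith+
    have "v1 * a2 \<le> (int (j\<^sup>2) * u2 + b) * a1"
      using v j(1) pos by (intro order_trans[OF v] mult_right_mono) auto
    also have "\<dots> = int (i\<^sup>2) * (u2 * a1) + ((2 * int i + 1) * (u2 * a1) + b * a1)"
      unfolding i(1) by (simp add: power2_eq_square algebra_simps)
    also have "(2 * int i + 1) * (u2 * a1) + b * a1 \<le> int i * (3 * u2 * a1) + int i * (b * a1)"
    proof (rule add_mono)
      have "(2 * int i + 1) * (u2 * a1) \<le> (3 * int i) * (u2 * a1)"
        using big(2) pos by (intro mult_right_mono) auto
      then show "(2 * int i + 1) * (u2 * a1) \<le> int i * (3 * u2 * a1)" by (simp add: algebra_simps)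
      show "b * a1 \<le> int i * (b * a1)"
        using big(2) pos mult_right_mono[of 1 "int i" "b * a1"] by simp
    qed
    also have "int i * (3 * u2 * a1) + int i * (b * a1) \<le> int i * int i"
      using big(1) mult_left_mono[of "3 * u2 * a1 + b * a1" "int i" "int i"] by (simp add: distrib_left)
    also have "int (i\<^sup>2) * (u2 * a1) + int i * int i = int (i\<^sup>2) * (u2 * a1 + 1)"
      by (simp add: power2_eq_square algebra_simps)
    also have "\<dots> \<le> int (i\<^sup>2) * (u1 * a2)" using lt by (intro mult_left_mono) auto
    finally have "v1 * a2 \<le> (int (i\<^sup>2) * u1) * a2" by (simp add: algebra_simps)
    then have "v1 \<le> int (i\<^sup>2) * u1" using pos(2) mult_le_cancel_right_pos by blast
    moreover have "I \<le> i" using i(2) by (simp add: J_def)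
    ultimately show "\<exists>i\<ge>I. int (i\<^sup>2) * u2 \<le> v2 \<and> v1 \<le> int (i\<^sup>2) * u1" using i1 by blast
  qed
qed


subsection \<open>Busemann increments are eventually ordered by direction\<close>

locale fpp = fpp_time_constant +
  assumes diff: "\<forall>\<xi>::real \<times> real. 0 < fst \<xi> \<and> 0 < snd \<xi> \<longrightarrow> ell differentiable (at \<xi>)"
    and sconv: "strictly_convex_on dirs ell"
begin

text \<open>Both vectors are normalised to the segment \<open>dirs\<close>; homogeneity then turns
  strict convexity there into a strict gap for non-parallel vectors.\<close>

lemma ellv_strict_subadditive:
  assumes pos: "site_pos u" "site_pos w" and np: "fst u * snd w \<noteq> fst w * snd u"
  shows "ellv (u + w) < ellv u + ellv w"
proof -
  define d where "d v = (real_of_int (fst v) / real_of_int (fst v + snd v),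
      real_of_int (snd v) / real_of_int (fst v + snd v))" for v :: site
  have dd: "d v \<in> dirs" and ed: "ellv v = real_of_int (fst v + snd v) * ell (d v)" if "site_pos v" for v
  proof -
    have p: "0 < fst v" "0 < snd v" using that by (auto simp: site_pos_def)
    then have n: "real (nat (fst v + snd v)) = real_of_int (fst v + snd v)" by simp
    have "snd (d v) = 1 - fst (d v)"
      using p by (simp add: d_def field_simps add_pos_pos flip: of_int_add)
    moreover have "0 < fst (d v)" "fst (d v) < 1" using p by (simp_all add: d_def add_pos_pos)
    ultimately show "d v \<in> dirs" unfolding dirs_def by (auto simp: prod_eq_iff)
    show "ellv v = real_of_int (fst v + snd v) * ell (d v)"
      using ell_scale[of "fst (d v)" "snd (d v)" "nat (fst v + snd v)"] p
      unfolding n by (simp add: d_def ellv_def)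
  qed
  have p: "0 < fst u" "0 < snd u" "0 < fst w" "0 < snd w" using pos by (auto simp: site_pos_def)
  define a b where "a = real_of_int (fst u + snd u)" and "b = real_of_int (fst w + snd w)"
  have ab: "a > 0" "b > 0" using p by (auto simp: a_def b_def)
  define t where "t = a / (a + b)"
  have t: "0 < t" "t < 1" "1 - t = b / (a + b)" using ab by (auto simp: t_def field_simps)
  have "site_pos (u + w)" using p by (auto simp: site_pos_def)
  moreover have "d (u + w) = t *\<^sub>R d u + (1 - t) *\<^sub>R d w"
    unfolding t(3) unfolding t_def d_def using ab
    by (simp add: a_def[symmetric] b_def[symmetric] add_divide_distrib flip: of_int_add)
      (simp add: a_def b_def add_divide_distrib ac_simps)
  moreover have ne: "d u \<noteq> d w"
  proof
    assume "d u = d w"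
    then have "real_of_int (fst u) * b = real_of_int (fst w) * a"
      using ab unfolding d_def a_def[symmetric] b_def[symmetric] prod.inject
      by (simp add: field_simps)
    then have "fst u * (fst w + snd w) = fst w * (fst u + snd u)"
      unfolding a_def b_def by (metis of_int_eq_iff of_int_mult)
    then show False using np by (simp add: algebra_simps)
  qed
  moreover have "ell (t *\<^sub>R d u + (1 - t) *\<^sub>R d w) < t * ell (d u) + (1 - t) * ell (d w)"
    using sconv[unfolded strictly_convex_on_def, rule_format, OF dd[OF pos(1)] dd[OF pos(2)] ne t(1,2)] .
  ultimately have "ellv (u + w) < real_of_int (fst (u + w) + snd (u + w)) * (t * ell (d u) + (1 - t) * ell (d w))"
    using p by (simp add: ed add_pos_pos)
  also have "real_of_int (fst (u + w) + snd (u + w)) = a + b" by (simp add: a_def b_def)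
  also have "(a + b) * (t * ell (d u) + (1 - t) * ell (d w)) = a * ell (d u) + b * ell (d w)"
    using ab unfolding t(3) unfolding t_def by (simp add: distrib_left)
  finally show ?thesis using ed pos by (simp add: a_def b_def)
qed

text \<open>\<open>geodesics_avoid_ray\<close> compares \<open>EL\<close> with \<open>ellv\<close>,
  and the difference must be small against the gap. Scaling \<open>\<eta>\<close> and
  \<open>u\<close> by \<open>q^2\<close> achieves this, since the gap grows linearly in
  \<open>q^2\<close>. The bad events remain controlled only on average over
  \<open>k\<close>.\<close>

lemma geodesics_avoid_ray_eventually:
  assumes \<eta>: "site_pos \<eta>" and u: "site_pos u" and np: "fst \<eta> * snd u \<noteq> fst u * snd \<eta>"
    and c: "ple 0 c" "ple c (1, 1)" and \<delta>: "\<delta> > 0"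
  shows "\<forall>\<^sub>F q in sequentially. \<exists>I N0 Z. (\<forall>k. Z k \<in> events) \<and>
    (\<forall>N\<ge>N0. (\<Sum>k=1..N. prob (Z k)) \<le> real N * \<delta>) \<and>
    (\<forall>k \<omega>. \<omega> \<notin> Z k \<longrightarrow> avoids_ray \<omega> (sc (q\<^sup>2) u) I (sc k (sc (q\<^sup>2) \<eta>) + c))"
proof -
  define gap where "gap = ellv \<eta> + ellv u - ellv (\<eta> + u)"
  have gap: "gap > 0" using ellv_strict_subadditive[OF \<eta> u np] by (simp add: gap_def)
  define C where "C = nat (fst \<eta>)"
  \<comment> \<open>Chosen so that \<open>(1 + C) p \<epsilon> / (p gap / 8) = \<delta> / 2\<close>.
    The gap is spent in eighths: one for \<open>l\<close>, six for \<open>6 g\<close>, one for the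
    error in \<open>EL (\<eta> + u)\<close>.\<close>
  define \<epsilon> where "\<epsilon> = gap * \<delta> / (16 * (1 + real C))"
  have \<epsilon>: "\<epsilon> > 0" using gap \<delta> by (simp add: \<epsilon>_def)
  have p0: "ple 0 \<eta>" "ple 0 u" "ple 0 (\<eta> + u)"
    using \<eta> u by (auto simp: site_pos_def ple_def)
  have "\<forall>\<^sub>F q in sequentially. EL (sc (q\<^sup>2) \<eta>) \<le> real (q\<^sup>2) * (ellv \<eta> + \<epsilon>)"
    by (rule EL_eventually_le[OF p0(1) \<epsilon>])
  moreover have "\<forall>\<^sub>F q in sequentially. EL (sc (q\<^sup>2) (\<eta> + u)) \<le> real (q\<^sup>2) * (ellv (\<eta> + u) + gap / 8)"
    using gap by (intro EL_eventually_le[OF p0(3)]) auto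
  moreover have "\<forall>\<^sub>F q::nat in sequentially. q > 0" by (rule eventually_gt_at_top)
  ultimately show ?thesis
  proof eventually_elim
    case (elim q)
    define p where "p = real (q\<^sup>2)"
    have p: "p > 0" "q\<^sup>2 \<ge> 1" using elim by (auto simp: p_def)
    let ?\<eta> = "sc (q\<^sup>2) \<eta>" and ?u = "sc (q\<^sup>2) u"
    have a1: "ple 0 ?\<eta>" "ple 0 ?u" by (intro ple_0_sc p0)+
    have a2: "0 < fst ?u" using u elim by (simp add: site_pos_def)
    have "1 \<le> int (q\<^sup>2) * k" if "0 < k" for k using p(2) that
      by (metis int_one_le_iff_zero_less mult_pos_pos of_nat_0_less_iff less_le_trans zero_less_one)
    then have a3: "ple c ?\<eta>" using c(2) \<eta> by (force simp: ple_def site_pos_def)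
    have "fst \<eta> * 1 \<le> fst \<eta> * fst u" using u \<eta> by (intro mult_left_mono) (auto simp: site_pos_def)
    then have a4: "fst ?\<eta> \<le> int C * fst ?u"
      using \<eta> mult_left_mono[of "fst \<eta>" "fst \<eta> * fst u" "int (q\<^sup>2)"]
      by (simp add: C_def site_pos_def algebra_simps)
    have a5: "p * gap / 8 > 0" using p gap by simp
    have a6: "EL (?\<eta> + ?u) + p * gap / 8 + 6 * (p * gap / 8) \<le> ellv ?\<eta> + ellv ?u"
      using elim(2) unfolding ellv_sc[OF p0(1)] ellv_sc[OF p0(2)] sc_plus[symmetric] p_def[symmetric]
      by (simp add: gap_def algebra_simps) (simp add: field_simps)
    have a7: "\<delta> / 2 > 0" using \<delta> by simp
    have "EL ?\<eta> - ellv ?\<eta> \<le> p * \<epsilon>"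
      using elim(1) unfolding ellv_sc[OF p0(1)] by (simp add: p_def algebra_simps)
    then have "(1 + real C) * (EL ?\<eta> - ellv ?\<eta>) / (p * gap / 8) \<le> (1 + real C) * (p * \<epsilon>) / (p * gap / 8)"
      using a5 by (intro divide_right_mono mult_left_mono) auto
    also have "\<dots> = \<delta> / 2"
    proof -
      have "D * (p * (gap * \<delta> / (16 * D))) / (p * gap / 8) = \<delta> / 2" if "D > 0" for D :: real
        using p gap that by (simp add: field_simps)
      from this[of "1 + real C"] show ?thesis unfolding \<epsilon>_def by linarith
    qed
    finally have small: "(1 + real C) * (EL ?\<eta> - ellv ?\<eta>) / (p * gap / 8) + \<delta> / 2 \<le> \<delta>" by linarith
    obtain I N0 Z where Z: "\<And>k. Z k \<in> events"
      "\<And>N. N \<ge> N0 \<Longrightarrow> (\<Sum>k=1..N. prob (Z k))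
          \<le> real N * ((1 + real C) * (EL ?\<eta> - ellv ?\<eta>) / (p * gap / 8) + \<delta> / 2)"
      "\<And>k \<omega> i s t. \<omega> \<notin> Z k \<Longrightarrow> i \<ge> I \<Longrightarrow> ray_piece ?u i = s @ t \<Longrightarrow>
        ple (path_end (sc (i\<^sup>2) ?u) s) (sc k ?\<eta> + c) \<Longrightarrow>
        passage \<omega> 0 (sc k ?\<eta> + c) \<noteq> passage \<omega> 0 (path_end (sc (i\<^sup>2) ?u) s)
          + passage \<omega> (path_end (sc (i\<^sup>2) ?u) s) (sc k ?\<eta> + c)"
      by (rule geodesics_avoid_ray[OF a1(1) a1(2) a2 c(1) a3 a4 a5 a5 a6 a7]) (rule that)
    have "(\<Sum>k=1..N. prob (Z k)) \<le> real N * \<delta>" if "N \<ge> N0" for N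
      using Z(2)[OF that] mult_left_mono[OF small, of "real N"] by linarith
    moreover have "avoids_ray \<omega> ?u I (sc k ?\<eta> + c)" if "\<omega> \<notin> Z k" for k \<omega>
      unfolding avoids_ray_def using Z(3)[OF that] by blast
    ultimately show ?case using Z(1) by blast
  qed
qed

text \<open>Between the directions of \<open>a\<close> and \<open>a'\<close> there is room for a target direction \<open>\<eta>\<close> and two
  separating rays \<open>u\<close> and \<open>u'\<close>. Since the geodesics from \<open>x\<close> and \<open>y\<close> to a far target cannot
  cross back over these rays, the increment at the far target separates the two families.\<close>

lemma increments_ordered_box:
  fixes a u \<eta> u' a' x y :: site
  assumes pos: "site_pos a" "site_pos u" "site_pos \<eta>" "site_pos u'" "site_pos a'"
    and lt: "dir_less a u" "dir_less u \<eta>" "dir_less \<eta> u'" "dir_less u' a'"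
    and xy: "ple 0 x" "ple x (1, 1)" "ple 0 y" "ple y (1, 1)" "upleft x y" and \<delta>: "\<delta> > 0"
  shows "\<exists>R::int. R \<ge> 1 \<and> (\<forall>S. prob {\<omega>. \<forall>v\<in>{R..S} \<times> {R..S}. \<forall>w\<in>{R..S} \<times> {R..S}.
      fst v * snd a \<le> snd v * fst a \<longrightarrow> snd w * fst a' \<le> fst w * snd a' \<longrightarrow>
      passage \<omega> x v - passage \<omega> y v \<le> passage \<omega> x w - passage \<omega> y w} \<ge> 1 - \<delta>)"
proof -
  \<comment> \<open>There are two families of bad events, and only about half of the indices up to
    \<open>N\<close> are sure to lie beyond \<open>K\<close>; hence a quarter.\<close>
  define \<delta>' where "\<delta>' = \<delta> / 4"
  have \<delta>': "\<delta>' > 0" using \<delta> by (simp add: \<delta>'_def)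
  \<comment> \<open>The geodesics from \<open>x\<close> and from \<open>y\<close> go to the same
    target \<open>V = sc k E + (1, 1)\<close>; relative to its own starting point each sees a
    different offset.\<close>
  define cx cy where "cx = (1, 1) - x" and "cy = (1, 1) - y"
  have c: "ple 0 cx" "ple cx (1, 1)" "ple 0 cy" "ple cy (1, 1)"
    using xy by (auto simp: cx_def cy_def ple_def)
  have np: "fst \<eta> * snd u \<noteq> fst u * snd \<eta>" "fst \<eta> * snd u' \<noteq> fst u' * snd \<eta>"
    using lt by (auto simp: dir_less_def)
  note evs = geodesics_avoid_ray_eventually[OF pos(3,2) np(1) c(1,2) \<delta>']
    geodesics_avoid_ray_eventually[OF pos(3,4) np(2) c(3,4) \<delta>'] eventually_gt_at_top[of "0::nat"]
  from eventually_happens[OF eventually_conj[OF evs(1) eventually_conj[OF evs(2,3)]]]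
  obtain q I1 N1 Z1 I2 N2 Z2 where q: "q > 0" and
    Z1: "\<And>k. Z1 k \<in> events" "\<And>N. N \<ge> N1 \<Longrightarrow> (\<Sum>k=1..N. prob (Z1 k)) \<le> real N * \<delta>'"
      "\<And>k \<omega>. \<omega> \<notin> Z1 k \<Longrightarrow> avoids_ray \<omega> (sc (q\<^sup>2) u) I1 (sc k (sc (q\<^sup>2) \<eta>) + cx)" and
    Z2: "\<And>k. Z2 k \<in> events" "\<And>N. N \<ge> N2 \<Longrightarrow> (\<Sum>k=1..N. prob (Z2 k)) \<le> real N * \<delta>'"
      "\<And>k \<omega>. \<omega> \<notin> Z2 k \<Longrightarrow> avoids_ray \<omega> (sc (q\<^sup>2) u') I2 (sc k (sc (q\<^sup>2) \<eta>) + cy)"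
    by auto metis
  define p where "p = int (q\<^sup>2)"
  have p: "p > 0" using q by (simp add: p_def)
  define E U U' where "E = sc (q\<^sup>2) \<eta>" and "U = sc (q\<^sup>2) u" and "U' = sc (q\<^sup>2) u'"
  have sE: "fst E = p * fst \<eta>" "snd E = p * snd \<eta>" "fst U = p * fst u" "snd U = p * snd u"
      "fst U' = p * fst u'" "snd U' = p * snd u'"
    by (simp_all add: E_def U_def U'_def p_def)
  have sp: "0 < fst E" "0 < snd E" "0 < fst U" "0 < snd U" "0 < fst U'" "0 < snd U'"
      "0 < fst a" "0 < snd a" "0 < fst a'" "0 < snd a'"
    using pos p by (auto simp: sE site_pos_def)
  have scl: "dir_less a U" "dir_less U E" "dir_less E U'" "dir_less U' a'"
    using lt p by (auto simp: dir_less_def sE mult_ac)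
  have pl: "ple 0 U" "ple 0 U'" using sp by (auto simp: ple_def)
  \<comment> \<open>\<open>R1\<close> and \<open>R2\<close> locate \<open>v\<close> and
    \<open>w\<close> against the rays and enter \<open>R\<close>; \<open>R3\<close> and
    \<open>R4\<close> locate the far target against the rays and only bound \<open>k\<close> from
    below. So \<open>R\<close> depends on neither \<open>S\<close> nor \<open>k\<close>.\<close>
  obtain R1 where R1: "\<And>v1 v2. R1 \<le> v2 \<Longrightarrow> v1 * snd a \<le> (v2 + 1) * fst a \<Longrightarrow>
    \<exists>i\<ge>I1. int (i\<^sup>2) * snd U \<le> v2 \<and> v1 \<le> int (i\<^sup>2) * fst U"
    using square_index[of "fst a" "snd a" "fst U" "snd U" 1 I1] sp scl(1)
    by (auto simp: dir_less_def mult_ac)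
  obtain R2 where R2: "\<And>v1 v2. R2 \<le> v2 \<Longrightarrow> v1 * fst a' \<le> (v2 + 1) * snd a' \<Longrightarrow>
    \<exists>i\<ge>I2. int (i\<^sup>2) * fst U' \<le> v2 \<and> v1 \<le> int (i\<^sup>2) * snd U'"
    using square_index[of "snd a'" "fst a'" "snd U'" "fst U'" 1 I2] sp scl(4)
    by (auto simp: dir_less_def mult_ac)
  obtain R3 where R3: "\<And>v1 v2. R3 \<le> v2 \<Longrightarrow> v1 * fst E \<le> (v2 + (fst E + 1)) * snd E \<Longrightarrow>
    \<exists>i\<ge>0. int (i\<^sup>2) * fst U \<le> v2 \<and> v1 \<le> int (i\<^sup>2) * snd U"
    using square_index[of "snd E" "fst E" "snd U" "fst U" "fst E + 1" 0] sp scl(2)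
    by (auto simp: dir_less_def mult_ac)
  obtain R4 where R4: "\<And>v1 v2. R4 \<le> v2 \<Longrightarrow> v1 * snd E \<le> (v2 + (snd E + 1)) * fst E \<Longrightarrow>
    \<exists>i\<ge>0. int (i\<^sup>2) * snd U' \<le> v2 \<and> v1 \<le> int (i\<^sup>2) * fst U'"
    using square_index[of "fst E" "snd E" "fst U'" "snd U'" "snd E + 1" 0] sp scl(3)
    by (auto simp: dir_less_def mult_ac)
  define R where "R = max 1 (max (R1 + 1) (R2 + 1))"
  show ?thesis
  proof (intro exI[of _ R] conjI allI)
    show "R \<ge> 1" by (simp add: R_def)
    fix S
    define K where "K = nat (max 1 (max S (max R3 R4)))"
    have K: "S \<le> int K" "R3 \<le> int K" "R4 \<le> int K" "1 \<le> K" by (auto simp: K_def)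
    \<comment> \<open>If every \<open>k \<ge> K\<close> were bad, the average of the two families
      together up to some \<open>N \<ge> 2 K\<close> would exceed
      \<open>2 \<delta>'\<close>.\<close>
    have "\<exists>k\<ge>K. prob (Z1 k) + prob (Z2 k) \<le> \<delta>"
    proof (rule ccontr)
      assume "\<not> ?thesis"
      then have big: "\<delta> < prob (Z1 k) + prob (Z2 k)" if "k \<ge> K" for k using that by (meson not_le)
      define N where "N = max (max N1 N2) (2 * K)"
      have N: "N \<ge> N1" "N \<ge> N2" "2 * K \<le> N" by (auto simp: N_def)
      have "real N / 2 * \<delta> < real (N + 1 - K) * \<delta>" using N(3) \<delta> by (intro mult_strict_right_mono) auto
      also have "\<dots> = (\<Sum>k=K..N. \<delta>)" by simp
      also have "\<dots> \<le> (\<Sum>k=K..N. prob (Z1 k) + prob (Z2 k))"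
        using big by (intro sum_mono) (auto intro: less_imp_le)
      also have "\<dots> \<le> (\<Sum>k=1..N. prob (Z1 k) + prob (Z2 k))" using K(4) by (intro sum_mono2) auto
      also have "\<dots> \<le> real N * \<delta>' + real N * \<delta>'"
        unfolding sum.distrib by (intro add_mono Z1(2) Z2(2) N)
      also have "\<dots> = real N / 2 * \<delta>" by (simp add: \<delta>'_def)
      finally show False by simp
    qed
    then obtain k where k: "k \<ge> K" "prob (Z1 k) + prob (Z2 k) \<le> \<delta>" by blast
    define B where "B = {\<omega>. shift x \<omega> \<in> Z1 k} \<union> {\<omega>. shift y \<omega> \<in> Z2 k}"
    have m: "{\<omega>. shift x \<omega> \<in> Z1 k} \<in> events" "{\<omega>. shift y \<omega> \<in> Z2 k} \<in> events"
      using measurable_sets[OF shift_measurable Z1(1)[of k], of x] measurable_sets[OF shift_measurable Z2(1)[of k], of y]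
      by (simp_all add: vimage_def)
    have "prob B \<le> prob (Z1 k) + prob (Z2 k)"
      unfolding B_def using measure_Un_le[OF m] by (simp add: prob_shift Z1(1) Z2(1))
    then have pB: "prob B \<le> \<delta>" using k by linarith
    let ?P = "\<lambda>\<omega>. \<forall>v\<in>{R..S} \<times> {R..S}. \<forall>w\<in>{R..S} \<times> {R..S}.
      fst v * snd a \<le> snd v * fst a \<longrightarrow> snd w * fst a' \<le> fst w * snd a' \<longrightarrow>
      passage \<omega> x v - passage \<omega> y v \<le> passage \<omega> x w - passage \<omega> y w"
    have "?P \<omega>" if "\<omega> \<notin> B" for \<omega>
    proof (intro ballI impI)
      fix v w assume v: "v \<in> {R..S} \<times> {R..S}" and w: "w \<in> {R..S} \<times> {R..S}"
        and va: "fst v * snd a \<le> snd v * fst a" and wa: "snd w * fst a' \<le> fst w * snd a'"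
      define V where "V = sc k E + (1, 1)"
      have Vx: "V - x = sc k E + cx" and Vy: "V - y = sc k E + cy" by (simp_all add: V_def cx_def cy_def)
      have k1: "int k \<le> int k * fst E" "int k \<le> int k * snd E" using sp by (simp_all add: mult_le_cancel_left1)
      have "int K \<le> int k" using k(1) by simp
      then have kS: "S \<le> int k * fst E" "S \<le> int k * snd E" using k1 K(1) by linarith+
      have Vf: "fst V = int k * fst E + 1" "snd V = int k * snd E + 1" by (simp_all add: V_def)
      have x: "0 \<le> fst x" "fst x \<le> 1" "0 \<le> snd x" "snd x \<le> 1" and y: "0 \<le> fst y" "fst y \<le> 1" "0 \<le> snd y" "snd y \<le> 1"
        using xy by (auto simp: ple_def)
      have av1: "avoids_ray (shift x \<omega>) U I1 (V - x)" and av2: "avoids_ray (shift y \<omega>) U' I2 (V - y)"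
        using that Z1(3)[of "shift x \<omega>" k] Z2(3)[of "shift y \<omega>" k] unfolding Vx Vy U_def U'_def E_def B_def by auto
      have vr: "R \<le> fst v" "R \<le> snd v" "fst v \<le> S" "snd v \<le> S" and wr: "R \<le> fst w" "R \<le> snd w" "fst w \<le> S" "snd w \<le> S"
        using v w by auto
      have "\<exists>q. ple 0 q \<and> ple q (V - x) \<and> upleft (v - x) q \<and>
          passage (shift x \<omega>) 0 (V - x) = passage (shift x \<omega>) 0 q + passage (shift x \<omega>) q (V - x)"
      proof -
        have "fst (v - x) * snd a \<le> fst v * snd a" using x sp by (simp add: mult_right_mono)
        also have "\<dots> \<le> (snd (v - x) + 1) * fst a"
          using x sp va by (intro order_trans[OF va] mult_right_mono) auto
        finally obtain i0 where i0: "i0 \<ge> I1" "int (i0\<^sup>2) * snd U \<le> snd (v - x)" "fst (v - x) \<le> int (i0\<^sup>2) * fst U"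
          using R1[of "snd (v - x)" "fst (v - x)"] vr x by (auto simp: R_def)
        have "snd (V - x) * fst E \<le> (int k * snd E + 1) * fst E"
          using x sp by (intro mult_right_mono) (auto simp: Vf)
        also have "\<dots> \<le> (int k * fst E + (fst E + 1)) * snd E"
        proof -
          have "fst E * 1 \<le> fst E * snd E" using sp by (intro mult_left_mono) auto
          then have "fst E \<le> snd E + fst E * snd E" using sp by linarith
          then show ?thesis by (simp add: algebra_simps)
        qed
        finally obtain i1 where i1: "int (i1\<^sup>2) * fst U \<le> int k * fst E" "snd (V - x) \<le> int (i1\<^sup>2) * snd U"
          using R3[of "int k * fst E" "snd (V - x)"] k1 K k(1) by auto
        have "ple 0 (V - x)" using x Vf k1 by (auto simp: ple_def)
        moreover have "0 \<le> snd (v - x)" "fst (v - x) \<le> fst (V - x)"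
          using vr x Vf kS by (auto simp: R_def)
        moreover have "int (i1\<^sup>2) * fst U \<le> fst (V - x)" using i1(1) x Vf by auto
        ultimately show ?thesis
          by (intro geodesic_right_of[OF av1 pl(1) sp(4) _ _ _ i0 _ i1(2)])
      qed
      then obtain q where q: "ple 0 q" "ple q (V - x)" "upleft (v - x) q"
          "passage \<omega> x V = passage \<omega> x (q + x) + passage \<omega> (q + x) V"
        by (auto simp: passage_shift)
      have "passage \<omega> x v - passage \<omega> y v \<le> passage \<omega> x V - passage \<omega> y V"
        using q(1-3) vr y xy(5)
        by (intro passage_compare_left[OF _ _ _ _ _ q(4)]) (auto simp: ple_def upleft_def R_def)
      moreover have "\<exists>q. ple 0 q \<and> ple q (V - y) \<and> upleft q (w - y) \<and>
          passage (shift y \<omega>) 0 (V - y) = passage (shift y \<omega>) 0 q + passage (shift y \<omega>) q (V - y)"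
      proof -
        have "snd (w - y) * fst a' \<le> snd w * fst a'" using y sp by (simp add: mult_right_mono)
        also have "\<dots> \<le> (fst (w - y) + 1) * snd a'"
          using y sp wa by (intro order_trans[OF wa] mult_right_mono) auto
        finally obtain i0 where i0: "i0 \<ge> I2" "int (i0\<^sup>2) * fst U' \<le> fst (w - y)" "snd (w - y) \<le> int (i0\<^sup>2) * snd U'"
          using R2[of "fst (w - y)" "snd (w - y)"] wr y by (auto simp: R_def)
        have "fst (V - y) * snd E \<le> (int k * fst E + 1) * snd E"
          using y sp by (intro mult_right_mono) (auto simp: Vf)
        also have "\<dots> \<le> (int k * snd E + (snd E + 1)) * fst E"
        proof -
          have "1 * snd E \<le> fst E * snd E" using sp by (intro mult_right_mono) auto
          then have "snd E \<le> fst E + fst E * snd E" using sp by linarith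
          then show ?thesis by (simp add: algebra_simps)
        qed
        finally obtain i1 where i1: "int (i1\<^sup>2) * snd U' \<le> int k * snd E" "fst (V - y) \<le> int (i1\<^sup>2) * fst U'"
          using R4[of "int k * snd E" "fst (V - y)"] k1 K k(1) by auto
        have "ple 0 (V - y)" using y Vf k1 by (auto simp: ple_def)
        moreover have "0 \<le> fst (w - y)" "snd (w - y) \<le> snd (V - y)"
          using wr y Vf kS by (auto simp: R_def)
        moreover have "int (i1\<^sup>2) * snd U' \<le> snd (V - y)" using i1(1) y Vf by auto
        ultimately show ?thesis
          by (intro geodesic_left_of[OF av2 pl(2) sp(5) _ _ _ i0 _ i1(2)])
      qed
      then obtain q' where q': "ple 0 q'" "ple q' (V - y)" "upleft q' (w - y)"
          "passage \<omega> y V = passage \<omega> y (q' + y) + passage \<omega> (q' + y) V"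
        by (auto simp: passage_shift)
      have "passage \<omega> x V - passage \<omega> y V \<le> passage \<omega> x w - passage \<omega> y w"
        using q'(1-3) wr x xy(5)
        by (intro passage_compare_right[OF _ _ _ _ _ q'(4)]) (auto simp: ple_def upleft_def R_def)
      ultimately show "passage \<omega> x v - passage \<omega> y v \<le> passage \<omega> x w - passage \<omega> y w" by linarith
    qed
    then have "UNIV - B \<subseteq> {\<omega>. ?P \<omega>}" by blast
    moreover have [measurable]: "Measurable.pred M (\<lambda>\<omega>. passage \<omega> x v - passage \<omega> y v
        \<le> passage \<omega> x w - passage \<omega> y w)" for v w
      unfolding pred_def by (intro borel_measurable_le borel_measurable_diff passage_measurable)
    have "{\<omega>\<in>space M. ?P \<omega>} \<in> events" by measurable
    ultimately have "prob (space M - B) \<le> prob {\<omega>. ?P \<omega>}"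
      by (intro finite_measure_mono) auto
    moreover have "prob (space M - B) = 1 - prob B" using m by (intro prob_compl) (simp add: B_def)
    ultimately show "1 - \<delta> \<le> prob {\<omega>. ?P \<omega>}" using pB by linarith
  qed
qed

end

context fpp
begin

text \<open>With \<open>R\<close> fixed the events decrease as the box grows, so the bound
  \<open>1 - \<delta>\<close> survives the limit in \<open>S\<close>; the union over all
  \<open>R\<close> then has probability at least \<open>1 - \<delta>\<close> for every
  \<open>\<delta>\<close>.\<close>

lemma increments_ordered_AE:
  fixes a u \<eta> u' a' x y :: site
  assumes pos: "site_pos a" "site_pos u" "site_pos \<eta>" "site_pos u'" "site_pos a'"
    and lt: "dir_less a u" "dir_less u \<eta>" "dir_less \<eta> u'" "dir_less u' a'"
    and xy: "ple 0 x" "ple x (1, 1)" "ple 0 y" "ple y (1, 1)" "upleft x y"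
  shows "AE \<omega> in M. \<exists>R. \<forall>v w. ple (R, R) v \<longrightarrow> ple (R, R) w \<longrightarrow>
      fst v * snd a \<le> snd v * fst a \<longrightarrow> snd w * fst a' \<le> fst w * snd a' \<longrightarrow>
      passage \<omega> x v - passage \<omega> y v \<le> passage \<omega> x w - passage \<omega> y w"
proof -
  define P where "P R S \<omega> \<longleftrightarrow> (\<forall>v\<in>{R..S} \<times> {R..S}. \<forall>w\<in>{R..S} \<times> {R..S}.
      fst v * snd a \<le> snd v * fst a \<longrightarrow> snd w * fst a' \<le> fst w * snd a' \<longrightarrow>
      passage \<omega> x v - passage \<omega> y v \<le> passage \<omega> x w - passage \<omega> y w)" for R S \<omega>
  have 1 [measurable]: "Measurable.pred M (\<lambda>\<omega>. passage \<omega> x v - passage \<omega> y v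
        \<le> passage \<omega> x w - passage \<omega> y w)" for v w
    unfolding pred_def by (intro borel_measurable_le borel_measurable_diff passage_measurable)
  have P_meas [measurable]: "Measurable.pred M (P R S)" for R S
    unfolding P_def by measurable
  let ?E = "{\<omega>\<in>space M. \<exists>R. \<forall>n::nat. P R (int n) \<omega>}"
  have E: "?E \<in> events" by measurable
  have ge: "1 - \<delta> \<le> prob ?E" if "\<delta> > 0" for \<delta>
  proof -
    obtain R where R: "\<And>S. 1 - \<delta> \<le> prob {\<omega>. P R S \<omega>}"
      using increments_ordered_box[OF pos lt xy \<open>\<delta> > 0\<close>] unfolding P_def by blast
    let ?A = "\<lambda>n::nat. {\<omega>\<in>space M. P R (int n) \<omega>}"
    have "(\<lambda>n. prob (?A n)) \<longlonglongrightarrow> prob (\<Inter>n. ?A n)"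
    proof (rule finite_Lim_measure_decseq)
      have "?A n \<in> events" for n by measurable
      then show "range ?A \<subseteq> events" by blast
      show "decseq ?A" unfolding decseq_def P_def by force
    qed
    then have "1 - \<delta> \<le> prob (\<Inter>n. ?A n)"
      using R by (intro LIMSEQ_le_const) auto
    also have "\<dots> \<le> prob ?E"
      using E by (intro finite_measure_mono) auto
    finally show ?thesis .
  qed
  have "1 \<le> prob ?E + \<delta>" if "\<delta> > 0" for \<delta>
    using ge[OF that] by linarith
  then have "1 \<le> prob ?E" by (rule field_le_epsilon)
  then have "AE \<omega> in M. \<omega> \<in> ?E" using prob_eq_1[OF E] antisym[OF prob_le_1[of ?E]] by blast
  then show ?thesis
  proof eventually_elim
    case (elim \<omega>)
    then obtain R where R: "\<And>n::nat. P R (int n) \<omega>" by auto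
    show ?case
    proof (intro exI[of _ R] allI impI)
      fix v w assume vw: "ple (R, R) v" "ple (R, R) w" "fst v * snd a \<le> snd v * fst a"
        "snd w * fst a' \<le> fst w * snd a'"
      define n where "n = nat (max (max (fst v) (snd v)) (max (fst w) (snd w)))"
      have "v \<in> {R..int n} \<times> {R..int n}" "w \<in> {R..int n} \<times> {R..int n}"
        using vw by (auto simp: ple_def n_def mem_Times_iff)
      then show "passage \<omega> x v - passage \<omega> y v \<le> passage \<omega> x w - passage \<omega> y w"
        using R[of n] vw unfolding P_def by blast
    qed
  qed
qed

end

subsection \<open>Sequences with an asymptotic direction\<close>

abbreviation dr :: "real \<Rightarrow> real \<times> real" where
  "dr t \<equiv> (t, 1 - t)"

lemma dirs_iff: "\<xi> \<in> dirs \<longleftrightarrow> \<xi> = dr (fst \<xi>) \<and> 0 < fst \<xi> \<and> fst \<xi> < 1"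
  unfolding dirs_def by (cases \<xi>) auto

lemma dr_dirs [simp]: "dr t \<in> dirs \<longleftrightarrow> 0 < t \<and> t < 1"
  by (auto simp: dirs_iff)

lemma tends_dirD:
  assumes "tends_dir v (a, b)"
  shows "filterlim (\<lambda>n. norm1 (v n)) at_top sequentially"
    "(\<lambda>n. real_of_int (fst (v n)) / norm1 (v n)) \<longlonglongrightarrow> a"
    "(\<lambda>n. real_of_int (snd (v n)) / norm1 (v n)) \<longlonglongrightarrow> b"
  using assms tendsto_fst[of _ "(a, b)" sequentially] tendsto_snd[of _ "(a, b)" sequentially]
  by (force simp: tends_dir_def)+

lemma tends_dir_at_top:
  assumes v: "tends_dir v (dr t)" and t: "0 < t" "t < 1"
  shows "filterlim (\<lambda>n. real_of_int (fst (v n))) at_top sequentially"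
    "filterlim (\<lambda>n. real_of_int (snd (v n))) at_top sequentially"
proof -
  note l = tends_dirD[OF v]
  have nz: "\<forall>\<^sub>F n in sequentially. norm1 (v n) > 0"
    using l(1) by (simp add: filterlim_at_top_dense)
  have "filterlim (\<lambda>n. (real_of_int (fst (v n)) / norm1 (v n)) * norm1 (v n)) at_top sequentially"
    using t by (intro filterlim_tendsto_pos_mult_at_top[OF l(2) _ l(1)]) auto
  then show "filterlim (\<lambda>n. real_of_int (fst (v n))) at_top sequentially"
    by (rule filterlim_cong[THEN iffD1, OF refl refl, rotated]) (use nz in \<open>auto elim: eventually_mono\<close>)
  have "filterlim (\<lambda>n. (real_of_int (snd (v n)) / norm1 (v n)) * norm1 (v n)) at_top sequentially"
    using t by (intro filterlim_tendsto_pos_mult_at_top[OF l(3) _ l(1)]) auto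
  then show "filterlim (\<lambda>n. real_of_int (snd (v n))) at_top sequentially"
    by (rule filterlim_cong[THEN iffD1, OF refl refl, rotated]) (use nz in \<open>auto elim: eventually_mono\<close>)
qed

lemma tends_dir_eventually_ge:
  assumes "tends_dir v (dr t)" "0 < t" "t < 1"
  shows "\<forall>\<^sub>F n in sequentially. ple (R, R') (v n)"
proof -
  have "\<forall>\<^sub>F n in sequentially. real_of_int R \<le> real_of_int (fst (v n))"
    "\<forall>\<^sub>F n in sequentially. real_of_int R' \<le> real_of_int (snd (v n))"
    using tends_dir_at_top[OF assms] unfolding filterlim_at_top by blast+
  then show ?thesis by eventually_elim (auto simp: ple_def)
qed

lemma tends_dir_eventually_less:
  assumes v: "tends_dir v (a, b)" and less: "a * \<beta> < b * \<alpha>"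
  shows "\<forall>\<^sub>F n in sequentially. real_of_int (fst (v n)) * \<beta> < real_of_int (snd (v n)) * \<alpha>"
proof -
  note l = tends_dirD[OF v]
  have nz: "\<forall>\<^sub>F n in sequentially. norm1 (v n) > 0"
    using l(1) by (simp add: filterlim_at_top_dense)
  have "(\<lambda>n. real_of_int (fst (v n)) / norm1 (v n) * \<beta> - real_of_int (snd (v n)) / norm1 (v n) * \<alpha>)
      \<longlonglongrightarrow> a * \<beta> - b * \<alpha>"
    by (intro tendsto_intros l)
  then have "\<forall>\<^sub>F n in sequentially.
      real_of_int (fst (v n)) / norm1 (v n) * \<beta> - real_of_int (snd (v n)) / norm1 (v n) * \<alpha> < 0"
    using less by (intro order_tendstoD) auto
  with nz show ?thesis
  proof eventually_elim
    case (elim n)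
    then have "(real_of_int (fst (v n)) * \<beta> - real_of_int (snd (v n)) * \<alpha>) / norm1 (v n) < 0"
      by (simp add: diff_divide_distrib)
    then show ?case using elim(1) by (simp add: divide_less_0_iff)
  qed
qed

text \<open>For large \<open>n\<close> all coordinates involved are nonnegative, so the norm changes
  by exactly the constant \<open>c\<close> and the quotients keep their limits.\<close>

lemma tends_dir_shift:
  assumes v: "tends_dir v (dr t)" and t: "0 < t" "t < 1"
  shows "tends_dir (\<lambda>n. v n + z) (dr t)"
proof -
  note l = tends_dirD[OF v]
  define c where "c = real_of_int (fst z) + real_of_int (snd z)"
  have "\<forall>\<^sub>F n in sequentially. ple (\<bar>fst z\<bar>, \<bar>snd z\<bar>) (v n)"
    by (rule tends_dir_eventually_ge[OF assms])
  then have nrm: "\<forall>\<^sub>F n in sequentially. norm1 (v n) + c = norm1 (v n + z)"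
    by eventually_elim (auto simp: norm1_def ple_def c_def)
  have "filterlim (\<lambda>n. norm1 (v n) + c) at_top sequentially"
    using filterlim_tendsto_add_at_top[OF tendsto_const l(1), of c] by (simp add: add.commute)
  then have 1: "filterlim (\<lambda>n. norm1 (v n + z)) at_top sequentially"
    using nrm by (subst (asm) filterlim_cong[OF refl refl nrm])
  have nz: "\<forall>\<^sub>F n in sequentially. norm1 (v n) > 0" "\<forall>\<^sub>F n in sequentially. norm1 (v n + z) > 0"
    using l(1) 1 by (simp_all add: filterlim_at_top_dense)
  have inv: "(\<lambda>n. k / norm1 (v n)) \<longlonglongrightarrow> 0" for k :: real
    by (rule real_tendsto_divide_at_top[OF tendsto_const l(1)])
  have coord: "(\<lambda>n. (f n + k) / norm1 (v n + z)) \<longlonglongrightarrow> a" if f: "(\<lambda>n. f n / norm1 (v n)) \<longlonglongrightarrow> a" for f k a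
  proof -
    have "(\<lambda>n. (f n / norm1 (v n) + k / norm1 (v n)) / (1 + c / norm1 (v n))) \<longlonglongrightarrow> (a + 0) / (1 + 0)"
      by (intro tendsto_intros f inv) auto
    moreover have "\<forall>\<^sub>F n in sequentially. (f n / norm1 (v n) + k / norm1 (v n)) / (1 + c / norm1 (v n))
        = (f n + k) / norm1 (v n + z)"
      using nrm nz
    proof eventually_elim
      case (elim n)
      have "1 + c / norm1 (v n) = norm1 (v n + z) / norm1 (v n)"
        using elim by (simp add: field_simps)
      moreover have "f n / norm1 (v n) + k / norm1 (v n) = (f n + k) / norm1 (v n)"
        by (simp add: add_divide_distrib)
      ultimately show ?case using elim by simp
    qed
    ultimately show ?thesis by (simp add: tendsto_cong)
  qed
  have "(\<lambda>n. (real_of_int (fst (v n + z)) / norm1 (v n + z), real_of_int (snd (v n + z)) / norm1 (v n + z)))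
     \<longlonglongrightarrow> dr t"
    using coord[OF l(2), of "real_of_int (fst z)"] coord[OF l(3), of "real_of_int (snd z)"]
    by (intro tendsto_Pair) auto
  then show ?thesis using 1 unfolding tends_dir_def by simp
qed

text \<open>For \<open>0 < t < 1\<close> this meets each antidiagonal once and moves by unit steps,
  which makes \<open>norm1\<close> equal to \<open>n\<close> and lets increments telescope along
  it.\<close>

definition stair :: "real \<Rightarrow> nat \<Rightarrow> site" where
  "stair t n = (\<lfloor>real n * t\<rfloor>, int n - \<lfloor>real n * t\<rfloor>)"

lemma norm1_stair: "0 \<le> t \<Longrightarrow> t \<le> 1 \<Longrightarrow> norm1 (stair t n) = real n"
proof -
  assume t: "0 \<le> t" "t \<le> 1"
  have "real n * t \<le> real n" using t by (simp add: mult_left_le)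
  then have "\<lfloor>real n * t\<rfloor> \<le> int n" by (simp add: floor_le_iff)
  then show ?thesis using t by (simp add: norm1_def stair_def)
qed

lemma floor_mult_LIMSEQ: "(\<lambda>n. real_of_int \<lfloor>real n * t\<rfloor> / real n) \<longlonglongrightarrow> t"
proof (rule real_tendsto_sandwich[of "\<lambda>n. t - 1 / real n" _ _ "\<lambda>n. t"])
  show "\<forall>\<^sub>F n in sequentially. t - 1 / real n \<le> real_of_int \<lfloor>real n * t\<rfloor> / real n"
    using eventually_gt_at_top[of 0]
  proof eventually_elim
    case (elim n)
    have "(real n * t - 1) / real n \<le> real_of_int \<lfloor>real n * t\<rfloor> / real n"
      by (intro divide_right_mono) linarith+
    then show ?case using elim by (simp add: diff_divide_distrib)
  qed
  show "\<forall>\<^sub>F n in sequentially. real_of_int \<lfloor>real n * t\<rfloor> / real n \<le> t"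
    using eventually_gt_at_top[of 0]
    by eventually_elim (simp add: divide_le_eq mult.commute)
  show "(\<lambda>n. t - 1 / real n) \<longlonglongrightarrow> t"
    using tendsto_diff[OF tendsto_const lim_1_over_n, of t] by simp
qed simp

lemma tends_dir_stair:
  assumes "0 < t" "t < 1" shows "tends_dir (stair t) (dr t)"
proof -
  have n: "norm1 (stair t n) = real n" for n using assms by (intro norm1_stair) auto
  have "(\<lambda>n. 1 - real_of_int \<lfloor>real n * t\<rfloor> / real n) \<longlonglongrightarrow> 1 - t"
    by (intro tendsto_intros floor_mult_LIMSEQ)
  moreover have "\<forall>\<^sub>F n in sequentially. 1 - real_of_int \<lfloor>real n * t\<rfloor> / real n
      = real_of_int (snd (stair t n)) / real n"
    using eventually_gt_at_top[of 0] by eventually_elim (simp add: stair_def diff_divide_distrib)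
  ultimately have "(\<lambda>n. real_of_int (snd (stair t n)) / real n) \<longlonglongrightarrow> 1 - t"
    by (simp add: tendsto_cong)
  then show ?thesis
    unfolding tends_dir_def n using floor_mult_LIMSEQ[of t]
    by (auto intro!: tendsto_Pair filterlim_real_sequentially simp: stair_def)
qed

section \<open>Ordering for all directions and sequences simultaneously\<close>

definition incr :: "config \<Rightarrow> site \<Rightarrow> site \<Rightarrow> site \<Rightarrow> real" where
  "incr \<omega> x y v = passage \<omega> x v - passage \<omega> y v"

lemma incr_shift: "incr (shift z \<omega>) x y v = incr \<omega> (x + z) (y + z) (v + z)"
  by (simp add: incr_def passage_shift)

text \<open>A property of a single configuration that already quantifies over all directions and
  sequences; the existence of limits is deduced from it deterministically.\<close>

definition dir_ordered :: "config \<Rightarrow> site \<Rightarrow> site \<Rightarrow> bool" where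
  "dir_ordered \<omega> x y \<longleftrightarrow> (\<forall>s t v w. 0 < s \<longrightarrow> s < t \<longrightarrow> t < 1 \<longrightarrow> tends_dir v (dr s) \<longrightarrow> tends_dir w (dr t) \<longrightarrow>
     (\<exists>N. \<forall>n\<ge>N. \<forall>m\<ge>N. incr \<omega> x y (v n) \<le> incr \<omega> x y (w m)))"

lemma dir_ordered_shift:
  assumes "dir_ordered (shift z \<omega>) x y" shows "dir_ordered \<omega> (x + z) (y + z)"
  unfolding dir_ordered_def
proof (intro allI impI)
  fix s t v w assume *: "0 < s" "s < t" "t < (1::real)" "tends_dir v (dr s)" "tends_dir w (dr t)"
  have "tends_dir (\<lambda>n. v n + - z) (dr s)" "tends_dir (\<lambda>n. w n + - z) (dr t)"
    using * by (intro tends_dir_shift; simp)+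
  then obtain N where "\<forall>n\<ge>N. \<forall>m\<ge>N. incr (shift z \<omega>) x y (v n + - z) \<le> incr (shift z \<omega>) x y (w m + - z)"
    using assms *(1-3) unfolding dir_ordered_def by meson
  then show "\<exists>N. \<forall>n\<ge>N. \<forall>m\<ge>N. incr \<omega> (x + z) (y + z) (v n) \<le> incr \<omega> (x + z) (y + z) (w m)"
    unfolding incr_shift by auto
qed

text \<open>The five vectors are consecutive lattice points of the antidiagonal \<open>n\<close>;
  \<open>6 / (t - s) < n\<close> leaves room for them strictly between the two directions after
  rounding.\<close>

lemma chain_between:
  assumes "0 < s" "s < t" "t < (1::real)"
  obtains a u \<eta> u' a' :: site where
    "site_pos a" "site_pos u" "site_pos \<eta>" "site_pos u'" "site_pos a'"
    "dir_less a u" "dir_less u \<eta>" "dir_less \<eta> u'" "dir_less u' a'"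
    "s * real_of_int (snd a) < (1 - s) * real_of_int (fst a)"
    "(1 - t) * real_of_int (fst a') < t * real_of_int (snd a')"
proof -
  obtain n :: nat where n: "6 / (t - s) < real n" using reals_Archimedean2 by blast
  then have nt: "real n * s + 6 < real n * t" using assms by (simp add: field_simps)
  define i where "i = \<lfloor>real n * s\<rfloor> + 1"
  have n0: "real n > 0" using n assms by (smt (verit) divide_pos_pos)
  have i: "i \<ge> 1" "real n * s < real_of_int i" "real_of_int i \<le> real n * s + 1"
    using assms n0 by (simp_all add: i_def)
  have "real n * t < real n" using assms n0 by simp
  then have "real_of_int i + 5 < real n" using nt i by linarith
  then have i5: "i + 5 < int n" by linarith
  define f where "f j = (i + j, int n - (i + j))" for j :: int
  have less: "dir_less (f j) (f (j + 1))" for j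
    using i5 i by (simp add: dir_less_def f_def algebra_simps)
  have pos: "site_pos (f j)" if "0 \<le> j" "j \<le> 4" for j
    using that i i5 by (auto simp: site_pos_def f_def)
  have 1: "s * real_of_int (snd (f 0)) < (1 - s) * real_of_int (fst (f 0))"
    using i by (simp add: f_def algebra_simps)
  have "real_of_int (i + 4) < real n * t" using nt i by simp
  then have 2: "(1 - t) * real_of_int (fst (f 4)) < t * real_of_int (snd (f 4))"
    by (simp add: f_def algebra_simps)
  show ?thesis
    using that[of "f 0" "f 1" "f 2" "f 3" "f 4"] pos less[of 0] less[of 1] less[of 2] less[of 3] 1 2
    by simp
qed

context fpp
begin

text \<open>Only countably many pairs of lattice directions \<open>a\<close>, \<open>a'\<close> are
  involved, which gives one null set for all \<open>s\<close>, \<open>t\<close> and all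
  sequences.\<close>

lemma dir_ordered_AE_base:
  assumes xy: "ple 0 x" "ple x (1, 1)" "ple 0 y" "ple y (1, 1)" "upleft x y"
  shows "AE \<omega> in M. dir_ordered \<omega> x y"
proof -
  define chain where "chain a a' \<longleftrightarrow> (\<exists>u \<eta> u'. site_pos a \<and> site_pos u \<and> site_pos \<eta> \<and> site_pos u' \<and> site_pos a' \<and>
    dir_less a u \<and> dir_less u \<eta> \<and> dir_less \<eta> u' \<and> dir_less u' a')" for a a'
  have "AE \<omega> in M. \<forall>a a'. chain a a' \<longrightarrow> (\<exists>R. \<forall>v w. ple (R, R) v \<longrightarrow> ple (R, R) w \<longrightarrow>
      fst v * snd a \<le> snd v * fst a \<longrightarrow> snd w * fst a' \<le> fst w * snd a' \<longrightarrow>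
      passage \<omega> x v - passage \<omega> y v \<le> passage \<omega> x w - passage \<omega> y w)"
    unfolding AE_all_countable
  proof (intro allI)
    fix a a'
    show "AE \<omega> in M. chain a a' \<longrightarrow> (\<exists>R. \<forall>v w. ple (R, R) v \<longrightarrow> ple (R, R) w \<longrightarrow>
      fst v * snd a \<le> snd v * fst a \<longrightarrow> snd w * fst a' \<le> fst w * snd a' \<longrightarrow>
      passage \<omega> x v - passage \<omega> y v \<le> passage \<omega> x w - passage \<omega> y w)"
    proof (cases "chain a a'")
      case True
      then obtain u \<eta> u' where "site_pos a" "site_pos u" "site_pos \<eta>" "site_pos u'" "site_pos a'"
        "dir_less a u" "dir_less u \<eta>" "dir_less \<eta> u'" "dir_less u' a'"
        unfolding chain_def by blast
      from increments_ordered_AE[OF this xy] show ?thesis by eventually_elim simp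
    qed simp
  qed
  then show ?thesis
  proof eventually_elim
    case (elim \<omega>)
    show ?case unfolding dir_ordered_def
    proof (intro allI impI)
      fix s t v w assume st: "0 < s" "s < t" "t < (1::real)" and v: "tends_dir v (dr s)" and w: "tends_dir w (dr t)"
      obtain a u \<eta> u' a' where ch: "site_pos a" "site_pos u" "site_pos \<eta>" "site_pos u'" "site_pos a'"
        "dir_less a u" "dir_less u \<eta>" "dir_less \<eta> u'" "dir_less u' a'"
        and sa: "s * real_of_int (snd a) < (1 - s) * real_of_int (fst a)"
        and ta: "(1 - t) * real_of_int (fst a') < t * real_of_int (snd a')"
        using chain_between[OF st] .
      then have "chain a a'" unfolding chain_def by blast
      then obtain R where R: "\<And>v w. ple (R, R) v \<Longrightarrow> ple (R, R) w \<Longrightarrow>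
        fst v * snd a \<le> snd v * fst a \<Longrightarrow> snd w * fst a' \<le> fst w * snd a' \<Longrightarrow>
        passage \<omega> x v - passage \<omega> y v \<le> passage \<omega> x w - passage \<omega> y w"
        using elim by blast
      have "\<forall>\<^sub>F n in sequentially. ple (R, R) (v n) \<and> fst (v n) * snd a \<le> snd (v n) * fst a"
      proof -
        have "\<forall>\<^sub>F n in sequentially. real_of_int (fst (v n)) * real_of_int (snd a)
            < real_of_int (snd (v n)) * real_of_int (fst a)"
          by (rule tends_dir_eventually_less[OF v sa])
        moreover have "\<forall>\<^sub>F n in sequentially. ple (R, R) (v n)"
          using st by (intro tends_dir_eventually_ge[OF v]) auto
        ultimately show ?thesis
        proof eventually_elim
          case (elim n)
          then have "fst (v n) * snd a < snd (v n) * fst a" unfolding of_int_mult[symmetric] of_int_less_iff by simp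
          then show ?case using elim by simp
        qed
      qed
      moreover have "\<forall>\<^sub>F n in sequentially. ple (R, R) (w n) \<and> snd (w n) * fst a' \<le> fst (w n) * snd a'"
      proof -
        have "\<forall>\<^sub>F n in sequentially. real_of_int (fst (w n)) * - real_of_int (snd a')
            < real_of_int (snd (w n)) * - real_of_int (fst a')"
          using ta by (intro tends_dir_eventually_less[OF w]) simp
        moreover have "\<forall>\<^sub>F n in sequentially. ple (R, R) (w n)"
          using st by (intro tends_dir_eventually_ge[OF w]) auto
        ultimately show ?thesis
        proof eventually_elim
          case (elim n)
          then have "real_of_int (snd (w n)) * real_of_int (fst a') < real_of_int (fst (w n)) * real_of_int (snd a')"
            by simp
          then have "snd (w n) * fst a' < fst (w n) * snd a'" unfolding of_int_mult[symmetric] of_int_less_iff by simp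
          then show ?case using elim by simp
        qed
      qed
      ultimately have "\<forall>\<^sub>F n in sequentially. (ple (R, R) (v n) \<and> fst (v n) * snd a \<le> snd (v n) * fst a) \<and>
          (ple (R, R) (w n) \<and> snd (w n) * fst a' \<le> fst (w n) * snd a')"
        by (rule eventually_conj)
      then obtain N where "\<And>n. n \<ge> N \<Longrightarrow> ple (R, R) (v n) \<and> fst (v n) * snd a \<le> snd (v n) * fst a"
          "\<And>n. n \<ge> N \<Longrightarrow> ple (R, R) (w n) \<and> snd (w n) * fst a' \<le> fst (w n) * snd a'"
        unfolding eventually_sequentially by blast
      then show "\<exists>N. \<forall>n\<ge>N. \<forall>m\<ge>N. incr \<omega> x y (v n) \<le> incr \<omega> x y (w m)"
        unfolding incr_def using R by blast
    qed
  qed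
qed

text \<open>Both kinds of edges are oriented so that the first end point is on the upper left of the
  second; then increments increase as the direction turns towards \<open>e1\<close>.\<close>

lemma dir_ordered_AE: "AE \<omega> in M. \<forall>x. dir_ordered \<omega> x (x + e1) \<and> dir_ordered \<omega> (x + e2) x"
  unfolding AE_all_countable
proof
  fix x
  have "AE \<omega> in M. dir_ordered \<omega> 0 e1" "AE \<omega> in M. dir_ordered \<omega> e2 0"
    by (intro dir_ordered_AE_base; simp add: ple_def upleft_def e1_def e2_def)+
  from this[THEN AE_shift, of x] show "AE \<omega> in M. dir_ordered \<omega> x (x + e1) \<and> dir_ordered \<omega> (x + e2) x"
  proof eventually_elim
    case (elim \<omega>)
    then show ?case
      using dir_ordered_shift[of x \<omega> 0 e1] dir_ordered_shift[of x \<omega> e2 0]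
      by (simp add: add.commute)
  qed
qed

end

section \<open>The increment as a monotone function of the direction\<close>

lemma real_limsup_bounds:
  fixes f :: "nat \<Rightarrow> real"
  assumes "\<forall>\<^sub>F n in sequentially. c \<le> f n" "\<forall>\<^sub>F n in sequentially. f n \<le> d"
  shows "ereal (real_of_ereal (limsup (\<lambda>n. ereal (f n)))) = limsup (\<lambda>n. ereal (f n))"
    and "c \<le> real_of_ereal (limsup (\<lambda>n. ereal (f n)))"
    and "real_of_ereal (limsup (\<lambda>n. ereal (f n))) \<le> d"
proof -
  let ?L = "limsup (\<lambda>n. ereal (f n))"
  have 1: "?L \<le> ereal d" using assms(2) by (intro Limsup_bounded) (auto elim: eventually_mono)
  have "ereal c \<le> liminf (\<lambda>n. ereal (f n))"
    using assms(1) by (intro Liminf_bounded) (auto elim: eventually_mono)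
  also have "\<dots> \<le> ?L" by (rule Liminf_le_Limsup) simp
  finally have 2: "ereal c \<le> ?L" .
  show *: "ereal (real_of_ereal ?L) = ?L"
    using 1 2 by (cases ?L) auto
  show "c \<le> real_of_ereal ?L" "real_of_ereal ?L \<le> d"
    using 1 2 unfolding ereal_less_eq(3)[symmetric] * by auto
qed

text \<open>A limsup is defined for every configuration and is measurable, so monotonicity in
  \<open>t\<close> can be exploited before any limit is known.\<close>

definition phi :: "config \<Rightarrow> site \<Rightarrow> site \<Rightarrow> real \<Rightarrow> real" where
  "phi \<omega> x y t = real_of_ereal (limsup (\<lambda>n. ereal (incr \<omega> x y (stair t n))))"

text \<open>The bounds are single increments towards far staircase points in the directions
  \<open>t / 2\<close> and \<open>(t + 1) / 2\<close>.\<close>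

lemma incr_eventually_bounded:
  assumes ord: "dir_ordered \<omega> x y" and t: "0 < t" "t < 1" and v: "tends_dir v (dr t)"
  shows "\<exists>c. \<forall>\<^sub>F n in sequentially. c \<le> incr \<omega> x y (v n)"
    and "\<exists>d. \<forall>\<^sub>F n in sequentially. incr \<omega> x y (v n) \<le> d"
proof -
  have "tends_dir (stair (t/2)) (dr (t/2))" using t by (intro tends_dir_stair) auto
  from ord[unfolded dir_ordered_def, rule_format, of "t/2" t, OF _ _ _ this v] t
  obtain N where "\<And>n m. n \<ge> N \<Longrightarrow> m \<ge> N \<Longrightarrow> incr \<omega> x y (stair (t/2) n) \<le> incr \<omega> x y (v m)" by auto
  then show "\<exists>c. \<forall>\<^sub>F n in sequentially. c \<le> incr \<omega> x y (v n)"
    unfolding eventually_sequentially by blast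
  have "tends_dir (stair ((t+1)/2)) (dr ((t+1)/2))" using t by (intro tends_dir_stair) auto
  from ord[unfolded dir_ordered_def, rule_format, of t "(t+1)/2", OF _ _ _ v this] t
  obtain N where "\<And>n m. n \<ge> N \<Longrightarrow> m \<ge> N \<Longrightarrow> incr \<omega> x y (v n) \<le> incr \<omega> x y (stair ((t+1)/2) m)" by auto
  then show "\<exists>d. \<forall>\<^sub>F n in sequentially. incr \<omega> x y (v n) \<le> d"
    unfolding eventually_sequentially by blast
qed

lemma phi_ge:
  assumes "dir_ordered \<omega> x y" "0 < t" "t < 1" "\<forall>\<^sub>F n in sequentially. c \<le> incr \<omega> x y (stair t n)"
  shows "c \<le> phi \<omega> x y t"
proof -
  obtain d where d: "\<forall>\<^sub>F n in sequentially. incr \<omega> x y (stair t n) \<le> d"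
    using incr_eventually_bounded(2)[OF assms(1-3) tends_dir_stair[OF assms(2,3)]] by blast
  show ?thesis unfolding phi_def by (rule real_limsup_bounds(2)[OF assms(4) d])
qed

lemma phi_le:
  assumes "dir_ordered \<omega> x y" "0 < t" "t < 1" "\<forall>\<^sub>F n in sequentially. incr \<omega> x y (stair t n) \<le> d"
  shows "phi \<omega> x y t \<le> d"
proof -
  obtain c where c: "\<forall>\<^sub>F n in sequentially. c \<le> incr \<omega> x y (stair t n)"
    using incr_eventually_bounded(1)[OF assms(1-3) tends_dir_stair[OF assms(2,3)]] by blast
  show ?thesis unfolding phi_def by (rule real_limsup_bounds(3)[OF c assms(4)])
qed

lemma phi_le_incr:
  assumes ord: "dir_ordered \<omega> x y" and st: "0 < s" "s < t" "t < 1" and v: "tends_dir v (dr t)"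
  shows "\<forall>\<^sub>F n in sequentially. phi \<omega> x y s \<le> incr \<omega> x y (v n)"
proof -
  have "tends_dir (stair s) (dr s)" using st by (intro tends_dir_stair) auto
  from ord[unfolded dir_ordered_def, rule_format, OF st this v]
  obtain N where N: "\<And>n m. n \<ge> N \<Longrightarrow> m \<ge> N \<Longrightarrow> incr \<omega> x y (stair s n) \<le> incr \<omega> x y (v m)" by auto
  have "phi \<omega> x y s \<le> incr \<omega> x y (v m)" if "m \<ge> N" for m
    using N[OF _ that] st by (intro phi_le[OF ord]) (auto simp: eventually_sequentially)
  then show ?thesis unfolding eventually_sequentially by blast
qed

lemma incr_le_phi:
  assumes ord: "dir_ordered \<omega> x y" and st: "0 < s" "s < t" "t < 1" and v: "tends_dir v (dr s)"
  shows "\<forall>\<^sub>F n in sequentially. incr \<omega> x y (v n) \<le> phi \<omega> x y t"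
proof -
  have "tends_dir (stair t) (dr t)" using st by (intro tends_dir_stair) auto
  from ord[unfolded dir_ordered_def, rule_format, OF st v this]
  obtain N where N: "\<And>n m. n \<ge> N \<Longrightarrow> m \<ge> N \<Longrightarrow> incr \<omega> x y (v n) \<le> incr \<omega> x y (stair t m)" by auto
  have "incr \<omega> x y (v n) \<le> phi \<omega> x y t" if "n \<ge> N" for n
    using N[OF that] st by (intro phi_ge[OF ord]) (auto simp: eventually_sequentially)
  then show ?thesis unfolding eventually_sequentially by blast
qed

lemma phi_mono:
  assumes ord: "dir_ordered \<omega> x y" and st: "0 < s" "s \<le> t" "t < 1"
  shows "phi \<omega> x y s \<le> phi \<omega> x y t"
proof (cases "s = t")
  case False
  then have "s < t" using st by simp
  then have "\<forall>\<^sub>F n in sequentially. phi \<omega> x y s \<le> incr \<omega> x y (stair t n)"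
    using st by (intro phi_le_incr[OF ord _ _ _ tends_dir_stair]) auto
  then show ?thesis using st by (intro phi_ge[OF ord]) auto
qed simp

text \<open>For a monotone function, continuity is a small difference between some two arguments
  around \<open>t\<close>; this form survives sandwiching and taking expectations.\<close>

lemma mono_isCont_iff:
  fixes f :: "real \<Rightarrow> real"
  assumes mono: "\<And>s t. 0 < s \<Longrightarrow> s \<le> t \<Longrightarrow> t < 1 \<Longrightarrow> f s \<le> f t" and t: "0 < t" "t < 1"
  shows "isCont f t \<longleftrightarrow> (\<forall>\<epsilon>>0. \<exists>s s'. 0 < s \<and> s < t \<and> t < s' \<and> s' < 1 \<and> f s' - f s < \<epsilon>)"
proof
  assume c: "isCont f t"
  show "\<forall>\<epsilon>>0. \<exists>s s'. 0 < s \<and> s < t \<and> t < s' \<and> s' < 1 \<and> f s' - f s < \<epsilon>"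
  proof (intro allI impI)
    fix \<epsilon> :: real assume "\<epsilon> > 0"
    then obtain d where d: "d > 0" "\<And>s. dist s t < d \<Longrightarrow> dist (f s) (f t) < \<epsilon> / 2"
      using c unfolding continuous_at_eps_delta by (metis half_gt_zero)
    define r where "r = min (d / 2) (min (t / 2) ((1 - t) / 2))"
    have r0: "0 < r" using d(1) t by (simp add: r_def)
    have r1: "r \<le> d / 2" "r \<le> t / 2" "r \<le> (1 - t) / 2"
      unfolding r_def by (meson min.cobounded1 min.cobounded2 order_trans)+
    have "t + r < 1" using r1(3) t(2) by (simp add: field_simps)
    then have r: "0 < r" "r < d" "r < t" "t + r < 1" using r0 r1 d(1) t(1) by simp_all
    have "dist (f (t + r)) (f t) < \<epsilon> / 2" "dist (f (t - r)) (f t) < \<epsilon> / 2"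
      using r by (intro d; simp add: dist_real_def)+
    then have "f (t + r) - f (t - r) < \<epsilon>" unfolding dist_real_def abs_less_iff by linarith
    then show "\<exists>s s'. 0 < s \<and> s < t \<and> t < s' \<and> s' < 1 \<and> f s' - f s < \<epsilon>"
      using r by (intro exI[of _ "t - r"] exI[of _ "t + r"]) auto
  qed
next
  assume *: "\<forall>\<epsilon>>0. \<exists>s s'. 0 < s \<and> s < t \<and> t < s' \<and> s' < 1 \<and> f s' - f s < \<epsilon>"
  show "isCont f t"
    unfolding continuous_at_eps_delta
  proof (intro allI impI)
    fix \<epsilon> :: real assume "\<epsilon> > 0"
    then obtain s s' where s: "0 < s" "s < t" "t < s'" "s' < 1" "f s' - f s < \<epsilon>" using * by blast
    have "dist (f r) (f t) < \<epsilon>" if "dist r t < min (t - s) (s' - t)" for r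
    proof -
      have r: "s \<le> r" "r \<le> s'" using that by (auto simp: dist_real_def)
      have "f s \<le> f r" "f r \<le> f s'" "f s \<le> f t" "f t \<le> f s'" using s r by (auto intro!: mono)
      then show ?thesis using s(5) unfolding dist_real_def abs_less_iff by linarith
    qed
    then show "\<exists>d>0. \<forall>r. dist r t < d \<longrightarrow> dist (f r) (f t) < \<epsilon>"
      using s by (intro exI[of _ "min (t - s) (s' - t)"]) auto
  qed
qed

lemma isCont_phi_iff:
  assumes ord: "dir_ordered \<omega> x y" and t: "0 < t" "t < 1"
  shows "isCont (phi \<omega> x y) t \<longleftrightarrow>
    (\<forall>\<epsilon>>0. \<exists>s s'. 0 < s \<and> s < t \<and> t < s' \<and> s' < 1 \<and> phi \<omega> x y s' - phi \<omega> x y s < \<epsilon>)"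
  by (rule mono_isCont_iff[OF phi_mono[OF ord] t])

text \<open>\<open>phi\<close> need not commute with shifts, because a translated staircase is
  another sequence. Its values at \<open>s\<close> and \<open>s'\<close> are caught between values
  of the shifted function at slightly wider arguments, and that suffices for continuity.\<close>

lemma isCont_phi_shift:
  assumes ord: "dir_ordered (shift z \<omega>) x y" and t: "0 < t" "t < 1"
    and cont: "isCont (phi (shift z \<omega>) x y) t"
  shows "isCont (phi \<omega> (x + z) (y + z)) t"
  unfolding isCont_phi_iff[OF dir_ordered_shift[OF ord] t]
proof (intro allI impI)
  fix \<epsilon> :: real assume "\<epsilon> > 0"
  then obtain s0 s0' where s0: "0 < s0" "s0 < t" "t < s0'" "s0' < 1"
      "phi (shift z \<omega>) x y s0' - phi (shift z \<omega>) x y s0 < \<epsilon>"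
    using cont[unfolded isCont_phi_iff[OF ord t]] by blast
  obtain s where s: "s0 < s" "s < t" using dense[OF s0(2)] by blast
  obtain s' where s': "t < s'" "s' < s0'" using dense[OF s0(3)] by blast
  have st: "tends_dir (\<lambda>n. stair r n + - z) (dr r)" if "0 < r" "r < 1" for r
    using that by (intro tends_dir_shift tends_dir_stair)
  have "\<forall>\<^sub>F n in sequentially. phi (shift z \<omega>) x y s0 \<le> incr \<omega> (x + z) (y + z) (stair s n)"
    using phi_le_incr[OF ord s0(1) s(1) _ st] s s0 t by (simp add: incr_shift)
  then have 1: "phi (shift z \<omega>) x y s0 \<le> phi \<omega> (x + z) (y + z) s"
    using s s0 t by (intro phi_ge[OF dir_ordered_shift[OF ord]]) auto
  have "\<forall>\<^sub>F n in sequentially. incr \<omega> (x + z) (y + z) (stair s' n) \<le> phi (shift z \<omega>) x y s0'"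
    using incr_le_phi[OF ord _ s'(2) s0(4) st] s' s0 t by (simp add: incr_shift)
  then have 2: "phi \<omega> (x + z) (y + z) s' \<le> phi (shift z \<omega>) x y s0'"
    using s' s0 t by (intro phi_le[OF dir_ordered_shift[OF ord]]) auto
  show "\<exists>s s'. 0 < s \<and> s < t \<and> t < s' \<and> s' < 1 \<and>
      phi \<omega> (x + z) (y + z) s' - phi \<omega> (x + z) (y + z) s < \<epsilon>"
    using 1 2 s s' s0 by (intro exI[of _ s] exI[of _ s']) auto
qed

text \<open>The increments are eventually between the values of \<open>phi\<close> at directions on
  either side of \<open>t\<close>; continuity closes the gap, whatever the sequence.\<close>

lemma incr_tendsto_phi:
  assumes ord: "dir_ordered \<omega> x y" and t: "0 < t" "t < 1" and cont: "isCont (phi \<omega> x y) t"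
    and v: "tends_dir v (dr t)"
  shows "(\<lambda>n. incr \<omega> x y (v n)) \<longlonglongrightarrow> phi \<omega> x y t"
proof (rule tendstoI)
  fix \<epsilon> :: real assume "\<epsilon> > 0"
  then obtain s s' where s: "0 < s" "s < t" "t < s'" "s' < 1" "phi \<omega> x y s' - phi \<omega> x y s < \<epsilon>"
    using cont[unfolded isCont_phi_iff[OF ord t]] by blast
  have m: "phi \<omega> x y s \<le> phi \<omega> x y t" "phi \<omega> x y t \<le> phi \<omega> x y s'"
    using s t by (auto intro!: phi_mono[OF ord])
  show "\<forall>\<^sub>F n in sequentially. dist (incr \<omega> x y (v n)) (phi \<omega> x y t) < \<epsilon>"
    using phi_le_incr[OF ord s(1,2) t(2) v] incr_le_phi[OF ord t(1) s(3,4) v]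
  proof eventually_elim
    case (elim n)
    then show ?case using m s(5) unfolding dist_real_def abs_less_iff by linarith
  qed
qed

text \<open>Equivalence rules carry a property from the oriented edges to all pairs of sites; for
  limits of increments the rules amount to the cocycle identity.\<close>

lemma site_adjacent_induct:
  assumes refl: "\<And>x. P x x" and sym: "\<And>x y. P x y \<Longrightarrow> P y x"
    and trans: "\<And>x y z. P x y \<Longrightarrow> P y z \<Longrightarrow> P x z"
    and h: "\<And>x. P x (x + e1)" and v: "\<And>x. P (x + e2) x"
  shows "P x y"
proof -
  have right: "P x (x + (int n, 0))" for n x
  proof (induction n)
    case 0
    show ?case using refl[of x] by (simp add: zero_prod_def[symmetric])
  next
    case (Suc n)
    have "x + (int (Suc n), 0) = x + (int n, 0) + e1" by (simp add: e1_def prod_eq_iff)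
    then show ?case using trans[OF Suc h] by metis
  qed
  have up: "P x (x + (0, int n))" for n x
  proof (induction n)
    case 0
    show ?case using refl[of x] by (simp add: zero_prod_def[symmetric])
  next
    case (Suc n)
    have "x + (0, int (Suc n)) = x + (0, int n) + e2" by (simp add: e2_def prod_eq_iff)
    then show ?case using trans[OF Suc sym[OF v]] by metis
  qed
  have 1: "P x (x + (k, 0))" for x k
  proof (cases "k \<ge> 0")
    case True then show ?thesis using right[of x "nat k"] by simp
  next
    case False
    then have "P (x + (k, 0)) (x + (k, 0) + (int (nat (- k)), 0))" by (intro right)
    also have "x + (k, 0) + (int (nat (- k)), 0) = x" using False by (simp add: prod_eq_iff)
    finally show ?thesis by (rule sym)
  qed
  have 2: "P x (x + (0, k))" for x k
  proof (cases "k \<ge> 0")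
    case True then show ?thesis using up[of x "nat k"] by simp
  next
    case False
    then have "P (x + (0, k)) (x + (0, k) + (0, int (nat (- k))))" by (intro up)
    also have "x + (0, k) + (0, int (nat (- k))) = x" using False by (simp add: prod_eq_iff)
    finally show ?thesis by (rule sym)
  qed
  have "P x (x + (fst (y - x), 0) + (0, snd (y - x)))" by (rule trans[OF 1 2])
  also have "x + (fst (y - x), 0) + (0, snd (y - x)) = y" by (simp add: prod_eq_iff)
  finally show ?thesis .
qed

subsection \<open>Busemann functions\<close>

definition cont_at :: "config \<Rightarrow> real \<Rightarrow> bool" where
  "cont_at \<omega> t \<longleftrightarrow> (\<forall>x. isCont (phi \<omega> x (x + e1)) t \<and> isCont (phi \<omega> (x + e2) x) t)"

definition U0 :: "config \<Rightarrow> (real \<times> real) set" where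
  "U0 \<omega> = {\<xi>\<in>dirs. cont_at \<omega> (fst \<xi>)}"

text \<open>Since \<open>lim\<close> is total, this is a functional of the weights on every
  configuration; its measurability, and that of its limits, involves no exceptional set.\<close>

definition B0 :: "config \<Rightarrow> real \<times> real \<Rightarrow> site \<Rightarrow> site \<Rightarrow> real" where
  "B0 \<omega> \<xi> x y = lim (\<lambda>n. incr \<omega> x y (stair (fst \<xi>) n))"

text \<open>Dyadic approximations of \<open>t\<close>, strictly from the right (\<open>True\<close>) and from the left (\<open>False\<close>);
  they reduce one-sided limits to countably many fixed directions.\<close>

definition dyadic :: "bool \<Rightarrow> real \<Rightarrow> nat \<Rightarrow> real" where
  "dyadic s t m = (if s then (of_int \<lfloor>2 ^ m * t\<rfloor> + 1) / 2 ^ m else (of_int \<lceil>2 ^ m * t\<rceil> - 1) / 2 ^ m)"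

definition Bs :: "bool \<Rightarrow> config \<Rightarrow> real \<times> real \<Rightarrow> site \<Rightarrow> site \<Rightarrow> real" where
  "Bs s \<omega> \<xi> x y = lim (\<lambda>m. B0 \<omega> (dr (dyadic s (fst \<xi>) m)) x y)"

text \<open>The almost sure event on which all pathwise assertions hold. Rational directions are
  included because the dyadic approximations must lie in \<open>U0\<close>.\<close>

definition good :: "config \<Rightarrow> bool" where
  "good \<omega> \<longleftrightarrow> (\<forall>x. dir_ordered \<omega> x (x + e1) \<and> dir_ordered \<omega> (x + e2) x) \<and>
     (\<forall>q\<in>\<rat>. 0 < q \<longrightarrow> q < 1 \<longrightarrow> cont_at \<omega> q)"

lemma dyadic_rat: "dyadic s t m \<in> \<rat>"
  by (simp add: dyadic_def)

lemma dyadic_bounds: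
  "t < dyadic True t m" "dyadic True t m \<le> t + (1/2) ^ m"
  "dyadic False t m < t" "t - (1/2) ^ m \<le> dyadic False t m"
proof -
  have p: "(0::real) < 2 ^ m" by simp
  have f: "of_int \<lfloor>2 ^ m * t\<rfloor> \<le> 2 ^ m * t" "2 ^ m * t < of_int \<lfloor>2 ^ m * t\<rfloor> + 1"
    "2 ^ m * t \<le> of_int \<lceil>2 ^ m * t\<rceil>" "of_int \<lceil>2 ^ m * t\<rceil> - 1 < 2 ^ m * t" by linarith+
  have h: "(1/2) ^ m = (1::real) / 2 ^ m" by (simp add: power_one_over)
  show "t < dyadic True t m" "dyadic True t m \<le> t + (1/2) ^ m"
    "dyadic False t m < t" "t - (1/2) ^ m \<le> dyadic False t m"
    using f p by (simp_all add: dyadic_def h field_simps)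
qed

lemma dyadic_LIMSEQ: "(\<lambda>m. dyadic s t m) \<longlonglongrightarrow> t"
proof -
  have z: "(\<lambda>m. (1/2::real) ^ m) \<longlonglongrightarrow> 0" by (rule LIMSEQ_power_zero) simp
  have "(\<lambda>m. t + (1/2) ^ m) \<longlonglongrightarrow> t" "(\<lambda>m. t - (1/2) ^ m) \<longlonglongrightarrow> t"
    using tendsto_add[OF tendsto_const z, of t] tendsto_diff[OF tendsto_const z, of t] by simp_all
  note lims = tendsto_sandwich[OF always_eventually always_eventually tendsto_const this(1)]
    tendsto_sandwich[OF always_eventually always_eventually this(2) tendsto_const]
  have "(\<lambda>m. dyadic True t m) \<longlonglongrightarrow> t" "(\<lambda>m. dyadic False t m) \<longlonglongrightarrow> t"
    by (intro lims allI less_imp_le[OF dyadic_bounds(1)] less_imp_le[OF dyadic_bounds(3)] dyadic_bounds)+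
  then show ?thesis by (cases s) simp_all
qed

definition side :: "bool \<Rightarrow> real \<times> real \<Rightarrow> config \<Rightarrow> (real \<times> real) set" where
  "side s \<xi> \<omega> = {\<zeta>\<in>U0 \<omega>. if s then fst \<xi> < fst \<zeta> else fst \<zeta> < fst \<xi>}"

lemma one_sided_limits:
  fixes f :: "real \<Rightarrow> real"
  assumes mono: "\<And>s t. 0 < s \<Longrightarrow> s \<le> t \<Longrightarrow> t < 1 \<Longrightarrow> f s \<le> f t" and t: "0 < t" "t < 1"
  shows "\<exists>l. (f \<longlongrightarrow> l) (at_right t) \<and> (\<forall>s. t < s \<longrightarrow> s < 1 \<longrightarrow> l \<le> f s) \<and> f t \<le> l"
    and "\<exists>l. (f \<longlongrightarrow> l) (at_left t) \<and> (\<forall>s. 0 < s \<longrightarrow> s < t \<longrightarrow> f s \<le> l) \<and> l \<le> f t"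
proof -
  define l where "l = Inf (f ` {t<..<1})"
  have ne: "f ` {t<..<1} \<noteq> {}" using t by simp
  have bdd: "bdd_below (f ` {t<..<1})" using mono t by (intro bdd_belowI[of _ "f t"]) auto
  have l: "l \<le> f s" if "t < s" "s < 1" for s
    unfolding l_def using that by (intro cInf_lower bdd) auto
  have "(f \<longlongrightarrow> l) (at_right t)"
  proof (rule order_tendstoI)
    fix a assume "a < l"
    have "\<forall>\<^sub>F s in at_right t. s < 1" using t by (intro eventually_at_rightI[of t 1]) auto
    with eventually_at_right_less show "\<forall>\<^sub>F s in at_right t. a < f s"
    proof eventually_elim
      case (elim s)
      then show ?case using l[of s] \<open>a < l\<close> by linarith
    qed
  next
    fix a assume "l < a"
    then obtain r where r: "t < r" "r < 1" "f r < a"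
      unfolding l_def cInf_less_iff[OF ne bdd] by auto
    have "\<forall>\<^sub>F s in at_right t. s < r" using r by (intro eventually_at_rightI[of t r]) auto
    with eventually_at_right_less show "\<forall>\<^sub>F s in at_right t. f s < a"
    proof eventually_elim
      case (elim s)
      then show ?case using mono[of s r] r t by linarith
    qed
  qed
  moreover have "f t \<le> l" unfolding l_def using ne mono t by (intro cInf_greatest) auto
  ultimately show "\<exists>l. (f \<longlongrightarrow> l) (at_right t) \<and> (\<forall>s. t < s \<longrightarrow> s < 1 \<longrightarrow> l \<le> f s) \<and> f t \<le> l"
    using l by blast
next
  define l where "l = Sup (f ` {0<..<t})"
  have ne: "f ` {0<..<t} \<noteq> {}" using t by simp
  have bdd: "bdd_above (f ` {0<..<t})" using mono t by (intro bdd_aboveI[of _ "f t"]) auto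
  have l: "f s \<le> l" if "0 < s" "s < t" for s
    unfolding l_def using that by (intro cSup_upper bdd) auto
  have "(f \<longlongrightarrow> l) (at_left t)"
  proof (rule order_tendstoI)
    fix a assume "l < a"
    have 1: "\<forall>\<^sub>F s in at_left t. 0 < s" using t by (intro eventually_at_leftI[of 0 t]) auto
    have 2: "\<forall>\<^sub>F s in at_left t. s < t" by (auto simp: eventually_at_filter)
    from 1 2 show "\<forall>\<^sub>F s in at_left t. f s < a"
    proof eventually_elim
      case (elim s)
      then show ?case using l[of s] \<open>l < a\<close> by linarith
    qed
  next
    fix a assume "a < l"
    then obtain r where r: "0 < r" "r < t" "a < f r"
      unfolding l_def less_cSup_iff[OF ne bdd] by auto
    have 1: "\<forall>\<^sub>F s in at_left t. r < s" using r by (intro eventually_at_leftI[of r t]) auto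
    have 2: "\<forall>\<^sub>F s in at_left t. s < t" by (auto simp: eventually_at_filter)
    from 1 2 show "\<forall>\<^sub>F s in at_left t. a < f s"
    proof eventually_elim
      case (elim s)
      then show ?case using mono[of r s] r t by linarith
    qed
  qed
  moreover have "l \<le> f t" unfolding l_def using ne mono t by (intro cSup_least) auto
  ultimately show "\<exists>l. (f \<longlongrightarrow> l) (at_left t) \<and> (\<forall>s. 0 < s \<longrightarrow> s < t \<longrightarrow> f s \<le> l) \<and> l \<le> f t"
    using l by blast
qed

definition adj :: "site \<Rightarrow> site \<Rightarrow> bool" where
  "adj x y \<longleftrightarrow> y = x + e1 \<or> x = y + e2"

lemma adj_steps: "adj x (x + e1)" "adj (x + e2) x"
  by (auto simp: adj_def)

lemma adj_induct:
  assumes refl: "\<And>x. P x x" and sym: "\<And>x y. P x y \<Longrightarrow> P y x"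
    and trans: "\<And>x y z. P x y \<Longrightarrow> P y z \<Longrightarrow> P x z" and adj: "\<And>x y. adj x y \<Longrightarrow> P x y"
  shows "P x y"
  by (rule site_adjacent_induct[of P, OF refl sym trans adj[OF adj_steps(1)] adj[OF adj_steps(2)]])

lemma cont_at_adj: "cont_at \<omega> t \<longleftrightarrow> (\<forall>x y. adj x y \<longrightarrow> isCont (phi \<omega> x y) t)"
  unfolding cont_at_def adj_def by blast

lemma good_ordered: "good \<omega> \<Longrightarrow> adj x y \<Longrightarrow> dir_ordered \<omega> x y"
  unfolding good_def adj_def by blast

lemma U0_dirs: "\<xi> \<in> U0 \<omega> \<Longrightarrow> \<xi> = dr (fst \<xi>) \<and> 0 < fst \<xi> \<and> fst \<xi> < 1"
  by (simp add: U0_def dirs_iff)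

lemma incr_cocycle: "incr \<omega> x z v = incr \<omega> x y v + incr \<omega> y z v"
  by (simp add: incr_def)

lemma U0_tendsto_phi:
  assumes "good \<omega>" "adj x y" "\<xi> \<in> U0 \<omega>" "tends_dir v \<xi>"
  shows "(\<lambda>n. incr \<omega> x y (v n)) \<longlonglongrightarrow> phi \<omega> x y (fst \<xi>)"
proof -
  have "isCont (phi \<omega> x y) (fst \<xi>)" using assms(2,3) unfolding U0_def cont_at_adj by blast
  then show ?thesis
    using assms U0_dirs[OF assms(3)] by (intro incr_tendsto_phi good_ordered) auto
qed

lemma U0_tendsto:
  assumes good: "good \<omega>" and \<xi>: "\<xi> \<in> U0 \<omega>" and v: "tends_dir v \<xi>"
  shows "(\<lambda>n. incr \<omega> x y (v n)) \<longlonglongrightarrow> B0 \<omega> \<xi> x y"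
proof -
  have "\<exists>l. \<forall>v. tends_dir v \<xi> \<longrightarrow> (\<lambda>n. incr \<omega> x y (v n)) \<longlonglongrightarrow> l"
  proof (induction x y rule: adj_induct)
    case (1 x)
    then show ?case by (auto simp: incr_def)
  next
    case (2 x y)
    then obtain l where "\<And>v. tends_dir v \<xi> \<Longrightarrow> (\<lambda>n. incr \<omega> x y (v n)) \<longlonglongrightarrow> l" by blast
    then have "\<And>v. tends_dir v \<xi> \<Longrightarrow> (\<lambda>n. - incr \<omega> x y (v n)) \<longlonglongrightarrow> - l" by (intro tendsto_minus)
    then show ?case by (auto simp: incr_def)
  next
    case (3 x y z)
    then obtain l l' where "\<And>v. tends_dir v \<xi> \<Longrightarrow> (\<lambda>n. incr \<omega> x y (v n)) \<longlonglongrightarrow> l"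
      "\<And>v. tends_dir v \<xi> \<Longrightarrow> (\<lambda>n. incr \<omega> y z (v n)) \<longlonglongrightarrow> l'" by blast
    then have "\<And>v. tends_dir v \<xi> \<Longrightarrow> (\<lambda>n. incr \<omega> x y (v n) + incr \<omega> y z (v n)) \<longlonglongrightarrow> l + l'"
      by (intro tendsto_add)
    then show ?case by (auto simp: incr_def)
  next
    case (4 x y)
    then show ?case using U0_tendsto_phi[OF good _ \<xi>] by blast
  qed
  then obtain l where l: "\<And>v. tends_dir v \<xi> \<Longrightarrow> (\<lambda>n. incr \<omega> x y (v n)) \<longlonglongrightarrow> l" by blast
  have "tends_dir (stair (fst \<xi>)) \<xi>" using U0_dirs[OF \<xi>] tends_dir_stair by metis
  from limI[OF l[OF this]] have "B0 \<omega> \<xi> x y = l" by (simp add: B0_def)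
  then show ?thesis using l[OF v] by simp
qed

lemma U0_stair: "\<xi> \<in> U0 \<omega> \<Longrightarrow> tends_dir (stair (fst \<xi>)) \<xi>"
  using U0_dirs tends_dir_stair by metis

lemma B0_phi: "good \<omega> \<Longrightarrow> adj x y \<Longrightarrow> \<xi> \<in> U0 \<omega> \<Longrightarrow> B0 \<omega> \<xi> x y = phi \<omega> x y (fst \<xi>)"
  using LIMSEQ_unique[OF U0_tendsto U0_tendsto_phi] U0_stair by blast

lemma B0_cocycle:
  assumes "good \<omega>" "\<xi> \<in> U0 \<omega>" shows "B0 \<omega> \<xi> x z = B0 \<omega> \<xi> x y + B0 \<omega> \<xi> y z"
proof (rule LIMSEQ_unique)
  note l = U0_tendsto[OF assms U0_stair[OF assms(2)]]
  show "(\<lambda>n. incr \<omega> x z (stair (fst \<xi>) n)) \<longlonglongrightarrow> B0 \<omega> \<xi> x z" by (rule l)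
  show "(\<lambda>n. incr \<omega> x z (stair (fst \<xi>) n)) \<longlonglongrightarrow> B0 \<omega> \<xi> x y + B0 \<omega> \<xi> y z"
    unfolding incr_cocycle[of \<omega> x z _ y] by (intro tendsto_add l)
qed

lemma B0_refl:
  assumes "good \<omega>" "\<xi> \<in> U0 \<omega>" shows "B0 \<omega> \<xi> x x = 0"
  using B0_cocycle[OF assms, of x x x] by simp

lemma B0_sym:
  assumes "good \<omega>" "\<xi> \<in> U0 \<omega>" shows "B0 \<omega> \<xi> y x = - B0 \<omega> \<xi> x y"
  using B0_cocycle[OF assms, of x x y] B0_refl[OF assms, of x] by simp

text \<open>The staircase is eventually strictly beyond \<open>x\<close> in both coordinates, so the
  first-step recursion applies and passes to the limit.\<close>

lemma B0_adapted:
  assumes "good \<omega>" "\<xi> \<in> U0 \<omega>"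
  shows "min (W \<omega> (padd x e1) 1 - B0 \<omega> \<xi> x (padd x e1)) (W \<omega> (padd x e2) 2 - B0 \<omega> \<xi> x (padd x e2)) = 0"
proof (rule LIMSEQ_unique)
  let ?v = "stair (fst \<xi>)"
  note v = U0_stair[OF assms(2)]
  show "(\<lambda>n. min (W \<omega> (padd x e1) 1 - incr \<omega> x (padd x e1) (?v n)) (W \<omega> (padd x e2) 2 - incr \<omega> x (padd x e2) (?v n)))
    \<longlonglongrightarrow> min (W \<omega> (padd x e1) 1 - B0 \<omega> \<xi> x (padd x e1)) (W \<omega> (padd x e2) 2 - B0 \<omega> \<xi> x (padd x e2))"
    by (intro tendsto_min tendsto_diff tendsto_const U0_tendsto assms v)
  have "tends_dir ?v (dr (fst \<xi>))" using v U0_dirs[OF assms(2)] by metis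
  then have "\<forall>\<^sub>F n in sequentially. ple (fst x + 1, snd x + 1) (?v n)"
    using U0_dirs[OF assms(2)] by (intro tends_dir_eventually_ge) auto
  then have "\<forall>\<^sub>F n in sequentially. 0 = min (W \<omega> (padd x e1) 1 - incr \<omega> x (padd x e1) (?v n)) (W \<omega> (padd x e2) 2 - incr \<omega> x (padd x e2) (?v n))"
  proof eventually_elim
    case (elim n)
    then have "fst x < fst (?v n)" "snd x < snd (?v n)" by (auto simp: ple_def)
    from passage_rec[OF this, of \<omega>] show ?case by (simp add: incr_def min_def split: if_splits)
  qed
  then show "(\<lambda>n. min (W \<omega> (padd x e1) 1 - incr \<omega> x (padd x e1) (?v n)) (W \<omega> (padd x e2) 2 - incr \<omega> x (padd x e2) (?v n)))
    \<longlonglongrightarrow> 0"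
    by (rule tendsto_eventually[OF eventually_mono]) simp
qed

text \<open>A monotone function has countably many discontinuities, and there are countably many
  edges.\<close>

lemma countable_not_U0:
  assumes "good \<omega>" shows "countable (dirs - U0 \<omega>)"
proof -
  have "countable {t\<in>{0<..<1}. \<not> isCont (phi \<omega> x y) t}" if "adj x y" for x y
    using phi_mono[OF good_ordered[OF assms that]]
    by (intro mono_on_ctble_discont_open) (auto simp: mono_on_def)
  then have "countable (dr ` (\<Union>x. \<Union>y\<in>{y. adj x y}. {t\<in>{0<..<1}. \<not> isCont (phi \<omega> x y) t}))"
    by (intro countable_image countable_UN) auto
  then show ?thesis
  proof (rule countable_subset[rotated], safe)
    fix a b assume ab: "(a, b) \<in> dirs" "(a, b) \<notin> U0 \<omega>"
    then have "b = 1 - a" "0 < a" "a < 1" by (auto simp: dirs_iff)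
    then show "(a, b) \<in> dr ` (\<Union>x. \<Union>y\<in>{y. adj x y}. {t\<in>{0<..<1}. \<not> isCont (phi \<omega> x y) t})"
      using ab by (auto simp: U0_def cont_at_adj)
  qed
qed

lemma dyadic_side:
  assumes "good \<omega>" "0 < t" "t < 1"
  shows "\<forall>\<^sub>F m in sequentially. dr (dyadic s t m) \<in> side s (dr t) \<omega> \<and> dr (dyadic s t m) \<noteq> dr t"
proof -
  have "\<forall>\<^sub>F m in sequentially. 0 < dyadic s t m" "\<forall>\<^sub>F m in sequentially. dyadic s t m < 1"
    using order_tendstoD[OF dyadic_LIMSEQ] assms by auto
  then show ?thesis
  proof eventually_elim
    case (elim m)
    then have "dr (dyadic s t m) \<in> U0 \<omega>"
      using assms(1) dyadic_rat by (auto simp: U0_def good_def)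
    then show ?case
      using dyadic_bounds(1,3)[of t m] by (cases s) (auto simp: side_def)
  qed
qed

lemma filterlim_dyadic:
  assumes "good \<omega>" "0 < t" "t < 1"
  shows "filterlim (\<lambda>m. dr (dyadic s t m)) (at (dr t) within side s (dr t) \<omega>) sequentially"
  unfolding filterlim_at using dyadic_side[OF assms]
  by (auto intro!: tendsto_intros dyadic_LIMSEQ)

lemma side_nontrivial:
  assumes "good \<omega>" "0 < t" "t < 1"
  shows "at (dr t) within side s (dr t) \<omega> \<noteq> bot"
proof
  assume "at (dr t) within side s (dr t) \<omega> = bot"
  then have "\<forall>\<^sub>F \<zeta> in at (dr t) within side s (dr t) \<omega>. False" by simp
  from eventually_compose_filterlim[OF this filterlim_dyadic[OF assms]] show False by simp
qed

lemma eventually_side: "\<forall>\<^sub>F \<zeta> in at \<xi> within side s \<xi>' \<omega>. \<zeta> \<in> U0 \<omega>"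
  by (auto simp: eventually_at_filter side_def)

lemma eventually_U0: "\<forall>\<^sub>F \<zeta> in at \<xi> within U0 \<omega>. \<zeta> \<in> U0 \<omega>"
  by (auto simp: eventually_at_filter)

text \<open>On \<open>U0\<close> the edge values of \<open>B0\<close> are values of
  \<open>phi\<close>, whose one-sided limits exist by monotonicity. The additional bounds are what
  the ordering of \<open>Bs\<close> rests on.\<close>

lemma phi_side_limit:
  assumes good: "good \<omega>" and t: "0 < t" "t < 1" and a: "adj x y"
  shows "\<exists>l. ((\<lambda>\<zeta>. B0 \<omega> \<zeta> x y) \<longlongrightarrow> l) (at (dr t) within side s (dr t) \<omega>) \<and>
    (phi \<omega> x y \<longlongrightarrow> l) (if s then at_right t else at_left t) \<and>
    (if s then phi \<omega> x y t \<le> l \<and> (\<forall>r. t < r \<longrightarrow> r < 1 \<longrightarrow> l \<le> phi \<omega> x y r)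
     else l \<le> phi \<omega> x y t \<and> (\<forall>r. 0 < r \<longrightarrow> r < t \<longrightarrow> phi \<omega> x y r \<le> l))"
proof -
  let ?F = "at (dr t) within side s (dr t) \<omega>"
  let ?G = "if s then at_right t else at_left t"
  obtain l where l: "(phi \<omega> x y \<longlongrightarrow> l) ?G"
    "if s then phi \<omega> x y t \<le> l \<and> (\<forall>r. t < r \<longrightarrow> r < 1 \<longrightarrow> l \<le> phi \<omega> x y r)
     else l \<le> phi \<omega> x y t \<and> (\<forall>r. 0 < r \<longrightarrow> r < t \<longrightarrow> phi \<omega> x y r \<le> l)"
    using one_sided_limits[where f = "phi \<omega> x y", OF phi_mono[OF good_ordered[OF good a]] t] by (cases s) auto
  have ev: "\<forall>\<^sub>F \<zeta> in ?F. \<zeta> \<in> side s (dr t) \<omega>" by (auto simp: eventually_at_filter)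
  have "(fst \<longlongrightarrow> t) ?F" using tendsto_fst[OF tendsto_ident_at, of "dr t"] by simp
  then have "filterlim fst ?G ?F"
    using ev by (cases s) (auto simp: filterlim_at side_def elim: eventually_mono)
  from filterlim_compose[OF l(1) this] have "((\<lambda>\<zeta>. phi \<omega> x y (fst \<zeta>)) \<longlongrightarrow> l) ?F" .
  moreover have "\<forall>\<^sub>F \<zeta> in ?F. phi \<omega> x y (fst \<zeta>) = B0 \<omega> \<zeta> x y"
    using ev by eventually_elim (simp add: side_def B0_phi[OF good a])
  ultimately have "((\<lambda>\<zeta>. B0 \<omega> \<zeta> x y) \<longlongrightarrow> l) ?F" by (rule Lim_transform_eventually)
  then show ?thesis using l by blast
qed

text \<open>Existence of the limit extends from edges to all pairs; its value is then read off along
  the dyadic directions.\<close>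

lemma Bs_tendsto:
  assumes good: "good \<omega>" and t: "0 < t" "t < 1"
  shows "((\<lambda>\<zeta>. B0 \<omega> \<zeta> x y) \<longlongrightarrow> Bs s \<omega> (dr t) x y) (at (dr t) within side s (dr t) \<omega>)"
proof -
  let ?F = "at (dr t) within side s (dr t) \<omega>"
  have ev: "\<forall>\<^sub>F \<zeta> in ?F. \<zeta> \<in> U0 \<omega>" by (auto simp: eventually_at_filter side_def)
  have "\<exists>l. ((\<lambda>\<zeta>. B0 \<omega> \<zeta> x y) \<longlongrightarrow> l) ?F"
  proof (induction x y rule: adj_induct)
    case (1 x)
    have "\<forall>\<^sub>F \<zeta> in ?F. B0 \<omega> \<zeta> x x = 0" using ev by eventually_elim (simp add: B0_refl[OF good])
    from tendsto_eventually[OF this] show ?case by blast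
  next
    case (2 x y)
    then obtain l where "((\<lambda>\<zeta>. B0 \<omega> \<zeta> x y) \<longlongrightarrow> l) ?F" by blast
    then have "((\<lambda>\<zeta>. - B0 \<omega> \<zeta> x y) \<longlongrightarrow> - l) ?F" by (rule tendsto_minus)
    moreover have "\<forall>\<^sub>F \<zeta> in ?F. - B0 \<omega> \<zeta> x y = B0 \<omega> \<zeta> y x"
      using ev by eventually_elim (simp add: B0_sym[OF good, of _ y x])
    ultimately have "((\<lambda>\<zeta>. B0 \<omega> \<zeta> y x) \<longlongrightarrow> - l) ?F" by (rule Lim_transform_eventually)
    then show ?case by blast
  next
    case (3 x y z)
    then obtain l l' where "((\<lambda>\<zeta>. B0 \<omega> \<zeta> x y) \<longlongrightarrow> l) ?F" "((\<lambda>\<zeta>. B0 \<omega> \<zeta> y z) \<longlongrightarrow> l') ?F" by blast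
    then have "((\<lambda>\<zeta>. B0 \<omega> \<zeta> x y + B0 \<omega> \<zeta> y z) \<longlongrightarrow> l + l') ?F" by (rule tendsto_add)
    moreover have "\<forall>\<^sub>F \<zeta> in ?F. B0 \<omega> \<zeta> x y + B0 \<omega> \<zeta> y z = B0 \<omega> \<zeta> x z"
      using ev by eventually_elim (simp add: B0_cocycle[OF good, of _ x z y])
    ultimately have "((\<lambda>\<zeta>. B0 \<omega> \<zeta> x z) \<longlongrightarrow> l + l') ?F" by (rule Lim_transform_eventually)
    then show ?case by blast
  next
    case (4 x y)
    then show ?case using phi_side_limit[OF good t, of x y s] by blast
  qed
  then obtain l where l: "((\<lambda>\<zeta>. B0 \<omega> \<zeta> x y) \<longlongrightarrow> l) ?F" by blast
  have "(\<lambda>m. B0 \<omega> (dr (dyadic s t m)) x y) \<longlonglongrightarrow> l"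
    by (rule filterlim_compose[OF l filterlim_dyadic[OF assms]])
  then have "Bs s \<omega> (dr t) x y = l" by (simp add: Bs_def limI)
  then show ?thesis using l by simp
qed

lemma Bs_cocycle:
  assumes good: "good \<omega>" and t: "0 < t" "t < 1"
  shows "Bs s \<omega> (dr t) x z = Bs s \<omega> (dr t) x y + Bs s \<omega> (dr t) y z"
proof (rule tendsto_unique[OF side_nontrivial[OF assms]])
  let ?F = "at (dr t) within side s (dr t) \<omega>"
  note l = Bs_tendsto[OF assms]
  have "\<forall>\<^sub>F \<zeta> in ?F. B0 \<omega> \<zeta> x y + B0 \<omega> \<zeta> y z = B0 \<omega> \<zeta> x z"
    using eventually_side by eventually_elim (simp add: B0_cocycle[OF good, of _ x z y])
  moreover have "((\<lambda>\<zeta>. B0 \<omega> \<zeta> x y + B0 \<omega> \<zeta> y z) \<longlongrightarrow> Bs s \<omega> (dr t) x y + Bs s \<omega> (dr t) y z) ?F"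
    by (intro tendsto_add l)
  ultimately show "((\<lambda>\<zeta>. B0 \<omega> \<zeta> x z) \<longlongrightarrow> Bs s \<omega> (dr t) x y + Bs s \<omega> (dr t) y z) ?F"
    by (simp add: tendsto_cong)
  show "((\<lambda>\<zeta>. B0 \<omega> \<zeta> x z) \<longlongrightarrow> Bs s \<omega> (dr t) x z) ?F" by (rule l)
qed

lemma Bs_refl: "good \<omega> \<Longrightarrow> 0 < t \<Longrightarrow> t < 1 \<Longrightarrow> Bs s \<omega> (dr t) x x = 0"
  using Bs_cocycle[of \<omega> t s x x x] by simp

lemma Bs_sym: "good \<omega> \<Longrightarrow> 0 < t \<Longrightarrow> t < 1 \<Longrightarrow> Bs s \<omega> (dr t) y x = - Bs s \<omega> (dr t) x y"
  using Bs_cocycle[of \<omega> t s x x y] Bs_refl[of \<omega> t s x] by simp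

lemma Bs_adapted:
  assumes good: "good \<omega>" and t: "0 < t" "t < 1"
  shows "min (W \<omega> (padd x e1) 1 - Bs s \<omega> (dr t) x (padd x e1))
    (W \<omega> (padd x e2) 2 - Bs s \<omega> (dr t) x (padd x e2)) = 0"
proof (rule tendsto_unique[OF side_nontrivial[OF assms]])
  let ?F = "at (dr t) within side s (dr t) \<omega>"
  let ?m = "\<lambda>\<zeta>. min (W \<omega> (padd x e1) 1 - B0 \<omega> \<zeta> x (padd x e1)) (W \<omega> (padd x e2) 2 - B0 \<omega> \<zeta> x (padd x e2))"
  show "(?m \<longlongrightarrow> min (W \<omega> (padd x e1) 1 - Bs s \<omega> (dr t) x (padd x e1))
    (W \<omega> (padd x e2) 2 - Bs s \<omega> (dr t) x (padd x e2))) ?F"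
    by (intro tendsto_min tendsto_diff tendsto_const Bs_tendsto assms)
  have "\<forall>\<^sub>F \<zeta> in ?F. ?m \<zeta> = 0"
    using eventually_side by eventually_elim (rule B0_adapted[OF good])
  then show "(?m \<longlongrightarrow> 0) ?F" by (rule tendsto_eventually)
qed

lemma Bs_phi:
  assumes good: "good \<omega>" and t: "0 < t" "t < 1" and a: "adj x y"
  shows "(phi \<omega> x y \<longlongrightarrow> Bs True \<omega> (dr t) x y) (at_right t)"
    "(phi \<omega> x y \<longlongrightarrow> Bs False \<omega> (dr t) x y) (at_left t)"
    "phi \<omega> x y t \<le> Bs True \<omega> (dr t) x y" "Bs False \<omega> (dr t) x y \<le> phi \<omega> x y t"
    "t < r \<Longrightarrow> r < 1 \<Longrightarrow> Bs True \<omega> (dr t) x y \<le> phi \<omega> x y r"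
    "0 < r \<Longrightarrow> r < t \<Longrightarrow> phi \<omega> x y r \<le> Bs False \<omega> (dr t) x y"
proof -
  have eq: "l = Bs s \<omega> (dr t) x y"
    if "((\<lambda>\<zeta>. B0 \<omega> \<zeta> x y) \<longlongrightarrow> l) (at (dr t) within side s (dr t) \<omega>)" for l s
    by (rule tendsto_unique[OF side_nontrivial[OF good t] that Bs_tendsto[OF good t]])
  show "(phi \<omega> x y \<longlongrightarrow> Bs True \<omega> (dr t) x y) (at_right t)"
    "phi \<omega> x y t \<le> Bs True \<omega> (dr t) x y" "t < r \<Longrightarrow> r < 1 \<Longrightarrow> Bs True \<omega> (dr t) x y \<le> phi \<omega> x y r"
    using phi_side_limit[OF good t a, of True] eq[of _ True] by auto
  show "(phi \<omega> x y \<longlongrightarrow> Bs False \<omega> (dr t) x y) (at_left t)"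
    "Bs False \<omega> (dr t) x y \<le> phi \<omega> x y t" "0 < r \<Longrightarrow> r < t \<Longrightarrow> phi \<omega> x y r \<le> Bs False \<omega> (dr t) x y"
    using phi_side_limit[OF good t a, of False] eq[of _ False] by auto
qed

lemma Bs_mono:
  assumes good: "good \<omega>" and a: "adj x y"
  shows "0 < t \<Longrightarrow> t < 1 \<Longrightarrow> Bs False \<omega> (dr t) x y \<le> Bs True \<omega> (dr t) x y"
    and "0 < t \<Longrightarrow> t < t' \<Longrightarrow> t' < 1 \<Longrightarrow> Bs True \<omega> (dr t) x y \<le> Bs False \<omega> (dr t') x y"
proof -
  show "0 < t \<Longrightarrow> t < 1 \<Longrightarrow> Bs False \<omega> (dr t) x y \<le> Bs True \<omega> (dr t) x y"
    using Bs_phi(3,4)[OF good _ _ a, of t] by linarith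
  assume t: "0 < t" "t < t'" "t' < 1"
  obtain r where "t < r" "r < t'" using dense[OF t(2)] by blast
  then show "Bs True \<omega> (dr t) x y \<le> Bs False \<omega> (dr t') x y"
    using Bs_phi(5)[OF good _ _ a, of t r] Bs_phi(6)[OF good _ _ a, of t' r] t by linarith
qed

text \<open>On edges, monotonicity bounds the values from below by the right limit and, for large
  \<open>n\<close>, from above by \<open>phi\<close> at a fixed term \<open>\<tau> m\<close>, which
  is close to that limit.\<close>

lemma Bs_right_continuous:
  assumes good: "good \<omega>" and t: "0 < t" "t < 1"
    and \<tau>: "\<And>n. t < \<tau> n" "\<And>n. \<tau> n < 1" "\<tau> \<longlonglongrightarrow> t"
  shows "(\<lambda>n. Bs s \<omega> (dr (\<tau> n)) x y) \<longlonglongrightarrow> Bs True \<omega> (dr t) x y"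
proof (induction x y rule: adj_induct)
  case (1 x)
  then show ?case using good t \<tau> by (simp add: Bs_refl order.strict_trans)
next
  case (2 x y)
  have "0 < \<tau> n" for n using \<tau>(1)[of n] t by linarith
  then show ?case using tendsto_minus[OF 2] Bs_sym[OF good _ _, of _ _ y x] t \<tau>(2) by simp
next
  case (3 x y z)
  have "0 < \<tau> n" for n using \<tau>(1)[of n] t by linarith
  then show ?case using tendsto_add[OF 3] Bs_cocycle[OF good _ _, of _ _ x z y] t \<tau>(2) by simp
next
  case (4 x y)
  note p = Bs_phi[OF good t 4]
  have t0: "0 < \<tau> n" for n using \<tau>(1)[of n] t by linarith
  have "\<tau> n \<noteq> t" for n using \<tau>(1)[of n] by simp
  then have "filterlim \<tau> (at_right t) sequentially" using \<tau> by (simp add: filterlim_at)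
  from filterlim_compose[OF p(1) this] have l1: "(\<lambda>n. phi \<omega> x y (\<tau> n)) \<longlonglongrightarrow> Bs True \<omega> (dr t) x y" .
  show ?case
  proof (rule order_tendstoI)
    fix a assume "a < Bs True \<omega> (dr t) x y"
    moreover have "Bs True \<omega> (dr t) x y \<le> Bs s \<omega> (dr (\<tau> n)) x y" for n
      using Bs_mono(2)[OF good 4 t(1) \<tau>(1)[of n] \<tau>(2)[of n]] Bs_mono(1)[OF good 4 t0[of n] \<tau>(2)[of n]]
      by (cases s) simp_all
    ultimately have "a < Bs s \<omega> (dr (\<tau> n)) x y" for n by (rule less_le_trans)
    then show "\<forall>\<^sub>F n in sequentially. a < Bs s \<omega> (dr (\<tau> n)) x y" by simp
  next
    fix a assume "Bs True \<omega> (dr t) x y < a"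
    then obtain m where m: "phi \<omega> x y (\<tau> m) < a"
      using order_tendstoD(2)[OF l1] by (auto simp: eventually_sequentially)
    have "\<forall>\<^sub>F n in sequentially. \<tau> n < \<tau> m" by (rule order_tendstoD(2)[OF \<tau>(3) \<tau>(1)])
    then show "\<forall>\<^sub>F n in sequentially. Bs s \<omega> (dr (\<tau> n)) x y < a"
    proof eventually_elim
      case (elim n)
      have "Bs True \<omega> (dr (\<tau> n)) x y \<le> phi \<omega> x y (\<tau> m)"
        by (rule Bs_phi(5)[OF good t0 \<tau>(2) 4 elim \<tau>(2)])
      moreover have "Bs s \<omega> (dr (\<tau> n)) x y \<le> Bs True \<omega> (dr (\<tau> n)) x y"
        using Bs_mono(1)[OF good 4 t0 \<tau>(2)] by (cases s) auto
      ultimately show ?case using m by linarith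
    qed
  qed
qed

lemma Bs_left_continuous:
  assumes good: "good \<omega>" and t: "0 < t" "t < 1"
    and \<tau>: "\<And>n. \<tau> n < t" "\<And>n. 0 < \<tau> n" "\<tau> \<longlonglongrightarrow> t"
  shows "(\<lambda>n. Bs s \<omega> (dr (\<tau> n)) x y) \<longlonglongrightarrow> Bs False \<omega> (dr t) x y"
proof (induction x y rule: adj_induct)
  case (1 x)
  have "\<tau> n < 1" for n using \<tau>(1)[of n] t by linarith
  then show ?case using good t \<tau> by (simp add: Bs_refl)
next
  case (2 x y)
  have "\<tau> n < 1" for n using \<tau>(1)[of n] t by linarith
  then show ?case using tendsto_minus[OF 2] Bs_sym[OF good _ _, of _ _ y x] t \<tau>(2) by simp
next
  case (3 x y z)
  have "\<tau> n < 1" for n using \<tau>(1)[of n] t by linarith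
  then show ?case using tendsto_add[OF 3] Bs_cocycle[OF good _ _, of _ _ x z y] t \<tau>(2) by simp
next
  case (4 x y)
  note p = Bs_phi[OF good t 4]
  have t1: "\<tau> n < 1" for n using \<tau>(1)[of n] t by linarith
  have "\<tau> n \<noteq> t" for n using \<tau>(1)[of n] by simp
  then have "filterlim \<tau> (at_left t) sequentially" using \<tau> by (simp add: filterlim_at)
  from filterlim_compose[OF p(2) this] have l1: "(\<lambda>n. phi \<omega> x y (\<tau> n)) \<longlonglongrightarrow> Bs False \<omega> (dr t) x y" .
  show ?case
  proof (rule order_tendstoI)
    fix a assume "Bs False \<omega> (dr t) x y < a"
    moreover have "Bs s \<omega> (dr (\<tau> n)) x y \<le> Bs False \<omega> (dr t) x y" for n
      using Bs_mono(2)[OF good 4 \<tau>(2)[of n] \<tau>(1)[of n] t(2)] Bs_mono(1)[OF good 4 \<tau>(2)[of n] t1[of n]]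
      by (cases s) simp_all
    ultimately have "Bs s \<omega> (dr (\<tau> n)) x y < a" for n by (rule le_less_trans[rotated])
    then show "\<forall>\<^sub>F n in sequentially. Bs s \<omega> (dr (\<tau> n)) x y < a" by simp
  next
    fix a assume "a < Bs False \<omega> (dr t) x y"
    then obtain m where m: "a < phi \<omega> x y (\<tau> m)"
      using order_tendstoD(1)[OF l1] by (auto simp: eventually_sequentially)
    have "\<forall>\<^sub>F n in sequentially. \<tau> m < \<tau> n" by (rule order_tendstoD(1)[OF \<tau>(3) \<tau>(1)])
    then show "\<forall>\<^sub>F n in sequentially. a < Bs s \<omega> (dr (\<tau> n)) x y"
    proof eventually_elim
      case (elim n)
      have "phi \<omega> x y (\<tau> m) \<le> Bs False \<omega> (dr (\<tau> n)) x y"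
        by (rule Bs_phi(6)[OF good \<tau>(2) t1 4 \<tau>(2) elim])
      moreover have "Bs False \<omega> (dr (\<tau> n)) x y \<le> Bs s \<omega> (dr (\<tau> n)) x y"
        using Bs_mono(1)[OF good 4 \<tau>(2) t1] by (cases s) auto
      ultimately show ?case using m by linarith
    qed
  qed
qed

lemma B0_continuous:
  assumes good: "good \<omega>" and \<xi>: "\<xi> \<in> U0 \<omega>"
  shows "((\<lambda>\<zeta>. B0 \<omega> \<zeta> x y) \<longlongrightarrow> B0 \<omega> \<xi> x y) (at \<xi> within U0 \<omega>)"
proof (induction x y rule: adj_induct)
  case (1 x)
  have "\<forall>\<^sub>F \<zeta> in at \<xi> within U0 \<omega>. B0 \<omega> \<zeta> x x = 0" using eventually_U0 by eventually_elim (simp add: B0_refl[OF good])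
  then show ?case by (simp add: tendsto_eventually B0_refl[OF good \<xi>])
next
  case (2 x y)
  have "\<forall>\<^sub>F \<zeta> in at \<xi> within U0 \<omega>. - B0 \<omega> \<zeta> x y = B0 \<omega> \<zeta> y x"
    using eventually_U0 by eventually_elim (simp add: B0_sym[OF good, of _ y x])
  then show ?case
    using tendsto_minus[OF 2] by (simp add: tendsto_cong B0_sym[OF good \<xi>, of y x])
next
  case (3 x y z)
  have "\<forall>\<^sub>F \<zeta> in at \<xi> within U0 \<omega>. B0 \<omega> \<zeta> x y + B0 \<omega> \<zeta> y z = B0 \<omega> \<zeta> x z"
    using eventually_U0 by eventually_elim (simp add: B0_cocycle[OF good, of _ x z y])
  then show ?case
    using tendsto_add[OF 3] by (simp add: tendsto_cong B0_cocycle[OF good \<xi>, of x z y])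
next
  case (4 x y)
  have "isCont (phi \<omega> x y) (fst \<xi>)" using \<xi> 4 unfolding U0_def cont_at_adj by blast
  then have "((\<lambda>\<zeta>. phi \<omega> x y (fst \<zeta>)) \<longlongrightarrow> phi \<omega> x y (fst \<xi>)) (at \<xi> within U0 \<omega>)"
    by (rule isCont_tendsto_compose) (intro tendsto_intros)
  moreover have "\<forall>\<^sub>F \<zeta> in at \<xi> within U0 \<omega>. phi \<omega> x y (fst \<zeta>) = B0 \<omega> \<zeta> x y"
    using eventually_U0 by eventually_elim (simp add: B0_phi[OF good 4])
  ultimately show ?case by (simp add: tendsto_cong B0_phi[OF good 4 \<xi>])
qed

lemma Bs_eq_B0:
  assumes good: "good \<omega>" and \<xi>: "\<xi> \<in> U0 \<omega>"
  shows "Bs s \<omega> \<xi> x y = B0 \<omega> \<xi> x y"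
proof -
  obtain t where t: "\<xi> = dr t" "0 < t" "t < 1" using U0_dirs[OF \<xi>] by blast
  have "((\<lambda>\<zeta>. B0 \<omega> \<zeta> x y) \<longlongrightarrow> B0 \<omega> \<xi> x y) (at \<xi> within side s \<xi> \<omega>)"
    by (rule tendsto_within_subset[OF B0_continuous[OF good \<xi>]]) (auto simp: side_def)
  then show ?thesis
    using tendsto_unique[OF side_nontrivial[OF good t(2,3)] Bs_tendsto[OF good t(2,3)]] t by blast
qed

subsection \<open>Means of the increments\<close>

context fpp
begin

lemma ell_isCont: "0 < a \<Longrightarrow> 0 < b \<Longrightarrow> isCont ell (a, b)"
  using diff by (auto intro: differentiable_imp_continuous_within)

lemma ple_0_stair: "0 \<le> t \<Longrightarrow> t \<le> 1 \<Longrightarrow> ple 0 (stair t n)"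
proof -
  assume t: "0 \<le> t" "t \<le> 1"
  have "real n * t \<le> real n" using t by (simp add: mult_left_le)
  then have "\<lfloor>real n * t\<rfloor> \<le> int n" by (simp add: floor_le_iff)
  then show ?thesis using t by (simp add: ple_def stair_def)
qed

lemma stair_LIMSEQ:
  assumes "0 < t" "t < 1"
  shows "(\<lambda>n. real_of_int (fst (stair t n)) / real n) \<longlonglongrightarrow> t"
    "(\<lambda>n. real_of_int (snd (stair t n)) / real n) \<longlonglongrightarrow> 1 - t"
  using tends_dirD(2,3)[OF tends_dir_stair[OF assms]] assms by (simp_all add: norm1_stair)

lemma stair_Suc:
  assumes "0 < t" "t < 1"
  shows "stair t (Suc n) = stair t n + e1 \<or> stair t (Suc n) = stair t n + e2"
proof -
  have "real (Suc n) * t = real n * t + t" by (simp add: algebra_simps)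
  then have "\<lfloor>real (Suc n) * t\<rfloor> = \<lfloor>real n * t\<rfloor> \<or> \<lfloor>real (Suc n) * t\<rfloor> = \<lfloor>real n * t\<rfloor> + 1"
    using assms by linarith
  then show ?thesis by (auto simp: stair_def e1_def e2_def prod_eq_iff simp del: of_nat_Suc)
qed

text \<open>The increments of \<open>EL\<close> are summed along the staircase, which makes about
  \<open>n t\<close> steps \<open>e1\<close> and \<open>n (1 - t)\<close> steps \<open>e2\<close>;
  the constant \<open>K\<close> left by the first \<open>N\<close> terms disappears after division
  by \<open>n\<close>.\<close>

lemma ell_le_of_increments:
  assumes t: "0 < t" "t < 1"
    and d1: "\<forall>\<^sub>F n in sequentially. EL (stair t n) - EL (stair t n - e1) \<le> d1"
    and d2: "\<forall>\<^sub>F n in sequentially. EL (stair t n) - EL (stair t n - e2) \<le> d2"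
  shows "ell (dr t) \<le> t * d1 + (1 - t) * d2"
proof -
  let ?a = "\<lambda>n. real_of_int (fst (stair t n))" and ?b = "\<lambda>n. real_of_int (snd (stair t n))"
  obtain N where N: "\<And>n. n \<ge> N \<Longrightarrow> EL (stair t n) - EL (stair t n - e1) \<le> d1"
      "\<And>n. n \<ge> N \<Longrightarrow> EL (stair t n) - EL (stair t n - e2) \<le> d2"
    using eventually_conj[OF d1 d2] unfolding eventually_sequentially by blast
  define K where "K = EL (stair t N) - ?a N * d1 - ?b N * d2"
  have bound: "EL (stair t n) \<le> ?a n * d1 + ?b n * d2 + K" if "n \<ge> N" for n
    using that
  proof (induction n rule: nat_induct_at_least)
    case base
    then show ?case by (simp add: K_def)
  next
    case (Suc n)
    from stair_Suc[OF t, of n] show ?case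
    proof
      assume s: "stair t (Suc n) = stair t n + e1"
      then show ?thesis using N(1)[of "Suc n"] Suc by (simp add: e1_def algebra_simps)
    next
      assume s: "stair t (Suc n) = stair t n + e2"
      then show ?thesis using N(2)[of "Suc n"] Suc by (simp add: e2_def algebra_simps)
    qed
  qed
  have "(\<lambda>n. ell (?a n / real n, ?b n / real n)) \<longlonglongrightarrow> ell (dr t)"
    using t by (intro isCont_tendsto_compose[OF ell_isCont] tendsto_Pair stair_LIMSEQ) auto
  moreover have "(\<lambda>n. ?a n / real n * d1 + ?b n / real n * d2 + K / real n) \<longlonglongrightarrow> t * d1 + (1 - t) * d2 + 0"
    by (intro tendsto_intros stair_LIMSEQ t real_tendsto_divide_at_top[OF tendsto_const] filterlim_real_sequentially)
  moreover have "\<exists>N'. \<forall>n\<ge>N'. ell (?a n / real n, ?b n / real n) \<le> ?a n / real n * d1 + ?b n / real n * d2 + K / real n"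
  proof (intro exI[of _ "max N 1"] allI impI)
    fix n assume n: "max N 1 \<le> n"
    have p: "ple 0 (stair t n)" using t by (intro ple_0_stair) auto
    have "real n * ell (?a n / real n, ?b n / real n) = ellv (stair t n)"
      using ell_scale[of "?a n / real n" "?b n / real n" n] n p by (simp add: ellv_def ple_def)
    also have "\<dots> \<le> EL (stair t n)" by (rule ellv_le_EL[OF p])
    also have "\<dots> \<le> ?a n * d1 + ?b n * d2 + K" using n by (intro bound) auto
    also have "\<dots> = real n * (?a n / real n * d1 + ?b n / real n * d2 + K / real n)"
      using n by (simp add: field_simps)
    finally show "ell (?a n / real n, ?b n / real n) \<le> ?a n / real n * d1 + ?b n / real n * d2 + K / real n"
      using n by simp
  qed
  ultimately have "ell (dr t) \<le> t * d1 + (1 - t) * d2 + 0" by (rule LIMSEQ_le)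
  then show ?thesis by simp
qed

lemma incr_measurable [measurable]: "(\<lambda>\<omega>. incr \<omega> x y v) \<in> borel_measurable M"
  unfolding incr_def by measurable

lemma phi_measurable [measurable]: "(\<lambda>\<omega>. phi \<omega> x y t) \<in> borel_measurable M"
  unfolding phi_def by measurable

lemma integrable_incr [simp]: "integrable M (\<lambda>\<omega>. incr \<omega> x y v)"
  unfolding incr_def by simp

text \<open>Fatou in a form that does not presuppose integrability of \<open>Y\<close>: the number
  \<open>c\<close> only has to be below the integral, which may be infinite.\<close>

lemma fatou_eventually:
  fixes f :: "nat \<Rightarrow> config \<Rightarrow> real"
  assumes f: "\<And>n. integrable M (f n)" "\<forall>\<^sub>F n in sequentially. \<forall>\<omega>. 0 \<le> f n \<omega>"
    and [measurable]: "Y \<in> borel_measurable M"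
    and lim: "AE \<omega> in M. \<forall>\<epsilon>>0. \<forall>\<^sub>F n in sequentially. Y \<omega> - \<epsilon> \<le> f n \<omega>"
    and c: "ennreal c < (\<integral>\<^sup>+\<omega>. ennreal (Y \<omega>) \<partial>M)"
  shows "\<forall>\<^sub>F n in sequentially. c < expectation (f n)"
proof -
  have [measurable]: "f n \<in> borel_measurable M" for n using f(1) by auto
  have "AE \<omega> in M. ennreal (Y \<omega>) \<le> liminf (\<lambda>n. ennreal (f n \<omega>))"
    using lim
  proof eventually_elim
    case (elim \<omega>)
    show ?case
    proof (rule ennreal_le_epsilon)
      fix e :: real assume e: "0 < e"
      then have "\<forall>\<^sub>F n in sequentially. Y \<omega> - e \<le> f n \<omega>" using elim by blast
      then have "ennreal (Y \<omega> - e) \<le> liminf (\<lambda>n. ennreal (f n \<omega>))"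
        by (intro Liminf_bounded) (auto elim!: eventually_mono intro: ennreal_leI)
      then have "ennreal (Y \<omega> - e) + ennreal e \<le> liminf (\<lambda>n. ennreal (f n \<omega>)) + ennreal e"
        by (rule add_right_mono)
      moreover have "ennreal (Y \<omega>) \<le> ennreal (Y \<omega> - e) + ennreal e"
        using ennreal_plus_if[of "Y \<omega> - e" e] e by (cases "Y \<omega> - e \<ge> 0") (auto simp: ennreal_neg intro: ennreal_leI)
      ultimately show "ennreal (Y \<omega>) \<le> liminf (\<lambda>n. ennreal (f n \<omega>)) + ennreal e" by (rule order_trans[rotated])
    qed
  qed
  then have "(\<integral>\<^sup>+\<omega>. ennreal (Y \<omega>) \<partial>M) \<le> (\<integral>\<^sup>+\<omega>. liminf (\<lambda>n. ennreal (f n \<omega>)) \<partial>M)"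
    by (rule nn_integral_mono_AE)
  also have "\<dots> \<le> liminf (\<lambda>n. \<integral>\<^sup>+\<omega>. ennreal (f n \<omega>) \<partial>M)"
    by (intro nn_integral_liminf) measurable
  finally have "ennreal c < liminf (\<lambda>n. \<integral>\<^sup>+\<omega>. ennreal (f n \<omega>) \<partial>M)" using c by (rule less_le_trans[rotated])
  from less_LiminfD[OF this] f(2) show ?thesis
  proof eventually_elim
    case (elim n)
    then have "ennreal c < ennreal (expectation (f n))"
      using f(1) by (simp add: nn_integral_eq_integral)
    moreover have "0 \<le> expectation (f n)" using elim by (intro integral_nonneg_AE) auto
    ultimately show ?case by (cases "c \<ge> 0") (auto simp: ennreal_less_iff ennreal_neg)
  qed
qed

definition Wm :: "bool \<Rightarrow> real" where
  "Wm b = expectation (\<lambda>\<omega>. W \<omega> (stepv b) (if b then 1 else 2))"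

text \<open>The triangle inequality through the neighbour. It makes weight minus increment
  nonnegative, which is what Fatou requires.\<close>

lemma incr_step_le:
  assumes "ple (stepv b) v"
  shows "incr \<omega> 0 (stepv b) v \<le> W \<omega> (stepv b) (if b then 1 else 2)"
proof -
  have "passage \<omega> 0 (stepv b) = W \<omega> (stepv b) (if b then 1 else 2)"
    using passage_step[of \<omega> 0] by (cases b) (auto simp: stepv_def W_def)
  then show ?thesis
    using passage_triangle[of 0 "stepv b" v \<omega>] assms ple_stepv[of 0 b] by (simp add: incr_def)
qed

lemma stair_ge_step:
  assumes t: "0 < t" "t < 1" shows "\<forall>\<^sub>F n in sequentially. ple (stepv b) (stair t n)"
proof -
  have "\<forall>\<^sub>F n in sequentially. ple (1, 1) (stair t n)"
    by (rule tends_dir_eventually_ge[OF tends_dir_stair[OF t] t])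
  then show ?thesis by eventually_elim (auto simp: ple_def)
qed

lemma AE_bounded_incr:
  assumes t: "0 < t" "t < 1"
  shows "AE \<omega> in M. \<exists>c d. (\<forall>\<^sub>F n in sequentially. c \<le> incr \<omega> 0 (stepv b) (stair t n)) \<and>
    (\<forall>\<^sub>F n in sequentially. incr \<omega> 0 (stepv b) (stair t n) \<le> d)"
  using dir_ordered_AE
proof eventually_elim
  case (elim \<omega>)
  show ?case
  proof (cases b)
    case True
    have "dir_ordered \<omega> 0 (stepv b)" using elim[rule_format, of 0] True by (simp add: stepv_def)
    from incr_eventually_bounded[OF this t tends_dir_stair[OF t]] show ?thesis by blast
  next
    case False
    have "dir_ordered \<omega> (stepv b) 0" using elim[rule_format, of 0] False by (simp add: stepv_def)
    from incr_eventually_bounded[OF this t tends_dir_stair[OF t]]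
    obtain c d where "\<forall>\<^sub>F n in sequentially. c \<le> - incr \<omega> 0 (stepv b) (stair t n)"
        "\<forall>\<^sub>F n in sequentially. - incr \<omega> 0 (stepv b) (stair t n) \<le> d"
      by (auto simp: incr_def)
    then have "\<forall>\<^sub>F n in sequentially. - d \<le> incr \<omega> 0 (stepv b) (stair t n)"
        "\<forall>\<^sub>F n in sequentially. incr \<omega> 0 (stepv b) (stair t n) \<le> - c"
      by (simp_all add: minus_le_iff le_minus_iff)
    then show ?thesis by blast
  qed
qed

lemma phi_limsup_AE:
  assumes t: "0 < t" "t < 1"
  shows "AE \<omega> in M. (\<forall>\<epsilon>>0. \<forall>\<^sub>F n in sequentially. incr \<omega> 0 (stepv b) (stair t n) \<le> phi \<omega> 0 (stepv b) t + \<epsilon>) \<and>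
    phi \<omega> 0 (stepv b) t \<le> W \<omega> (stepv b) (if b then 1 else 2)"
  using AE_bounded_incr[OF t, of b]
proof eventually_elim
  case (elim \<omega>)
  let ?f = "\<lambda>n. incr \<omega> 0 (stepv b) (stair t n)"
  obtain c d where c: "\<forall>\<^sub>F n in sequentially. c \<le> ?f n" and d: "\<forall>\<^sub>F n in sequentially. ?f n \<le> d"
    using elim by blast
  have eq: "limsup (\<lambda>n. ereal (?f n)) = ereal (phi \<omega> 0 (stepv b) t)"
    unfolding phi_def using real_limsup_bounds(1)[OF c d] by simp
  have "\<forall>\<^sub>F n in sequentially. ?f n \<le> phi \<omega> 0 (stepv b) t + \<epsilon>" if "\<epsilon> > 0" for \<epsilon>
  proof -
    have "limsup (\<lambda>n. ereal (?f n)) < ereal (phi \<omega> 0 (stepv b) t + \<epsilon>)" using that by (simp add: eq)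
    then have "\<forall>\<^sub>F n in sequentially. ereal (?f n) < ereal (phi \<omega> 0 (stepv b) t + \<epsilon>)"
      by (rule Limsup_lessD)
    then show ?thesis by eventually_elim simp
  qed
  moreover have "phi \<omega> 0 (stepv b) t \<le> W \<omega> (stepv b) (if b then 1 else 2)"
    unfolding phi_def using stair_ge_step[OF t, of b]
    by (intro real_limsup_bounds(3)[OF c]) (rule eventually_mono[OF _ incr_step_le])
  ultimately show ?case by blast
qed

text \<open>Fatou is applied to weight minus increment on both edges at the origin. Lower bounds for
  the means of \<open>f\<close> are upper bounds for mean increments of \<open>EL\<close>, which
  cannot both be small because they accumulate to \<open>ell\<close> along the staircase.
  Integrability and the mean inequality come from this one estimate.\<close>

lemma phi_integrable_mean:
  assumes t: "0 < t" "t < 1"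
  shows "integrable M (\<lambda>\<omega>. phi \<omega> 0 e1 t)" "integrable M (\<lambda>\<omega>. phi \<omega> 0 e2 t)"
    and "ell (dr t) \<le> t * expectation (\<lambda>\<omega>. phi \<omega> 0 e1 t) + (1 - t) * expectation (\<lambda>\<omega>. phi \<omega> 0 e2 t)"
proof -
  define w where "w b \<omega> = W \<omega> (stepv b) (if b then 1 else 2)" for b \<omega>
  define Y where "Y b \<omega> = w b \<omega> - phi \<omega> 0 (stepv b) t" for b \<omega>
  define f where "f b n \<omega> = w b \<omega> - incr \<omega> 0 (stepv b) (stair t n)" for b n \<omega>
  have w_int [simp]: "integrable M (w b)" for b
    unfolding w_def[abs_def] by (rule sq_integrable_imp_integrable[OF sq_integrable_W])
  have w_meas [measurable]: "w b \<in> borel_measurable M" for b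
    unfolding w_def[abs_def] by measurable
  have f_int: "integrable M (f b n)" for b n unfolding f_def[abs_def] by simp
  have f0: "\<forall>\<^sub>F n in sequentially. \<forall>\<omega>. 0 \<le> f b n \<omega>" for b
    using stair_ge_step[OF t, of b]
  proof eventually_elim
    case (elim n)
    then show ?case using incr_step_le[OF elim] by (simp add: f_def w_def)
  qed
  have Y_meas [measurable]: "Y b \<in> borel_measurable M" for b unfolding Y_def[abs_def] by measurable
  have lim: "AE \<omega> in M. \<forall>\<epsilon>>0. \<forall>\<^sub>F n in sequentially. Y b \<omega> - \<epsilon> \<le> f b n \<omega>" for b
    using phi_limsup_AE[OF t, of b]
  proof eventually_elim
    case (elim \<omega>)
    show ?case
    proof (intro allI impI)
      fix \<epsilon> :: real assume "\<epsilon> > 0"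
      then have "\<forall>\<^sub>F n in sequentially. incr \<omega> 0 (stepv b) (stair t n) \<le> phi \<omega> 0 (stepv b) t + \<epsilon>"
        using elim by blast
      then show "\<forall>\<^sub>F n in sequentially. Y b \<omega> - \<epsilon> \<le> f b n \<omega>"
        by eventually_elim (simp add: Y_def f_def)
    qed
  qed
  have Y0: "AE \<omega> in M. 0 \<le> Y b \<omega>" for b
    using phi_limsup_AE[OF t, of b] by eventually_elim (simp add: Y_def w_def)
  have Ef: "expectation (f b n) = Wm b - (EL (stair t n) - EL (stair t n - stepv b))" for b n
  proof -
    have "expectation (f b n) = expectation (w b) - expectation (\<lambda>\<omega>. incr \<omega> 0 (stepv b) (stair t n))"
      unfolding f_def[abs_def] by simp
    also have "expectation (\<lambda>\<omega>. incr \<omega> 0 (stepv b) (stair t n)) = EL (stair t n) - EL (stair t n - stepv b)"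
      unfolding incr_def by (simp add: expectation_passage)
    finally show ?thesis by (simp add: Wm_def w_def[abs_def])
  qed
  \<comment> \<open>The bounds \<open>c True\<close> and \<open>c False\<close> are free: with one
    of them large the inequality shows that the integrals are finite, with both just below the means
    it gives the last claim.\<close>
  have key: "t * c True + (1 - t) * c False \<le> t * Wm True + (1 - t) * Wm False - ell (dr t)"
    if c: "\<And>b. c b < 0 \<or> c b = 0 \<or> ennreal (c b) < (\<integral>\<^sup>+\<omega>. ennreal (Y b \<omega>) \<partial>M)" for c :: "bool \<Rightarrow> real"
  proof -
    have ev: "\<forall>\<^sub>F n in sequentially. EL (stair t n) - EL (stair t n - stepv b) \<le> Wm b - c b" for b
    proof (cases "c b \<le> 0")
      case True
      from f0[of b] show ?thesis
      proof eventually_elim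
        case (elim n)
        then have "0 \<le> expectation (f b n)" by (intro integral_nonneg_AE) auto
        then show ?case using True by (simp add: Ef)
      qed
    next
      case False
      then have "ennreal (c b) < (\<integral>\<^sup>+\<omega>. ennreal (Y b \<omega>) \<partial>M)" using c[of b] by auto
      from fatou_eventually[OF f_int f0 Y_meas lim this] show ?thesis
        by eventually_elim (simp add: Ef)
    qed
    have "ell (dr t) \<le> t * (Wm True - c True) + (1 - t) * (Wm False - c False)"
      using ev[of True] ev[of False] by (intro ell_le_of_increments t) (simp_all add: stepv_def)
    then show ?thesis by (simp add: algebra_simps)
  qed
  define R where "R = t * Wm True + (1 - t) * Wm False - ell (dr t)"
  have fin: "(\<integral>\<^sup>+\<omega>. ennreal (Y b \<omega>) \<partial>M) < \<infinity>" for b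
  proof (rule ccontr)
    assume "\<not> ?thesis"
    then have inf: "(\<integral>\<^sup>+\<omega>. ennreal (Y b \<omega>) \<partial>M) = \<infinity>" by (simp add: top.not_eq_extremum[symmetric])
    \<comment> \<open>Both \<open>t k\<close> and \<open>(1 - t) k\<close> are at least
      \<open>\<bar>R\<bar> + 1\<close>, so either one contradicts \<open>key\<close>.\<close>
    define k where "k = (\<bar>R\<bar> + 1) / min t (1 - t)"
    have m: "0 < min t (1 - t)" using t by simp
    have k: "k > 0" using m by (simp add: k_def)
    define c where "c b' = (if b' = b then k else 0)" for b'
    have "t * c True + (1 - t) * c False \<le> R"
      unfolding R_def by (rule key) (auto simp: c_def inf)
    moreover have "\<bar>R\<bar> + 1 \<le> t * k" "\<bar>R\<bar> + 1 \<le> (1 - t) * k"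
    proof -
      have mk: "min t (1 - t) * k = \<bar>R\<bar> + 1" 
        using m unfolding k_def by (metis less_irrefl nonzero_mult_div_cancel_left times_divide_eq_right)
      show "\<bar>R\<bar> + 1 \<le> t * k" "\<bar>R\<bar> + 1 \<le> (1 - t) * k"
        unfolding mk[symmetric] using k by (intro mult_right_mono; simp)+
    qed
    ultimately show False by (cases b) (auto simp: c_def)
  qed
  have Y_int: "integrable M (Y b)" for b
    by (rule integrableI_nonneg[OF Y_meas Y0 fin])
  have phi_eq: "phi \<omega> 0 (stepv b) t = w b \<omega> - Y b \<omega>" for b \<omega> by (simp add: Y_def)
  have int: "integrable M (\<lambda>\<omega>. phi \<omega> 0 (stepv b) t)" for b
    unfolding phi_eq using Y_int by simp
  then show "integrable M (\<lambda>\<omega>. phi \<omega> 0 e1 t)" "integrable M (\<lambda>\<omega>. phi \<omega> 0 e2 t)"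
    using int[of True] int[of False] by (simp_all add: stepv_def)
  have EY: "expectation (Y b) = Wm b - expectation (\<lambda>\<omega>. phi \<omega> 0 (stepv b) t)" for b
  proof -
    have "Wm b = expectation (w b)" by (simp only: Wm_def w_def[abs_def])
    then show ?thesis unfolding Y_def[abs_def] using int by simp
  qed
  have "t * expectation (Y True) + (1 - t) * expectation (Y False) \<le> R + \<epsilon>" if \<epsilon>: "\<epsilon> > 0" for \<epsilon>
  proof -
    have nn: "(\<integral>\<^sup>+\<omega>. ennreal (Y b \<omega>) \<partial>M) = ennreal (expectation (Y b))" for b
      by (rule nn_integral_eq_integral[OF Y_int Y0])
    have "t * (expectation (Y True) - \<epsilon>) + (1 - t) * (expectation (Y False) - \<epsilon>) \<le> R"
      unfolding R_def
    proof (rule key[of "\<lambda>b. expectation (Y b) - \<epsilon>"])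
      fix b
      show "expectation (Y b) - \<epsilon> < 0 \<or> expectation (Y b) - \<epsilon> = 0 \<or>
          ennreal (expectation (Y b) - \<epsilon>) < (\<integral>\<^sup>+\<omega>. ennreal (Y b \<omega>) \<partial>M)"
        unfolding nn using \<epsilon> by (auto simp: ennreal_less_iff not_less)
    qed
    then show ?thesis by (simp add: algebra_simps)
  qed
  then have "t * expectation (Y True) + (1 - t) * expectation (Y False) \<le> R"
    by (rule field_le_epsilon)
  then show "ell (dr t) \<le> t * expectation (\<lambda>\<omega>. phi \<omega> 0 e1 t) + (1 - t) * expectation (\<lambda>\<omega>. phi \<omega> 0 e2 t)"
    unfolding EY by (simp add: R_def stepv_def algebra_simps)
qed

section \<open>Means of the increments as gradients of the time constant\<close>

definition mean1 :: "real \<Rightarrow> real" where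
  "mean1 t = expectation (\<lambda>\<omega>. phi \<omega> 0 e1 t)"

text \<open>The vertical edge is read from \<open>e2\<close> to \<open>0\<close>, so that both means
  increase with the direction; the mean of \<open>B(0, e2)\<close> is therefore
  \<open>- mean2\<close>.\<close>

definition mean2 :: "real \<Rightarrow> real" where
  "mean2 t = expectation (\<lambda>\<omega>. phi \<omega> e2 0 t)"

text \<open>Reversing the edge turns a limsup into minus a liminf, so the two orientations of
  \<open>phi\<close> can be compared only after moving the direction a little.\<close>

lemma phi_reverse_AE:
  assumes "0 < s" "s < t" "t < s'" "s' < 1"
  shows "AE \<omega> in M. - phi \<omega> e2 0 s' \<le> phi \<omega> 0 e2 t \<and> phi \<omega> 0 e2 t \<le> - phi \<omega> e2 0 s"
  using dir_ordered_AE
proof eventually_elim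
  case (elim \<omega>)
  have ord: "dir_ordered \<omega> e2 0" using elim[rule_format, of 0] by simp
  have v: "tends_dir (stair t) (dr t)" using assms by (intro tends_dir_stair) auto
  have "\<forall>\<^sub>F n in sequentially. phi \<omega> e2 0 s \<le> incr \<omega> e2 0 (stair t n)"
    using assms by (intro phi_le_incr[OF ord _ _ _ v]) auto
  then have 1: "\<forall>\<^sub>F n in sequentially. incr \<omega> 0 e2 (stair t n) \<le> - phi \<omega> e2 0 s"
    by (auto simp: incr_def elim!: eventually_mono)
  have "\<forall>\<^sub>F n in sequentially. incr \<omega> e2 0 (stair t n) \<le> phi \<omega> e2 0 s'"
    using assms by (intro incr_le_phi[OF ord _ _ _ v]) auto
  then have 2: "\<forall>\<^sub>F n in sequentially. - phi \<omega> e2 0 s' \<le> incr \<omega> 0 e2 (stair t n)"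
    by (auto simp: incr_def elim!: eventually_mono)
  show ?case unfolding phi_def[of _ 0] using real_limsup_bounds(2,3)[OF 2 1] by simp
qed

lemma phi_integrable:
  assumes t: "0 < t" "t < 1"
  shows "integrable M (\<lambda>\<omega>. phi \<omega> 0 e1 t)" "integrable M (\<lambda>\<omega>. phi \<omega> e2 0 t)"
proof -
  show "integrable M (\<lambda>\<omega>. phi \<omega> 0 e1 t)" by (rule phi_integrable_mean[OF t])
  define s s' where "s = t / 2" and "s' = (t + 1) / 2"
  have s: "0 < s" "s < t" "t < s'" "s' < 1" using t by (auto simp: s_def s'_def)
  have 1: "AE \<omega> in M. phi \<omega> 0 e2 s' \<le> - phi \<omega> e2 0 t"
    using phi_reverse_AE[of t s' "(s' + 1) / 2"] s t by (auto elim!: eventually_mono)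
  have 2: "AE \<omega> in M. - phi \<omega> e2 0 t \<le> phi \<omega> 0 e2 s"
    using phi_reverse_AE[of "s / 2" s t] s t by (auto elim!: eventually_mono)
  have "integrable M (\<lambda>\<omega>. \<bar>phi \<omega> 0 e2 s'\<bar> + \<bar>phi \<omega> 0 e2 s\<bar>)"
    using s t by (intro Bochner_Integration.integrable_add integrable_abs phi_integrable_mean(2)) auto
  then show "integrable M (\<lambda>\<omega>. phi \<omega> e2 0 t)"
  proof (rule Bochner_Integration.integrable_bound)
    show "AE \<omega> in M. norm (phi \<omega> e2 0 t) \<le> norm (\<bar>phi \<omega> 0 e2 s'\<bar> + \<bar>phi \<omega> 0 e2 s\<bar>)"
      using 1 2 by eventually_elim auto
  qed measurable
qed

text \<open>As the auxiliary direction tends to \<open>t\<close> from the left, continuity of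
  \<open>mean2\<close> removes the discrepancy between the two orientations.\<close>

lemma ell_le_means:
  assumes t: "0 < t" "t < 1" and c: "isCont mean2 t"
  shows "ell (dr t) \<le> t * mean1 t - (1 - t) * mean2 t"
proof -
  let ?h = "expectation (\<lambda>\<omega>. phi \<omega> 0 e2 t)"
  have "?h \<le> - mean2 s" if "0 < s" "s < t" for s
  proof -
    have "?h \<le> expectation (\<lambda>\<omega>. - phi \<omega> e2 0 s)"
    proof (rule integral_mono_AE)
      show "AE \<omega> in M. phi \<omega> 0 e2 t \<le> - phi \<omega> e2 0 s"
        using phi_reverse_AE[of s t "(t + 1) / 2"] that t by (auto elim!: eventually_mono)
      show "integrable M (\<lambda>\<omega>. phi \<omega> 0 e2 t)" by (rule phi_integrable_mean[OF t])
      show "integrable M (\<lambda>\<omega>. - phi \<omega> e2 0 s)" using phi_integrable(2)[of s] that t by simp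
    qed
    then show ?thesis by (simp add: mean2_def)
  qed
  then have "\<forall>\<^sub>F s in at_left t. mean2 s \<le> - ?h"
    using t by (intro eventually_at_leftI[of 0 t]) (auto simp: le_minus_iff)
  moreover have "(mean2 \<longlongrightarrow> mean2 t) (at_left t)"
    using c by (simp add: isCont_def filterlim_at_split)
  ultimately have "mean2 t \<le> - ?h" by (intro tendsto_upperbound) auto
  then have "(1 - t) * ?h \<le> (1 - t) * - mean2 t" using t by (intro mult_left_mono) auto
  then show ?thesis using phi_integrable_mean(3)[OF t] by (simp add: mean1_def)
qed

lemma mean_mono:
  assumes "0 < s" "s \<le> t" "t < 1" shows "mean1 s \<le> mean1 t" "mean2 s \<le> mean2 t"
proof -
  have "AE \<omega> in M. phi \<omega> 0 e1 s \<le> phi \<omega> 0 e1 t \<and> phi \<omega> e2 0 s \<le> phi \<omega> e2 0 t"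
    using dir_ordered_AE
  proof eventually_elim
    case (elim \<omega>)
    have "dir_ordered \<omega> 0 e1" "dir_ordered \<omega> e2 0" using elim[rule_format, of 0] by simp_all
    then show ?case using phi_mono assms by blast
  qed
  then show "mean1 s \<le> mean1 t" "mean2 s \<le> mean2 t"
    unfolding mean1_def mean2_def using assms by (intro integral_mono_AE phi_integrable; auto elim!: eventually_mono)+
qed

text \<open>The jump of a monotone random function is nonnegative, and continuity of the mean makes
  its expectation zero. Markov's inequality carries this out for directions
  \<open>s m < t < s' m\<close> with small mean difference.\<close>

lemma AE_isCont_phi:
  assumes ord: "AE \<omega> in M. dir_ordered \<omega> x y"
    and int: "\<And>s. 0 < s \<Longrightarrow> s < 1 \<Longrightarrow> integrable M (\<lambda>\<omega>. phi \<omega> x y s)"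
    and mono: "\<And>s t. 0 < s \<Longrightarrow> s \<le> t \<Longrightarrow> t < 1 \<Longrightarrow>
      expectation (\<lambda>\<omega>. phi \<omega> x y s) \<le> expectation (\<lambda>\<omega>. phi \<omega> x y t)"
    and t: "0 < t" "t < 1" and c: "isCont (\<lambda>t. expectation (\<lambda>\<omega>. phi \<omega> x y t)) t"
  shows "AE \<omega> in M. isCont (phi \<omega> x y) t"
proof -
  have h: "\<forall>\<epsilon>>0. \<exists>s s'. 0 < s \<and> s < t \<and> t < s' \<and> s' < 1 \<and>
      expectation (\<lambda>\<omega>. phi \<omega> x y s') - expectation (\<lambda>\<omega>. phi \<omega> x y s) < \<epsilon>"
    using c mono_isCont_iff[where f = "\<lambda>t. expectation (\<lambda>\<omega>. phi \<omega> x y t)", OF mono t] by blast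
  have "\<forall>m::nat. \<exists>s s'. 0 < s \<and> s < t \<and> t < s' \<and> s' < 1 \<and>
      expectation (\<lambda>\<omega>. phi \<omega> x y s') - expectation (\<lambda>\<omega>. phi \<omega> x y s) < inverse (real (Suc m))"
    by (intro allI h[rule_format]) simp
  then obtain s s' where s: "\<And>m. 0 < s m" "\<And>m. s m < t" "\<And>m. t < s' m" "\<And>m. s' m < 1"
    and E: "\<And>m. expectation (\<lambda>\<omega>. phi \<omega> x y (s' m)) - expectation (\<lambda>\<omega>. phi \<omega> x y (s m)) < inverse (real (Suc m))"
    by metis
  define D where "D m \<omega> = phi \<omega> x y (s' m) - phi \<omega> x y (s m)" for m \<omega>
  have [measurable]: "D m \<in> borel_measurable M" for m unfolding D_def[abs_def] by measurable
  have s1: "s m < 1" "0 < s' m" for m using s[of m] t by linarith+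
  have D_int: "integrable M (D m)" for m
    unfolding D_def[abs_def] using s s1 by (intro Bochner_Integration.integrable_diff int)
  have D0: "AE \<omega> in M. 0 \<le> D m \<omega>" for m
    using ord
  proof eventually_elim
    case (elim \<omega>)
    have "s m \<le> s' m" using s[of m] by linarith
    then show ?case using phi_mono[OF elim s(1) _ s(4)] by (simp add: D_def)
  qed
  have ED: "expectation (D m) < inverse (real (Suc m))" for m
    unfolding D_def[abs_def] using E[of m] s s1 by (subst Bochner_Integration.integral_diff) (auto intro: int)
  have "AE \<omega> in M. \<forall>k::nat. \<exists>m. D m \<omega> < inverse (real (Suc k))"
    unfolding AE_all_countable
  proof
    fix k :: nat
    let ?e = "inverse (real (Suc k))"
    let ?A = "{\<omega>\<in>space M. \<forall>m. ?e \<le> D m \<omega>}"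
    have A: "?A \<in> events" by measurable
    have "prob ?A \<le> expectation (D m) / ?e" for m
    proof -
      have "prob ?A \<le> prob {\<omega>\<in>space M. ?e \<le> D m \<omega>}"
      proof (rule finite_measure_mono)
        show "{\<omega>\<in>space M. ?e \<le> D m \<omega>} \<in> events" by measurable
      qed auto
      also have "\<dots> \<le> expectation (D m) / ?e"
        by (intro integral_Markov_inequality_measure[of _ _ "{}"] D_int D0) auto
      finally show ?thesis .
    qed
    then have le: "prob ?A \<le> inverse (real (Suc m)) * real (Suc k)" for m
      using less_imp_le[OF mult_strict_right_mono[OF ED[of m], of "real (Suc k)"]]
      by (intro order_trans[OF \<open>\<And>m. prob ?A \<le> expectation (D m) / ?e\<close>[of m]]) (simp add: field_simps)
    have lim0: "(\<lambda>m. inverse (real (Suc m)) * real (Suc k)) \<longlonglongrightarrow> 0"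
      using tendsto_mult_right[OF LIMSEQ_inverse_real_of_nat, of "real (Suc k)"] by simp
    have "prob ?A \<le> 0" by (rule LIMSEQ_le_const[OF lim0]) (use le in blast)
    then have "prob ?A = 0" using measure_nonneg[of M ?A] by linarith
    then have "?A \<in> null_sets M" using A by (simp add: emeasure_eq_measure null_sets_def)
    then have "AE \<omega> in M. \<omega> \<notin> ?A" by (rule AE_not_in)
    then show "AE \<omega> in M. \<exists>m. D m \<omega> < ?e" by eventually_elim (auto simp: not_le)
  qed
  with ord show ?thesis
  proof eventually_elim
    case (elim \<omega>)
    show ?case unfolding isCont_phi_iff[OF elim(1) t]
    proof (intro allI impI)
      fix \<epsilon> :: real assume "\<epsilon> > 0"
      then obtain k where k: "inverse (real (Suc k)) < \<epsilon>" using reals_Archimedean by blast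
      obtain m where "D m \<omega> < inverse (real (Suc k))" using elim(2) by blast
      then show "\<exists>s s'. 0 < s \<and> s < t \<and> t < s' \<and> s' < 1 \<and> phi \<omega> x y s' - phi \<omega> x y s < \<epsilon>"
        using s k by (intro exI[of _ "s m"] exI[of _ "s' m"]) (auto simp: D_def)
    qed
  qed
qed

text \<open>By monotonicity all but countably many directions are regular;
  \<open>regular_all\<close> removes the exceptions afterwards.\<close>

definition regular :: "real \<Rightarrow> bool" where
  "regular t \<longleftrightarrow> 0 < t \<and> t < 1 \<and> isCont mean1 t \<and> isCont mean2 t"

lemma regular_cont_AE:
  assumes "regular t"
  shows "AE \<omega> in M. (\<forall>x y. adj x y \<longrightarrow> dir_ordered \<omega> x y) \<and> cont_at \<omega> t"
proof -
  have t: "0 < t" "t < 1" using assms by (auto simp: regular_def)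
  have o: "AE \<omega> in M. dir_ordered \<omega> 0 e1 \<and> dir_ordered \<omega> e2 0"
    using dir_ordered_AE by eventually_elim (metis add_0)
  have "AE \<omega> in M. isCont (phi \<omega> 0 e1) t"
    using o assms mean_mono(1) phi_integrable(1) unfolding regular_def mean1_def
    by (intro AE_isCont_phi t) (auto elim!: eventually_mono)
  moreover have "AE \<omega> in M. isCont (phi \<omega> e2 0) t"
    using o assms mean_mono(2) phi_integrable(2) unfolding regular_def mean2_def
    by (intro AE_isCont_phi t) (auto elim!: eventually_mono)
  ultimately have "AE \<omega> in M. (dir_ordered \<omega> 0 e1 \<and> dir_ordered \<omega> e2 0) \<and>
      isCont (phi \<omega> 0 e1) t \<and> isCont (phi \<omega> e2 0) t"
    using o by eventually_elim simp
  then have "AE \<omega> in M. \<forall>z. (dir_ordered (shift z \<omega>) 0 e1 \<and> dir_ordered (shift z \<omega>) e2 0) \<and>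
      isCont (phi (shift z \<omega>) 0 e1) t \<and> isCont (phi (shift z \<omega>) e2 0) t"
    unfolding AE_all_countable by (intro allI AE_shift)
  then show ?thesis
  proof eventually_elim
    case (elim \<omega>)
    have 1: "dir_ordered \<omega> z (z + e1)" "isCont (phi \<omega> z (z + e1)) t" for z
      using elim[rule_format, of z] dir_ordered_shift[of z \<omega> 0 e1] isCont_phi_shift[of z \<omega> 0 e1 t] t
      by (simp_all add: add.commute)
    have 2: "dir_ordered \<omega> (z + e2) z" "isCont (phi \<omega> (z + e2) z) t" for z
      using elim[rule_format, of z] dir_ordered_shift[of z \<omega> e2 0] isCont_phi_shift[of z \<omega> e2 0 t] t
      by (simp_all add: add.commute)
    show ?case using 1 2 unfolding cont_at_def adj_def by blast
  qed
qed

text \<open>At a regular direction \<open>phi\<close> is almost surely the limit along every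
  sequence, in particular along the translated staircase.\<close>

lemma regular_phi_shift_AE:
  assumes r: "regular t" and a: "adj x y"
  shows "AE \<omega> in M. phi \<omega> (x + z) (y + z) t = phi (shift z \<omega>) x y t"
  using regular_cont_AE[OF r] AE_shift[OF regular_cont_AE[OF r], of z]
proof eventually_elim
  case (elim \<omega>)
  have t: "0 < t" "t < 1" using r by (auto simp: regular_def)
  have a': "adj (x + z) (y + z)" using a by (auto simp: adj_def ac_simps)
  have "(\<lambda>n. incr \<omega> (x + z) (y + z) (stair t n + z)) \<longlonglongrightarrow> phi \<omega> (x + z) (y + z) t"
    using elim(1) a' t unfolding cont_at_adj
    by (intro incr_tendsto_phi tends_dir_shift tends_dir_stair) blast+
  moreover have "(\<lambda>n. incr (shift z \<omega>) x y (stair t n)) \<longlonglongrightarrow> phi (shift z \<omega>) x y t"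
    using elim(2) a t unfolding cont_at_adj
    by (intro incr_tendsto_phi tends_dir_stair) blast+
  ultimately show ?case unfolding incr_shift by (rule LIMSEQ_unique)
qed

lemma regular_phi_mean:
  assumes r: "regular t"
  shows "integrable M (\<lambda>\<omega>. phi \<omega> x (x + e1) t)" "expectation (\<lambda>\<omega>. phi \<omega> x (x + e1) t) = mean1 t"
    "integrable M (\<lambda>\<omega>. phi \<omega> (x + e2) x t)" "expectation (\<lambda>\<omega>. phi \<omega> (x + e2) x t) = mean2 t"
proof -
  have t: "0 < t" "t < 1" using r by (auto simp: regular_def)
  have m: "(\<lambda>\<omega>. phi (shift x \<omega>) y z t) \<in> borel_measurable M" for y z
    by (rule measurable_compose[OF shift_measurable phi_measurable])
  have 1: "AE \<omega> in M. phi \<omega> x (x + e1) t = phi (shift x \<omega>) 0 e1 t"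
    using regular_phi_shift_AE[OF r, of 0 e1 x] by (simp add: adj_def add.commute)
  have 2: "AE \<omega> in M. phi \<omega> (x + e2) x t = phi (shift x \<omega>) e2 0 t"
    using regular_phi_shift_AE[OF r, of e2 0 x] by (simp add: adj_def add.commute)
  show "integrable M (\<lambda>\<omega>. phi \<omega> x (x + e1) t)"
    using integrable_cong_AE[OF _ m 1] phi_integrable(1)[OF t] integrable_shift_iff[of "\<lambda>\<omega>. phi \<omega> 0 e1 t" x] by simp
  show "integrable M (\<lambda>\<omega>. phi \<omega> (x + e2) x t)"
    using integrable_cong_AE[OF _ m 2] phi_integrable(2)[OF t] integrable_shift_iff[of "\<lambda>\<omega>. phi \<omega> e2 0 t" x] by simp
  show "expectation (\<lambda>\<omega>. phi \<omega> x (x + e1) t) = mean1 t"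
    using integral_cong_AE[OF _ m 1] integral_shift[of "\<lambda>\<omega>. phi \<omega> 0 e1 t" x] by (simp add: mean1_def)
  show "expectation (\<lambda>\<omega>. phi \<omega> (x + e2) x t) = mean2 t"
    using integral_cong_AE[OF _ m 2] integral_shift[of "\<lambda>\<omega>. phi \<omega> e2 0 t" x] by (simp add: mean2_def)
qed

text \<open>The limiting increments along an L-shaped path telescope to the increment between its
  end points, which is at most the passage time; each edge contributes the mean of its translate at
  the origin.\<close>

lemma mean_le_EL:
  assumes r: "regular t"
  shows "real k1 * mean1 t - real k2 * mean2 t \<le> EL (int k1, int k2)"
proof -
  have t: "0 < t" "t < 1" using r by (auto simp: regular_def)
  define S where "S \<omega> = (\<Sum>i<k1. phi \<omega> (int i, 0) ((int i, 0) + e1) t)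
    - (\<Sum>j<k2. phi \<omega> ((int k1, int j) + e2) (int k1, int j) t)" for \<omega>
  note m = regular_phi_mean[OF r]
  have S_int: "integrable M S" unfolding S_def[abs_def]
    by (intro Bochner_Integration.integrable_diff Bochner_Integration.integrable_sum m)
  have S_mean: "expectation S = real k1 * mean1 t - real k2 * mean2 t"
    unfolding S_def[abs_def]
    by (subst Bochner_Integration.integral_diff)
      (auto simp: Bochner_Integration.integral_sum m intro!: Bochner_Integration.integrable_sum)
  have "AE \<omega> in M. S \<omega> \<le> passage \<omega> 0 (int k1, int k2)"
    using regular_cont_AE[OF r]
  proof eventually_elim
    case (elim \<omega>)
    have lim: "(\<lambda>n. incr \<omega> x y (stair t n)) \<longlonglongrightarrow> phi \<omega> x y t" if "adj x y" for x y
      using elim that t unfolding cont_at_adj by (intro incr_tendsto_phi tends_dir_stair) blast+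
    have 1: "(\<Sum>i<k. incr \<omega> (int i, 0) ((int i, 0) + e1) v) = incr \<omega> 0 (int k, 0) v" for k v
      by (induction k) (auto simp: incr_def e1_def zero_prod_def algebra_simps)
    have 2: "(\<Sum>j<k. incr \<omega> ((int k1, int j) + e2) (int k1, int j) v) = - incr \<omega> (int k1, 0) (int k1, int k) v" for k v
      by (induction k) (auto simp: incr_def e2_def algebra_simps)
    have "(\<lambda>n. (\<Sum>i<k1. incr \<omega> (int i, 0) ((int i, 0) + e1) (stair t n))
      - (\<Sum>j<k2. incr \<omega> ((int k1, int j) + e2) (int k1, int j) (stair t n))) \<longlonglongrightarrow> S \<omega>"
      unfolding S_def by (intro tendsto_diff tendsto_sum lim) (auto simp: adj_def)
    then have "(\<lambda>n. incr \<omega> 0 (int k1, int k2) (stair t n)) \<longlonglongrightarrow> S \<omega>"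
      unfolding 1 2 by (simp add: incr_def)
    moreover have "\<forall>\<^sub>F n in sequentially. incr \<omega> 0 (int k1, int k2) (stair t n) \<le> passage \<omega> 0 (int k1, int k2)"
      using tends_dir_eventually_ge[OF tends_dir_stair[OF t] t, of "int k1" "int k2"]
    proof eventually_elim
      case (elim n)
      have "ple 0 (int k1, int k2)" by (simp add: ple_def)
      then show ?case using passage_triangle[OF _ elim, of 0 \<omega>] by (simp add: incr_def)
    qed
    ultimately show ?case by (intro tendsto_upperbound) auto
  qed
  then have "expectation S \<le> expectation (\<lambda>\<omega>. passage \<omega> 0 (int k1, int k2))"
    by (intro integral_mono_AE S_int integrable_passage)
  then show ?thesis by (simp add: S_mean EL_def)
qed

lemma mean_le_ell:
  assumes r: "regular t" and ab: "0 < a" "0 < b"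
  shows "a * mean1 t - b * mean2 t \<le> ell (a, b)"
proof -
  have int: "real k1 * mean1 t - real k2 * mean2 t \<le> ellv (int k1, int k2)" for k1 k2
  proof (rule field_le_epsilon)
    fix e :: real assume "e > 0"
    have p: "ple 0 (int k1, int k2)" by (simp add: ple_def)
    obtain i :: nat where i: "i > 0" "EL (sc (i\<^sup>2) (int k1, int k2)) \<le> real (i\<^sup>2) * (ellv (int k1, int k2) + e)"
      using eventually_happens[OF eventually_conj[OF eventually_gt_at_top[of 0] EL_eventually_le[OF p \<open>e > 0\<close>]]]
      by auto
    have "real (i\<^sup>2) * (real k1 * mean1 t - real k2 * mean2 t) = real (i\<^sup>2 * k1) * mean1 t - real (i\<^sup>2 * k2) * mean2 t"
      by (simp add: algebra_simps)
    also have "\<dots> \<le> EL (int (i\<^sup>2 * k1), int (i\<^sup>2 * k2))" by (rule mean_le_EL[OF r])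
    also have "(int (i\<^sup>2 * k1), int (i\<^sup>2 * k2)) = sc (i\<^sup>2) (int k1, int k2)" by (simp add: sc_def)
    finally have "real (i\<^sup>2) * (real k1 * mean1 t - real k2 * mean2 t) \<le> real (i\<^sup>2) * (ellv (int k1, int k2) + e)"
      using i by linarith
    then show "real k1 * mean1 t - real k2 * mean2 t \<le> ellv (int k1, int k2) + e"
      using i(1) by (simp only: mult_le_cancel_left_pos of_nat_0_less_iff zero_less_power)
  qed
  let ?A = "\<lambda>n. real_of_int \<lfloor>real n * a\<rfloor> / real n" and ?B = "\<lambda>n. real_of_int \<lfloor>real n * b\<rfloor> / real n"
  have "(\<lambda>n. ?A n * mean1 t - ?B n * mean2 t) \<longlonglongrightarrow> a * mean1 t - b * mean2 t"
    by (intro tendsto_intros floor_mult_LIMSEQ)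
  moreover have "(\<lambda>n. ell (?A n, ?B n)) \<longlonglongrightarrow> ell (a, b)"
    by (intro isCont_tendsto_compose[OF ell_isCont[OF ab]] tendsto_Pair floor_mult_LIMSEQ)
  moreover have "\<exists>N. \<forall>n\<ge>N. ?A n * mean1 t - ?B n * mean2 t \<le> ell (?A n, ?B n)"
  proof (intro exI[of _ 1] allI impI)
    fix n :: nat assume n: "1 \<le> n"
    define k1 k2 where "k1 = nat \<lfloor>real n * a\<rfloor>" and "k2 = nat \<lfloor>real n * b\<rfloor>"
    have k: "real_of_int \<lfloor>real n * a\<rfloor> = real k1" "real_of_int \<lfloor>real n * b\<rfloor> = real k2"
      using ab by (simp_all add: k1_def k2_def)
    have "real n * (?A n * mean1 t - ?B n * mean2 t) = real k1 * mean1 t - real k2 * mean2 t"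
      using n unfolding k by (simp add: right_diff_distrib)
    also have "\<dots> \<le> ellv (int k1, int k2)" by (rule int)
    also have "\<dots> = real n * ell (?A n, ?B n)"
      using ell_scale[of "real k1 / real n" "real k2 / real n" n] n unfolding k by (simp add: ellv_def)
    finally show "?A n * mean1 t - ?B n * mean2 t \<le> ell (?A n, ?B n)" using n by simp
  qed
  ultimately show ?thesis by (rule LIMSEQ_le)
qed

text \<open>\<open>ell\<close> minus the linear form with coefficients \<open>p\<close> and
  \<open>- q\<close> is nonnegative on the open quadrant and at most \<open>0\<close> at
  \<open>dr t\<close>; so it has a minimum there and its derivative vanishes.\<close>

lemma gradient_unique:
  assumes t: "0 < t" "t < 1"
    and le: "\<And>a b. 0 < a \<Longrightarrow> 0 < b \<Longrightarrow> a * p - b * q \<le> ell (a, b)"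
    and ge: "ell (dr t) \<le> t * p - (1 - t) * q"
  shows "frechet_derivative ell (at (dr t)) (1, 0) = p" "frechet_derivative ell (at (dr t)) (0, 1) = - q"
proof -
  let ?F = "frechet_derivative ell (at (dr t))"
  have "(ell has_derivative ?F) (at (dr t))"
    using diff t by (simp add: frechet_derivative_works)
  then have "((\<lambda>v. ell v - (fst v * p - snd v * q)) has_derivative (\<lambda>h. ?F h - (fst h * p - snd h * q))) (at (dr t))"
    by (intro derivative_intros)
  moreover have "open ({0::real<..} \<times> {0::real<..})" "dr t \<in> {0::real<..} \<times> {0::real<..}"
    using t by (auto intro!: open_Times)
  moreover have "\<forall>v\<in>{0::real<..} \<times> {0::real<..}. ell (dr t) - (fst (dr t) * p - snd (dr t) * q) \<le> ell v - (fst v * p - snd v * q)"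
    using le ge by force
  ultimately have "(\<lambda>h. ?F h - (fst h * p - snd h * q)) = (\<lambda>v. 0)"
    using differential_zero_maxmin[of "dr t" "{0::real<..} \<times> {0::real<..}"] by blast
  from fun_cong[OF this, of "(1, 0)"] fun_cong[OF this, of "(0, 1)"]
  show "?F (1, 0) = p" "?F (0, 1) = - q" by simp_all
qed

lemma regular_dense:
  assumes "0 < a" "a < b" "b < 1" shows "\<exists>t. regular t \<and> a < t \<and> t < b"
proof -
  have 1: "countable {t\<in>{0<..<1}. \<not> isCont mean1 t}" "countable {t\<in>{0<..<1}. \<not> isCont mean2 t}"
    by (rule mono_on_ctble_discont_open; auto simp: mono_on_def intro: mean_mono)+
  have "uncountable {a<..<b}" using assms by (simp add: uncountable_open_interval)
  then have "\<not> {a<..<b} \<subseteq> {t\<in>{0<..<1}. \<not> isCont mean1 t} \<union> {t\<in>{0<..<1}. \<not> isCont mean2 t}"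
    using 1 by (meson countable_Un countable_subset)
  then obtain t where "t \<in> {a<..<b}" "t \<notin> {t\<in>{0<..<1}. \<not> isCont mean1 t}" "t \<notin> {t\<in>{0<..<1}. \<not> isCont mean2 t}"
    by blast
  then show ?thesis using assms unfolding regular_def by (intro exI[of _ t]) auto
qed

text \<open>Regular directions are dense and approach \<open>t\<close> from either side. The limits
  of their means satisfy both inequalities of \<open>gradient_unique\<close> at \<open>t\<close> and
  hence give the gradient; so the one-sided limits of the monotone means coincide and enclose the
  value at \<open>t\<close>.\<close>

lemma regular_all:
  assumes t: "0 < t" "t < 1" shows "regular t"
proof -
  note R = one_sided_limits(1)[where f = mean1, OF mean_mono(1) t] one_sided_limits(1)[where f = mean2, OF mean_mono(2) t]
  note L = one_sided_limits(2)[where f = mean1, OF mean_mono(1) t] one_sided_limits(2)[where f = mean2, OF mean_mono(2) t]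
  obtain r1 where r1: "(mean1 \<longlongrightarrow> r1) (at_right t)" "mean1 t \<le> r1" using R(1) by blast
  obtain r2 where r2: "(mean2 \<longlongrightarrow> r2) (at_right t)" "mean2 t \<le> r2" using R(2) by blast
  obtain l1 where l1: "(mean1 \<longlongrightarrow> l1) (at_left t)" "l1 \<le> mean1 t" using L(1) by blast
  obtain l2 where l2: "(mean2 \<longlongrightarrow> l2) (at_left t)" "l2 \<le> mean2 t" using L(2) by blast
  have limit: "frechet_derivative ell (at (dr t)) (1, 0) = p \<and> frechet_derivative ell (at (dr t)) (0, 1) = - q"
    if \<tau>: "\<And>n. regular (\<tau> n)" "\<tau> \<longlonglongrightarrow> t"
      and p: "(\<lambda>n. mean1 (\<tau> n)) \<longlonglongrightarrow> p" and q: "(\<lambda>n. mean2 (\<tau> n)) \<longlonglongrightarrow> q" for \<tau> p q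
  proof -
    have le: "a * p - b * q \<le> ell (a, b)" if "0 < a" "0 < b" for a b
    proof (rule LIMSEQ_le_const2)
      show "(\<lambda>n. a * mean1 (\<tau> n) - b * mean2 (\<tau> n)) \<longlonglongrightarrow> a * p - b * q" by (intro tendsto_intros p q)
      show "\<exists>N. \<forall>n\<ge>N. a * mean1 (\<tau> n) - b * mean2 (\<tau> n) \<le> ell (a, b)"
        using mean_le_ell[OF \<tau>(1) that] by blast
    qed
    have "ell (dr t) \<le> t * p - (1 - t) * q"
    proof (rule LIMSEQ_le)
      show "(\<lambda>n. ell (dr (\<tau> n))) \<longlonglongrightarrow> ell (dr t)"
        using t by (intro isCont_tendsto_compose[OF ell_isCont] tendsto_intros \<tau>(2)) auto
      show "(\<lambda>n. \<tau> n * mean1 (\<tau> n) - (1 - \<tau> n) * mean2 (\<tau> n)) \<longlonglongrightarrow> t * p - (1 - t) * q"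
        by (intro tendsto_intros p q \<tau>(2))
      show "\<exists>N. \<forall>n\<ge>N. ell (dr (\<tau> n)) \<le> \<tau> n * mean1 (\<tau> n) - (1 - \<tau> n) * mean2 (\<tau> n)"
        using ell_le_means \<tau>(1) unfolding regular_def by blast
    qed
    with gradient_unique[OF t le] show ?thesis by blast
  qed
  define \<delta> where "\<delta> n = min t (1 - t) / real (n + 2)" for n
  have \<delta>: "0 < \<delta> n" "\<delta> n < t" "t + \<delta> n < 1" for n
  proof -
    have m: "0 < min t (1 - t)" using t by simp
    then show "0 < \<delta> n" by (simp add: \<delta>_def)
    have "min t (1 - t) / real (n + 2) < min t (1 - t) / 1" using m by (intro divide_strict_left_mono) auto
    then show "\<delta> n < t" "t + \<delta> n < 1" by (auto simp: \<delta>_def)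
  qed
  have \<delta>0: "\<delta> \<longlonglongrightarrow> 0" unfolding \<delta>_def
    by (intro real_tendsto_divide_at_top[OF tendsto_const]
        filterlim_compose[OF filterlim_real_sequentially] filterlim_add_const_nat_at_top)
  have "\<exists>s. regular s \<and> t < s \<and> s < t + \<delta> n" for n using regular_dense[of t "t + \<delta> n"] \<delta>[of n] t by auto
  then obtain \<tau> where \<tau>: "\<And>n. regular (\<tau> n)" "\<And>n. t < \<tau> n" "\<And>n. \<tau> n < t + \<delta> n" by metis
  have "\<exists>s. regular s \<and> t - \<delta> n < s \<and> s < t" for n using regular_dense[of "t - \<delta> n" t] \<delta>[of n] t by auto
  then obtain \<sigma> where \<sigma>: "\<And>n. regular (\<sigma> n)" "\<And>n. t - \<delta> n < \<sigma> n" "\<And>n. \<sigma> n < t" by metis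
  have \<tau>t: "\<tau> \<longlonglongrightarrow> t"
  proof (rule tendsto_sandwich[OF always_eventually always_eventually tendsto_const])
    show "(\<lambda>n. t + \<delta> n) \<longlonglongrightarrow> t" using tendsto_add[OF tendsto_const \<delta>0, of t] by simp
  qed (use \<tau> less_imp_le in blast)+
  have \<sigma>t: "\<sigma> \<longlonglongrightarrow> t"
  proof (rule tendsto_sandwich[OF always_eventually always_eventually _ tendsto_const])
    show "(\<lambda>n. t - \<delta> n) \<longlonglongrightarrow> t" using tendsto_diff[OF tendsto_const \<delta>0, of t] by simp
  qed (use \<sigma> less_imp_le in blast)+
  have ne: "\<tau> n \<noteq> t" "\<sigma> n \<noteq> t" for n using \<tau>(2)[of n] \<sigma>(3)[of n] by auto
  have fr: "filterlim \<tau> (at_right t) sequentially" using \<tau> \<tau>t ne by (simp add: filterlim_at)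
  have fl: "filterlim \<sigma> (at_left t) sequentially" using \<sigma> \<sigma>t ne by (simp add: filterlim_at)
  have "frechet_derivative ell (at (dr t)) (1, 0) = r1 \<and> frechet_derivative ell (at (dr t)) (0, 1) = - r2"
    by (rule limit[OF \<tau>(1) \<tau>t filterlim_compose[OF r1(1) fr] filterlim_compose[OF r2(1) fr]])
  moreover have "frechet_derivative ell (at (dr t)) (1, 0) = l1 \<and> frechet_derivative ell (at (dr t)) (0, 1) = - l2"
    by (rule limit[OF \<sigma>(1) \<sigma>t filterlim_compose[OF l1(1) fl] filterlim_compose[OF l2(1) fl]])
  ultimately have "r1 = mean1 t" "l1 = mean1 t" "r2 = mean2 t" "l2 = mean2 t"
    using r1(2) r2(2) l1(2) l2(2) by auto
  then show ?thesis
    using r1(1) r2(1) l1(1) l2(1) t by (simp add: regular_def isCont_def filterlim_at_split)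
qed

lemma mean_gradient:
  assumes t: "0 < t" "t < 1"
  shows "frechet_derivative ell (at (dr t)) (1, 0) = mean1 t" "frechet_derivative ell (at (dr t)) (0, 1) = - mean2 t"
proof -
  have r: "regular t" by (rule regular_all[OF t])
  then have "ell (dr t) \<le> t * mean1 t - (1 - t) * mean2 t" by (intro ell_le_means t) (simp add: regular_def)
  then show "frechet_derivative ell (at (dr t)) (1, 0) = mean1 t" "frechet_derivative ell (at (dr t)) (0, 1) = - mean2 t"
    using gradient_unique[OF t mean_le_ell[OF r]] by blast+
qed

text \<open>A common mean would give one linear form that is at most \<open>ell\<close> on the open
  quadrant and at least \<open>ell\<close> at both directions; at their midpoint this contradicts
  strict convexity.\<close>

lemma mean_distinct:
  assumes s: "0 < s" "s < 1" and t: "0 < t" "t < 1" and "s \<noteq> t"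
  shows "(mean1 s, - mean2 s) \<noteq> (mean1 t, - mean2 t)"
proof
  assume eq: "(mean1 s, - mean2 s) = (mean1 t, - mean2 t)"
  have le: "a * mean1 t - b * mean2 t \<le> ell (a, b)" if "0 < a" "0 < b" for a b
    by (rule mean_le_ell[OF regular_all[OF t] that])
  have es: "ell (dr s) \<le> s * mean1 t - (1 - s) * mean2 t"
    using ell_le_means[OF s] regular_all[OF s] eq by (simp add: regular_def)
  have et: "ell (dr t) \<le> t * mean1 t - (1 - t) * mean2 t"
    using ell_le_means[OF t] regular_all[OF t] by (simp add: regular_def)
  have "ell ((1/2) *\<^sub>R dr s + (1 - 1/2) *\<^sub>R dr t) < (1/2) * ell (dr s) + (1 - 1/2) * ell (dr t)"
    using sconv[unfolded strictly_convex_on_def, rule_format, of "dr s" "dr t" "1/2"] s t \<open>s \<noteq> t\<close> by simp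
  also have "\<dots> \<le> ((s + t) / 2) * mean1 t - (1 - (s + t) / 2) * mean2 t"
    using es et by (simp add: field_simps)
  also have "\<dots> \<le> ell ((s + t) / 2, 1 - (s + t) / 2)" using s t by (intro le) auto
  also have "((s + t) / 2, 1 - (s + t) / 2) = (1/2) *\<^sub>R dr s + (1 - 1/2) *\<^sub>R dr t"
    by (simp add: field_simps)
  finally show False by simp
qed

lemma good_AE: "AE \<omega> in M. good \<omega>"
proof -
  have "AE \<omega> in M. \<forall>q\<in>\<rat> \<inter> {0<..<1}. cont_at \<omega> q"
    using regular_cont_AE[OF regular_all]
    by (subst AE_ball_countable) (auto simp: countable_rat elim!: eventually_mono)
  with dir_ordered_AE show ?thesis
    by eventually_elim (auto simp: good_def)
qed

lemma U0_AE:
  assumes "\<xi> \<in> dirs" shows "AE \<omega> in M. \<xi> \<in> U0 \<omega>"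
  using regular_cont_AE[OF regular_all, of "fst \<xi>"] assms dirs_iff[of \<xi>]
  by (auto simp: U0_def elim!: eventually_mono)

end

subsection \<open>Mixing of the weights under shifts\<close>

context fpp_weights
begin

definition cyl :: "site set \<Rightarrow> (site \<Rightarrow> (real \<times> real) set) \<Rightarrow> config set" where
  "cyl J F = {\<omega>. \<forall>j\<in>J. \<omega> j \<in> F j}"

lemma prod_emb_cyl: "prod_emb UNIV (\<lambda>_. \<mu>) J (Pi\<^sub>E J F) = cyl J F"
  by (auto simp: prod_emb_def cyl_def space_PiM Pi_iff PiE_iff)

lemma prob_cyl:
  assumes "finite J" "\<And>i. i \<in> J \<Longrightarrow> F i \<in> sets \<mu>"
  shows "prob (cyl J F) = (\<Prod>i\<in>J. measure \<mu> (F i))"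
  using prod.measure_PiM_emb[of J F] assms by (simp add: weight_space_def prod_emb_cyl)

lemma cyl_events:
  assumes "finite J" "\<And>i. i \<in> J \<Longrightarrow> F i \<in> sets \<mu>"
  shows "cyl J F \<in> events"
  unfolding prod_emb_cyl[symmetric] weight_space_def using assms by (intro sets_PiM_I) auto

lemma events_eq: "events = sigma_sets UNIV (prod_algebra UNIV (\<lambda>_. \<mu>))"
  unfolding weight_space_def sets_PiM by simp

text \<open>Once the horizontal shift exceeds the extent of both index sets, the two cylinders
  depend on disjoint coordinates and the product formula is exact.\<close>

lemma eventually_cyl_independent:
  assumes F: "finite J" "\<And>i. i \<in> J \<Longrightarrow> F i \<in> sets \<mu>" and G: "finite K" "\<And>i. i \<in> K \<Longrightarrow> G i \<in> sets \<mu>"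
  shows "\<forall>\<^sub>F n in sequentially. prob (cyl J F \<inter> shift (int n, 0) -` cyl K G) = prob (cyl J F) * prob (cyl K G)"
proof -
  define b where "b = (\<Sum>i\<in>J. \<bar>fst i\<bar>) + (\<Sum>i\<in>K. \<bar>fst i\<bar>) + 1"
  show ?thesis
  proof (rule eventually_sequentiallyI[of "nat b"])
    fix n assume n: "nat b \<le> n"
    define z where "z = (int n, 0::int)"
    define K' where "K' = (\<lambda>k. k + z) ` K"
    have disj: "J \<inter> K' = {}"
    proof (rule ccontr)
      assume "J \<inter> K' \<noteq> {}"
      then obtain k where k: "k \<in> K" "k + z \<in> J" by (auto simp: K'_def)
      have "\<bar>fst (k + z)\<bar> \<le> (\<Sum>i\<in>J. \<bar>fst i\<bar>)" "\<bar>fst k\<bar> \<le> (\<Sum>i\<in>K. \<bar>fst i\<bar>)"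
        by (rule member_le_sum[OF k(2) _ F(1), of "\<lambda>i. \<bar>fst i\<bar>"], simp)
          (rule member_le_sum[OF k(1) _ G(1), of "\<lambda>i. \<bar>fst i\<bar>"], simp)
      moreover have "b \<le> int n" using n by linarith
      ultimately show False by (auto simp: z_def b_def)
    qed
    define H where "H i = (if i \<in> J then F i else G (i - z))" for i
    have inj: "inj_on (\<lambda>k. k + z) K" by (auto simp: inj_on_def)
    have H: "H i \<in> sets \<mu>" if "i \<in> J \<union> K'" for i
      using that F G by (auto simp: H_def K'_def)
    have fin: "finite (J \<union> K')" using F G by (auto simp: K'_def)
    have "cyl J F \<inter> shift z -` cyl K G = cyl (J \<union> K') H"
    proof -
      have "\<omega> i \<in> H i \<longleftrightarrow> \<omega> i \<in> G (i - z)" if "i \<in> K'" for \<omega> i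
        using that disj by (auto simp: H_def)
      then have "(\<forall>i\<in>K'. \<omega> i \<in> H i) \<longleftrightarrow> (\<forall>k\<in>K. \<omega> (k + z) \<in> G k)" for \<omega>
        by (simp add: K'_def)
      moreover have "(\<forall>i\<in>J. \<omega> i \<in> H i) \<longleftrightarrow> (\<forall>i\<in>J. \<omega> i \<in> F i)" for \<omega> by (simp add: H_def)
      ultimately show ?thesis unfolding cyl_def shift_def by (auto simp: ball_Un)
    qed
    then have "prob (cyl J F \<inter> shift z -` cyl K G) = (\<Prod>i\<in>J \<union> K'. measure \<mu> (H i))"
      using prob_cyl[OF fin H] by simp
    also have "\<dots> = (\<Prod>i\<in>J. measure \<mu> (H i)) * (\<Prod>i\<in>K'. measure \<mu> (H i))"
      using F G disj by (intro prod.union_disjoint) (auto simp: K'_def)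
    also have "(\<Prod>i\<in>J. measure \<mu> (H i)) = prob (cyl J F)"
      using F by (subst prob_cyl) (auto simp: H_def)
    also have "(\<Prod>i\<in>K'. measure \<mu> (H i)) = (\<Prod>k\<in>K. measure \<mu> (G k))"
    proof -
      have "k + z \<notin> J" if "k \<in> K" for k using that disj by (auto simp: K'_def)
      then show ?thesis unfolding K'_def by (subst prod.reindex[OF inj]) (auto simp: H_def)
    qed
    also have "\<dots> = prob (cyl K G)" using G by (simp add: prob_cyl)
    finally show "prob (cyl J F \<inter> shift (int n, 0) -` cyl K G) = prob (cyl J F) * prob (cyl K G)"
      by (simp add: z_def)
  qed
qed

text \<open>One Dynkin argument for both variables of mixing, applied first to one set and then to
  the other. The domination \<open>q n A \<le> prob A\<close> controls the tail of a countable
  disjoint union uniformly in \<open>n\<close>.\<close>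

lemma product_limit_dynkin:
  fixes q :: "nat \<Rightarrow> config set \<Rightarrow> real"
  assumes q0: "\<And>n A. A \<in> events \<Longrightarrow> 0 \<le> q n A" and q1: "\<And>n A. A \<in> events \<Longrightarrow> q n A \<le> prob A"
    and add: "\<And>n A B. A \<in> events \<Longrightarrow> B \<in> events \<Longrightarrow> A \<inter> B = {} \<Longrightarrow> q n (A \<union> B) = q n A + q n B"
    and univ: "\<And>n. q n UNIV = c"
    and basic: "\<And>J F. finite J \<Longrightarrow> (\<And>i. i \<in> J \<Longrightarrow> F i \<in> sets \<mu>) \<Longrightarrow> (\<lambda>n. q n (cyl J F)) \<longlonglongrightarrow> prob (cyl J F) * c"
    and A: "A \<in> events"
  shows "(\<lambda>n. q n A) \<longlonglongrightarrow> prob A * c"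
proof -
  have c: "0 \<le> c" "c \<le> 1"
    using q0[of UNIV 0] q1[of UNIV 0] univ[of 0] sets.top[of M] by auto
  have closed: "prod_algebra UNIV (\<lambda>_. \<mu>) \<subseteq> Pow UNIV" by simp
  from Int_stable_prod_algebra closed A[unfolded events_eq]
  show ?thesis
  proof (induction A rule: sigma_sets_induct_disjoint)
    case (basic A)
    then obtain J E where "A = prod_emb UNIV (\<lambda>_. \<mu>) J (Pi\<^sub>E J E)" "finite J" "\<And>i. i \<in> J \<Longrightarrow> E i \<in> sets \<mu>"
      by (elim prod_algebraE) auto
    then show ?case using assms(5)[of J E] by (simp add: prod_emb_cyl)
  next
    case empty
    have "q n {} = 0" for n using q0[of "{}" n] q1[of "{}" n] by simp
    then show ?case by simp
  next
    case (compl A)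
    then have A: "A \<in> events" by (simp add: events_eq)
    have "q n (UNIV - A) = c - q n A" for n
      using add[of A "UNIV - A" n] A univ[of n] sets.compl_sets[OF A] by (simp add: Un_absorb1)
    moreover have "prob (UNIV - A) * c = c - prob A * c"
      using prob_compl[OF A] by (simp add: left_diff_distrib)
    ultimately show ?case
      using tendsto_diff[OF tendsto_const compl(2), of c] by presburger
  next
    case (union A)
    have A: "A i \<in> events" for i using union(2) by (auto simp: events_eq)
    define U where "U = (\<Union>i. A i)"
    define P where "P k = (\<Union>i<k. A i)" for k
    have U: "U \<in> events" "P k \<in> events" "P k \<subseteq> U" for k using A by (auto simp: U_def P_def)
    have qP: "q n (P k) = (\<Sum>i<k. q n (A i))" for n k
    proof (induction k)
      case 0
      have "q n {} = 0" using q0[of "{}" n] q1[of "{}" n] by simp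
      then show ?case by (simp add: P_def)
    next
      case (Suc k)
      have "P (Suc k) = P k \<union> A k" by (auto simp: P_def lessThan_Suc)
      moreover have "A i \<inter> A k = {}" if "i < k" for i
        using disjoint_family_onD[OF union(1), of i k] that by simp
      then have "P k \<inter> A k = {}" unfolding P_def by blast
      ultimately show ?case using Suc add[OF U(2) A] by simp
    qed
    have pP: "prob (P k) = (\<Sum>i<k. prob (A i))" for k
      unfolding P_def using A union(1)
      by (intro finite_measure_finite_Union) (auto simp: disjoint_family_on_def)
    have "(\<lambda>k. prob (P k)) \<longlonglongrightarrow> prob U"
    proof -
      have "(\<lambda>k. prob (P k)) \<longlonglongrightarrow> prob (\<Union>k. P k)"
      proof (rule finite_Lim_measure_incseq)
        show "range P \<subseteq> events" using U(2) by blast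
        show "incseq P" unfolding incseq_def P_def by (auto intro: less_le_trans)
      qed
      also have "(\<Union>k. P k) = U" unfolding P_def U_def by blast
      finally show ?thesis .
    qed
    note limP = this
    show ?case unfolding U_def[symmetric]
    proof (rule tendstoI)
      fix e :: real assume e: "e > 0"
      then have "\<forall>\<^sub>F k in sequentially. prob U - e / 3 < prob (P k)"
        using limP by (intro order_tendstoD) auto
      then obtain k where k: "prob U - e / 3 < prob (P k)" by (auto simp: eventually_sequentially)
      have "(\<lambda>n. q n (P k)) \<longlonglongrightarrow> (\<Sum>i<k. prob (A i) * c)"
        unfolding qP by (intro tendsto_sum union(3))
      then have "(\<lambda>n. q n (P k)) \<longlonglongrightarrow> prob (P k) * c" by (simp add: pP sum_distrib_right)
      then have "\<forall>\<^sub>F n in sequentially. dist (q n (P k)) (prob (P k) * c) < e / 3"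
        using e by (intro tendstoD) auto
      then show "\<forall>\<^sub>F n in sequentially. dist (q n U) (prob U * c) < e"
      proof eventually_elim
        case (elim n)
        have "U - P k \<in> events" using U by blast
        have "q n U = q n (P k) + q n (U - P k)"
          using add[of "P k" "U - P k" n] U by (simp add: Un_absorb1)
        moreover have pd: "prob (U - P k) = prob U - prob (P k)"
          using U by (intro finite_measure_Diff) auto
        moreover have "0 \<le> q n (U - P k)" "q n (U - P k) \<le> prob (U - P k)"
          using q0 q1 \<open>U - P k \<in> events\<close> by auto
        moreover have "0 \<le> prob U * c - prob (P k) * c" "prob U * c - prob (P k) * c \<le> prob U - prob (P k)"
        proof -
          have "0 \<le> prob (U - P k)" by simp
          then have d: "0 \<le> prob U - prob (P k)" using pd by simp
          show "0 \<le> prob U * c - prob (P k) * c" "prob U * c - prob (P k) * c \<le> prob U - prob (P k)"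
            using c d mult_nonneg_nonneg[OF d c(1)] mult_left_le[OF c(2) d] by (simp_all add: left_diff_distrib)
        qed
        ultimately show ?case using elim k unfolding dist_real_def abs_less_iff by linarith
      qed
    qed
  qed
qed

lemma shift_mixing:
  assumes A: "A \<in> events" and B: "B \<in> events"
  shows "(\<lambda>n. prob (A \<inter> shift (int n, 0) -` B)) \<longlonglongrightarrow> prob A * prob B"
proof -
  have T: "shift z -` C \<in> events" if "C \<in> events" for z C
    using measurable_sets[OF shift_measurable that, of z] by simp
  have pT: "prob (shift z -` C) = prob C" if "C \<in> events" for z C
    using prob_shift[OF that, of z] by (simp add: vimage_def)
  have step: "(\<lambda>n. prob (A \<inter> shift (int n, 0) -` cyl K G)) \<longlonglongrightarrow> prob A * prob (cyl K G)"
    if K: "finite K" "\<And>i. i \<in> K \<Longrightarrow> G i \<in> sets \<mu>" for K G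
  proof -
    note C = cyl_events[OF K]
    show ?thesis
    proof (rule product_limit_dynkin[where q = "\<lambda>n A. prob (A \<inter> shift (int n, 0) -` cyl K G)"])
      show "(\<lambda>n. prob (cyl J F \<inter> shift (int n, 0) -` cyl K G)) \<longlonglongrightarrow> prob (cyl J F) * prob (cyl K G)"
        if "finite J" "\<And>i. i \<in> J \<Longrightarrow> F i \<in> sets \<mu>" for J F
        by (rule tendsto_eventually[OF eventually_cyl_independent[OF that K]])
      show "prob (UNIV \<inter> shift (int n, 0) -` cyl K G) = prob (cyl K G)" for n using pT[OF C] by simp
      show "prob ((A \<union> B) \<inter> shift (int n, 0) -` cyl K G)
          = prob (A \<inter> shift (int n, 0) -` cyl K G) + prob (B \<inter> shift (int n, 0) -` cyl K G)"
        if "A \<in> events" "B \<in> events" "A \<inter> B = {}" for n A B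
        unfolding Int_Un_distrib2 using that T[OF C] by (intro finite_measure_Union) auto
      show "prob (A \<inter> shift (int n, 0) -` cyl K G) \<le> prob A" if "A \<in> events" for n A
        using that by (intro finite_measure_mono) auto
    qed (use A in auto)
  qed
  have "(\<lambda>n. prob (A \<inter> shift (int n, 0) -` B)) \<longlonglongrightarrow> prob B * prob A"
  proof (rule product_limit_dynkin[where q = "\<lambda>n B. prob (A \<inter> shift (int n, 0) -` B)"])
    show "(\<lambda>n. prob (A \<inter> shift (int n, 0) -` cyl J F)) \<longlonglongrightarrow> prob (cyl J F) * prob A"
      if "finite J" "\<And>i. i \<in> J \<Longrightarrow> F i \<in> sets \<mu>" for J F
      using step[OF that] by (simp add: mult.commute)
    show "prob (A \<inter> shift (int n, 0) -` (B \<union> C))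
        = prob (A \<inter> shift (int n, 0) -` B) + prob (A \<inter> shift (int n, 0) -` C)"
      if "B \<in> events" "C \<in> events" "B \<inter> C = {}" for n B C
      unfolding vimage_Un Int_Un_distrib using that A T by (intro finite_measure_Union) auto
    show "prob (A \<inter> shift (int n, 0) -` B) \<le> prob B" if "B \<in> events" for n B
      using that T pT[OF that, of "(int n, 0)"] finite_measure_mono[of "A \<inter> shift (int n, 0) -` B" "shift (int n, 0) -` B"] by auto
  qed (use B in auto)
  then show ?thesis by (simp add: mult.commute)
qed

text \<open>Mixing applied to \<open>E\<close> and itself gives \<open>p = p^2\<close>. Invariance
  is required only almost surely, because the Busemann functions are known to commute with shifts on
  good configurations.\<close>

lemma shift_zero_one:
  assumes E: "E \<in> events" and inv: "\<And>z. AE \<omega> in M. shift z \<omega> \<in> E \<longleftrightarrow> \<omega> \<in> E"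
  shows "prob E \<in> {0, 1}"
proof -
  have T: "shift z -` E \<in> events" for z
    using measurable_sets[OF shift_measurable E, of z] by simp
  have "prob (E \<inter> shift z -` E) = prob E" for z
    using inv[of z] E T by (intro measure_eq_AE) (auto elim!: eventually_mono)
  then have "(\<lambda>n. prob E) \<longlonglongrightarrow> prob E * prob E" using shift_mixing[OF E E] by simp
  then have "prob E = prob E * prob E" by (simp add: LIMSEQ_const_iff)
  then show ?thesis by simp
qed

section \<open>Measurability, stationarity and ergodicity of the Busemann process\<close>

text \<open>\<open>Bs\<close> is built from passage times by differences and \<open>lim\<close>,
  which preserves measurability with or without convergence; so any sigma algebra that measures the
  passage times will do.\<close>

lemma Bs_measurable_gen:
  assumes "\<And>v. (\<lambda>\<omega>. passage \<omega> x v) \<in> borel_measurable N" "\<And>v. (\<lambda>\<omega>. passage \<omega> y v) \<in> borel_measurable N"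
  shows "(\<lambda>\<omega>. Bs s \<omega> \<xi> x y) \<in> borel_measurable N"
proof -
  note [measurable] = assms
  show ?thesis unfolding Bs_def B0_def incr_def by measurable
qed

lemma Bs_measurable [measurable]: "(\<lambda>\<omega>. Bs s \<omega> \<xi> x y) \<in> borel_measurable M"
  by (intro Bs_measurable_gen passage_measurable)

text \<open>Paths from \<open>x\<close> or \<open>y\<close> see only weights in the two quadrants,
  so restricting the configuration changes no passage time and \<open>Bs\<close> itself is the
  measurable version.\<close>

lemma Bs_measurable_quadrant: "(\<lambda>\<omega>. Bs s \<omega> \<xi> x y) \<in> borel_measurable (quadrant_sigma \<mu> x y)"
proof (rule Bs_measurable_gen)
  let ?K = "{z. ple x z \<or> ple y z}"
  have r: "(\<lambda>\<omega>. restrict \<omega> ?K) \<in> quadrant_sigma \<mu> x y \<rightarrow>\<^sub>M PiM ?K (\<lambda>_. \<mu>)"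
    unfolding quadrant_sigma_def by (rule measurable_vimage_algebra1) (auto simp: space_PiM)
  have "(\<lambda>\<omega>. passage \<omega> u v) \<in> borel_measurable (quadrant_sigma \<mu> x y)" if "u = x \<or> u = y" for u v
  proof -
    have "(\<lambda>\<omega>. passage (restrict \<omega> ?K) u v) \<in> borel_measurable (quadrant_sigma \<mu> x y)"
      using that by (intro measurable_compose[OF r] passage_measurable_PiM) auto
    moreover have "passage (restrict \<omega> ?K) u v = passage \<omega> u v" for \<omega>
      using that by (intro passage_cong) auto
    ultimately show ?thesis by simp
  qed
  then show "(\<lambda>\<omega>. passage \<omega> x v) \<in> borel_measurable (quadrant_sigma \<mu> x y)"
    "(\<lambda>\<omega>. passage \<omega> y v) \<in> borel_measurable (quadrant_sigma \<mu> x y)" for v by auto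
qed

lemma psi_measurable: "psi (Bs True) (Bs False) \<in> M \<rightarrow>\<^sub>M psi_space"
  unfolding psi_space_def psi_def[abs_def]
proof (rule measurable_restrict)
  fix i :: "site \<times> (real \<times> real) \<times> bool"
  obtain x \<xi> s where i: "i = (x, \<xi>, s)" by (cases i)
  show "(\<lambda>\<omega>. case i of (x, \<xi>, s) \<Rightarrow> (W \<omega> x 1, W \<omega> x 2,
      (if s then Bs True else Bs False) \<omega> \<xi> x (padd x e1),
      (if s then Bs True else Bs False) \<omega> \<xi> x (padd x e2))) \<in> borel_measurable M"
    unfolding i by (cases s) (auto intro!: borel_measurable_Pair)
qed

lemma psi_shift_measurable: "psi_shift z \<in> psi_space \<rightarrow>\<^sub>M psi_space"
  unfolding psi_space_def psi_shift_def[abs_def]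
proof (rule measurable_restrict)
  fix i assume "i \<in> psi_index"
  then obtain x \<xi> s where i: "i = (x, \<xi>, s)" "\<xi> \<in> dirs" by (cases i) (auto simp: psi_index_def)
  have "(padd x z, \<xi>, s) \<in> psi_index" using i by (simp add: psi_index_def)
  from measurable_component_singleton[OF this]
  show "(\<lambda>f. case i of (x, \<xi>, s) \<Rightarrow> f (padd x z, \<xi>, s)) \<in> borel_measurable (PiM psi_index (\<lambda>_. borel))"
    unfolding i by simp
qed

end

text \<open>Both sides are limits along the same dyadic directions, and in each of these the
  translated staircase is one more admissible sequence.\<close>

lemma Bs_shift:
  assumes good: "good \<omega>" "good (shift z \<omega>)" and t: "0 < t" "t < 1"
  shows "Bs s (shift z \<omega>) (dr t) x y = Bs s \<omega> (dr t) (x + z) (y + z)"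
proof (rule LIMSEQ_unique)
  show "(\<lambda>m. B0 (shift z \<omega>) (dr (dyadic s t m)) x y) \<longlonglongrightarrow> Bs s (shift z \<omega>) (dr t) x y"
    by (rule filterlim_compose[OF Bs_tendsto[OF good(2) t] filterlim_dyadic[OF good(2) t]])
  have l: "(\<lambda>m. B0 \<omega> (dr (dyadic s t m)) (x + z) (y + z)) \<longlonglongrightarrow> Bs s \<omega> (dr t) (x + z) (y + z)"
    by (rule filterlim_compose[OF Bs_tendsto[OF good(1) t] filterlim_dyadic[OF good(1) t]])
  have "\<forall>\<^sub>F m in sequentially. B0 \<omega> (dr (dyadic s t m)) (x + z) (y + z) = B0 (shift z \<omega>) (dr (dyadic s t m)) x y"
    using dyadic_side[OF good(1) t, of s] dyadic_side[OF good(2) t, of s]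
  proof eventually_elim
    case (elim m)
    let ?q = "dyadic s t m"
    have u: "dr ?q \<in> U0 \<omega>" "dr ?q \<in> U0 (shift z \<omega>)" using elim by (auto simp: side_def)
    then have q: "0 < ?q" "?q < 1" using U0_dirs by fastforce+
    have "(\<lambda>n. incr \<omega> (x + z) (y + z) (stair ?q n + z)) \<longlonglongrightarrow> B0 \<omega> (dr ?q) (x + z) (y + z)"
      using q by (intro U0_tendsto[OF good(1) u(1)] tends_dir_shift tends_dir_stair)
    moreover have "(\<lambda>n. incr (shift z \<omega>) x y (stair ?q n)) \<longlonglongrightarrow> B0 (shift z \<omega>) (dr ?q) x y"
      using q by (intro U0_tendsto[OF good(2) u(2)] tends_dir_stair)
    ultimately show ?case unfolding incr_shift by (rule LIMSEQ_unique)
  qed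
  with l show "(\<lambda>m. B0 (shift z \<omega>) (dr (dyadic s t m)) x y) \<longlonglongrightarrow> Bs s \<omega> (dr t) (x + z) (y + z)"
    by (rule Lim_transform_eventually)
qed

lemma if_Bs: "(if s then Bs True else Bs False) = Bs s"
  by (cases s) simp_all

text \<open>The identity holds for all directions and signs at once, so the joint process over
  uncountably many directions needs no union of null sets.\<close>

lemma psi_shift_psi:
  assumes "good \<omega>" "good (shift z \<omega>)"
  shows "psi_shift z (psi (Bs True) (Bs False) \<omega>) = psi (Bs True) (Bs False) (shift z \<omega>)"
proof
  fix i :: "site \<times> (real \<times> real) \<times> bool"
  obtain x \<xi> s where i: "i = (x, \<xi>, s)" by (cases i)
  show "psi_shift z (psi (Bs True) (Bs False) \<omega>) i = psi (Bs True) (Bs False) (shift z \<omega>) i"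
  proof (cases "\<xi> \<in> dirs")
    case True
    then obtain t where t: "\<xi> = dr t" "0 < t" "t < 1" by (auto simp: dirs_iff)
    have c: "x + z + e1 = x + e1 + z" "x + z + e2 = x + e2 + z" by (simp_all add: algebra_simps)
    show ?thesis using t unfolding i psi_shift_def psi_def if_Bs padd_eq
      by (simp add: psi_index_def Bs_shift[OF assms] c) (simp add: W_def shift_def)
  next
    case False
    then show ?thesis unfolding i psi_shift_def psi_def by (simp add: psi_index_def)
  qed
qed

context fpp
begin

lemma psi_shift_AE: "AE \<omega> in M. psi_shift z (psi (Bs True) (Bs False) \<omega>) = psi (Bs True) (Bs False) (shift z \<omega>)"
  using good_AE AE_shift[OF good_AE, of z] by eventually_elim (rule psi_shift_psi)

lemma psi_stationary:
  "distr M psi_space (\<lambda>\<omega>. psi_shift z (psi (Bs True) (Bs False) \<omega>)) = distr M psi_space (psi (Bs True) (Bs False))"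
proof -
  have "distr M psi_space (\<lambda>\<omega>. psi_shift z (psi (Bs True) (Bs False) \<omega>))
      = distr M psi_space (psi (Bs True) (Bs False) \<circ> shift z)"
    by (intro distr_cong_AE measurable_compose[OF psi_measurable psi_shift_measurable]
        measurable_comp[OF shift_measurable psi_measurable]) (use psi_shift_AE in auto)
  also have "\<dots> = distr (distr M M (shift z)) psi_space (psi (Bs True) (Bs False))"
    by (rule distr_distr[symmetric, OF psi_measurable shift_measurable])
  finally show ?thesis by (simp add: distr_shift)
qed

text \<open>An invariant event of the process pulls back to an almost surely invariant event of the
  weights.\<close>

lemma psi_ergodic:
  assumes A: "A \<in> sets psi_space" and inv: "\<forall>z. \<forall>f\<in>space psi_space. psi_shift z f \<in> A \<longleftrightarrow> f \<in> A"
  shows "measure M (psi (Bs True) (Bs False) -` A \<inter> space M) \<in> {0, 1}"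
proof (rule shift_zero_one)
  let ?psi = "psi (Bs True) (Bs False)"
  show "?psi -` A \<inter> space M \<in> events" by (rule measurable_sets[OF psi_measurable A])
  show "AE \<omega> in M. shift z \<omega> \<in> ?psi -` A \<inter> space M \<longleftrightarrow> \<omega> \<in> ?psi -` A \<inter> space M" for z
    using psi_shift_AE[of z]
  proof eventually_elim
    case (elim \<omega>)
    have "?psi \<omega> \<in> space psi_space" using measurable_space[OF psi_measurable, of \<omega>] by simp
    then have "psi_shift z (?psi \<omega>) \<in> A \<longleftrightarrow> ?psi \<omega> \<in> A" using inv by blast
    then show ?case using elim by simp
  qed
qed

text \<open>A fixed direction almost surely lies in \<open>U0\<close>, where both one-sided
  functions equal \<open>B0\<close>; hence the two signs share their means.\<close>

lemma Bs_AE_phi: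
  assumes t: "0 < t" "t < 1"
  shows "AE \<omega> in M. Bs s \<omega> (dr t) (0, 0) e1 = phi \<omega> 0 e1 t"
    "AE \<omega> in M. Bs s \<omega> (dr t) (0, 0) e2 = - phi \<omega> e2 0 t"
proof -
  have "AE \<omega> in M. good \<omega> \<and> dr t \<in> U0 \<omega>"
    using good_AE U0_AE[of "dr t"] t by auto
  then have "AE \<omega> in M. Bs s \<omega> (dr t) (0, 0) e1 = phi \<omega> 0 e1 t \<and> Bs s \<omega> (dr t) (0, 0) e2 = - phi \<omega> e2 0 t"
  proof eventually_elim
    case (elim \<omega>)
    then have g: "good \<omega>" and u: "dr t \<in> U0 \<omega>" by auto
    have "adj 0 e1" "adj e2 0" by (auto simp: adj_def)
    then show ?case
      using B0_phi[OF g _ u, of 0 e1] B0_phi[OF g _ u, of e2 0] B0_sym[OF g u, of e2 0] Bs_eq_B0[OF g u]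
      by (simp add: zero_prod_def)
  qed
  then show "AE \<omega> in M. Bs s \<omega> (dr t) (0, 0) e1 = phi \<omega> 0 e1 t"
    "AE \<omega> in M. Bs s \<omega> (dr t) (0, 0) e2 = - phi \<omega> e2 0 t"
    by (auto elim!: eventually_mono)
qed

lemma Bs_mean:
  assumes t: "0 < t" "t < 1"
  shows "integrable M (\<lambda>\<omega>. Bs s \<omega> (dr t) (0, 0) e1)" "expectation (\<lambda>\<omega>. Bs s \<omega> (dr t) (0, 0) e1) = mean1 t"
    "integrable M (\<lambda>\<omega>. Bs s \<omega> (dr t) (0, 0) e2)" "expectation (\<lambda>\<omega>. Bs s \<omega> (dr t) (0, 0) e2) = - mean2 t"
proof -
  note ae = Bs_AE_phi[OF t, of s]
  have m: "(\<lambda>\<omega>. phi \<omega> 0 e1 t) \<in> borel_measurable M" "(\<lambda>\<omega>. - phi \<omega> e2 0 t) \<in> borel_measurable M"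
    by measurable
  show "integrable M (\<lambda>\<omega>. Bs s \<omega> (dr t) (0, 0) e1)"
    using integrable_cong_AE[OF _ m(1) ae(1)] phi_integrable(1)[OF t] by simp
  show "integrable M (\<lambda>\<omega>. Bs s \<omega> (dr t) (0, 0) e2)"
    using integrable_cong_AE[OF _ m(2) ae(2)] phi_integrable(2)[OF t] by simp
  show "expectation (\<lambda>\<omega>. Bs s \<omega> (dr t) (0, 0) e1) = mean1 t"
    using integral_cong_AE[OF _ m(1) ae(1)] by (simp add: mean1_def)
  show "expectation (\<lambda>\<omega>. Bs s \<omega> (dr t) (0, 0) e2) = - mean2 t"
    using integral_cong_AE[OF _ m(2) ae(2)] by (simp add: mean2_def)
qed

end

text \<open>The witnesses are \<open>B0\<close>, \<open>Bs True\<close>, \<open>Bs False\<close> and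
  \<open>U0\<close>; every pathwise assertion is verified on the event \<open>good\<close>.\<close>

theorem theorem2p2:
  fixes \<mu> :: "(real \<times> real) measure" and ell :: "real \<times> real \<Rightarrow> real"
  assumes SA: "standing_assumption \<mu>"
    and TC: "is_time_constant \<mu> ell"
    and diff: "\<forall>\<xi>::real \<times> real. 0 < fst \<xi> \<and> 0 < snd \<xi> \<longrightarrow> ell differentiable (at \<xi>)"
    and sconv: "strictly_convex_on dirs ell"
  shows "\<exists>(B0 :: config \<Rightarrow> real \<times> real \<Rightarrow> site \<Rightarrow> site \<Rightarrow> real)
          (Bp :: config \<Rightarrow> real \<times> real \<Rightarrow> site \<Rightarrow> site \<Rightarrow> real)
          (Bm :: config \<Rightarrow> real \<times> real \<Rightarrow> site \<Rightarrow> site \<Rightarrow> real)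
          (U0 :: config \<Rightarrow> (real \<times> real) set).
   (AE \<omega> in weight_space \<mu>.
      U0 \<omega> \<subseteq> dirs \<and> countable (dirs - U0 \<omega>) \<and>
      (\<forall>\<xi>\<in>U0 \<omega>. \<forall>x y. \<forall>v. tends_dir v \<xi> \<longrightarrow>
          ((\<lambda>n. passage \<omega> x (v n) - passage \<omega> y (v n)) \<longlongrightarrow> B0 \<omega> \<xi> x y) sequentially) \<and>
      (\<forall>\<xi>\<in>dirs. \<forall>x y.
          ((\<lambda>\<zeta>. B0 \<omega> \<zeta> x y) \<longlongrightarrow> Bp \<omega> \<xi> x y) (at \<xi> within {\<zeta> \<in> U0 \<omega>. fst \<xi> < fst \<zeta>}) \<and>
          ((\<lambda>\<zeta>. B0 \<omega> \<zeta> x y) \<longlongrightarrow> Bm \<omega> \<xi> x y) (at \<xi> within {\<zeta> \<in> U0 \<omega>. fst \<zeta> < fst \<xi>})) \<and>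
      \<comment> \<open>(i) cocycle\<close>
      (\<forall>\<xi>\<in>dirs. \<forall>s. \<forall>x y z.
          (if s then Bp else Bm) \<omega> \<xi> x y
            = (if s then Bp else Bm) \<omega> \<xi> x z + (if s then Bp else Bm) \<omega> \<xi> z y) \<and>
      \<comment> \<open>(iv) adaptedness\<close>
      (\<forall>\<xi>\<in>dirs. \<forall>s. \<forall>x.
          min (W \<omega> (padd x e1) 1 - (if s then Bp else Bm) \<omega> \<xi> x (padd x e1))
              (W \<omega> (padd x e2) 2 - (if s then Bp else Bm) \<omega> \<xi> x (padd x e2)) = 0) \<and>
      \<comment> \<open>(v) monotonicity\<close>
      (\<forall>\<xi>\<in>dirs. \<forall>\<zeta>\<in>dirs. fst \<xi> < fst \<zeta> \<longrightarrow> (\<forall>x.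
          Bm \<omega> \<xi> x (padd x e1) \<le> Bp \<omega> \<xi> x (padd x e1) \<and>
          Bp \<omega> \<xi> x (padd x e1) \<le> Bm \<omega> \<zeta> x (padd x e1) \<and>
          Bm \<omega> \<xi> x (padd x e2) \<ge> Bp \<omega> \<xi> x (padd x e2) \<and>
          Bp \<omega> \<xi> x (padd x e2) \<ge> Bm \<omega> \<zeta> x (padd x e2))) \<and>
      \<comment> \<open>(vi) one-sided continuity\<close>
      (\<forall>\<xi>\<in>dirs. \<forall>\<zeta> :: nat \<Rightarrow> real \<times> real.
          (\<forall>n. \<zeta> n \<in> dirs \<and> fst \<xi> < fst (\<zeta> n)) \<and> decseq (\<lambda>n. fst (\<zeta> n)) \<and>
          ((\<lambda>n. fst (\<zeta> n)) \<longlongrightarrow> fst \<xi>) sequentially \<longrightarrow>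
          (\<forall>s x y. ((\<lambda>n. (if s then Bp else Bm) \<omega> (\<zeta> n) x y) \<longlongrightarrow> Bp \<omega> \<xi> x y) sequentially)) \<and>
      (\<forall>\<xi>\<in>dirs. \<forall>\<zeta> :: nat \<Rightarrow> real \<times> real.
          (\<forall>n. \<zeta> n \<in> dirs \<and> fst (\<zeta> n) < fst \<xi>) \<and> incseq (\<lambda>n. fst (\<zeta> n)) \<and>
          ((\<lambda>n. fst (\<zeta> n)) \<longlongrightarrow> fst \<xi>) sequentially \<longrightarrow>
          (\<forall>s x y. ((\<lambda>n. (if s then Bp else Bm) \<omega> (\<zeta> n) x y) \<longlongrightarrow> Bm \<omega> \<xi> x y) sequentially)) \<and>
      (\<forall>\<xi>\<in>U0 \<omega>. \<forall>x y. Bp \<omega> \<xi> x y = B0 \<omega> \<xi> x y \<and> Bm \<omega> \<xi> x y = B0 \<omega> \<xi> x y \<and>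
          continuous (at \<xi> within U0 \<omega>) (\<lambda>\<zeta>. B0 \<omega> \<zeta> x y))) \<and>
   (\<forall>\<xi>\<in>dirs. AE \<omega> in weight_space \<mu>. \<xi> \<in> U0 \<omega>) \<and>
   \<comment> \<open>(ii) stationarity and joint ergodicity of psi\<close>
   psi Bp Bm \<in> weight_space \<mu> \<rightarrow>\<^sub>M psi_space \<and>
   (\<forall>z. distr (weight_space \<mu>) psi_space (\<lambda>\<omega>. psi_shift z (psi Bp Bm \<omega>))
          = distr (weight_space \<mu>) psi_space (psi Bp Bm)) \<and>
   (\<forall>A \<in> sets psi_space. (\<forall>z. \<forall>f \<in> space psi_space. psi_shift z f \<in> A \<longleftrightarrow> f \<in> A) \<longrightarrow>
       measure (weight_space \<mu>) (psi Bp Bm -` A \<inter> space (weight_space \<mu>)) \<in> {0, 1}) \<and>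
   \<comment> \<open>(iii) measurability\<close>
   (\<forall>\<xi>\<in>dirs. \<forall>s x y.
       (\<lambda>\<omega>. (if s then Bp else Bm) \<omega> \<xi> x y) \<in> borel_measurable (weight_space \<mu>) \<and>
       (\<exists>g \<in> borel_measurable (quadrant_sigma \<mu> x y).
          AE \<omega> in weight_space \<mu>. (if s then Bp else Bm) \<omega> \<xi> x y = g \<omega>)) \<and>
   \<comment> \<open>(vii) means\<close>
   (\<forall>\<xi>\<in>dirs. \<forall>s.
       integrable (weight_space \<mu>) (\<lambda>\<omega>. (if s then Bp else Bm) \<omega> \<xi> (0, 0) e1) \<and>
       integrable (weight_space \<mu>) (\<lambda>\<omega>. (if s then Bp else Bm) \<omega> \<xi> (0, 0) e2) \<and>
       (integral\<^sup>L (weight_space \<mu>) (\<lambda>\<omega>. (if s then Bp else Bm) \<omega> \<xi> (0, 0) e1),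
        integral\<^sup>L (weight_space \<mu>) (\<lambda>\<omega>. (if s then Bp else Bm) \<omega> \<xi> (0, 0) e2))
       = (frechet_derivative ell (at \<xi>) (1, 0), frechet_derivative ell (at \<xi>) (0, 1))) \<and>
   (\<forall>\<xi>\<in>dirs. \<forall>\<zeta>\<in>dirs. \<forall>s t. \<xi> \<noteq> \<zeta> \<longrightarrow>
       (integral\<^sup>L (weight_space \<mu>) (\<lambda>\<omega>. (if s then Bp else Bm) \<omega> \<xi> (0, 0) e1),
        integral\<^sup>L (weight_space \<mu>) (\<lambda>\<omega>. (if s then Bp else Bm) \<omega> \<xi> (0, 0) e2))
       \<noteq> (integral\<^sup>L (weight_space \<mu>) (\<lambda>\<omega>. (if t then Bp else Bm) \<omega> \<zeta> (0, 0) e1),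
          integral\<^sup>L (weight_space \<mu>) (\<lambda>\<omega>. (if t then Bp else Bm) \<omega> \<zeta> (0, 0) e2)))"
proof -
  interpret fpp \<mu> ell
    using SA TC diff sconv by unfold_locales
  have dirsD: "\<xi> = dr (fst \<xi>)" "0 < fst \<xi>" "fst \<xi> < 1" if "\<xi> \<in> dirs" for \<xi>
    using that dirs_iff by blast+
  show ?thesis
    apply (rule exI[of _ B0], rule exI[of _ "Bs True"], rule exI[of _ "Bs False"], rule exI[of _ U0])
    unfolding if_Bs
  proof (intro conjI, goal_cases)
    case 1
    show ?case using good_AE
    proof eventually_elim
      case good: (elim \<omega>)
      show ?case
      proof (intro conjI, goal_cases)
        case 1
        show ?case by (auto simp: U0_def)
      next
        case 2
        show ?case by (rule countable_not_U0[OF good])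
      next
        case 3
        show ?case using U0_tendsto[OF good] unfolding incr_def by blast
      next
        case 4
        show ?case
        proof (intro ballI)
          fix \<xi> assume "\<xi> \<in> dirs"
          note d = dirsD[OF this]
          show "\<forall>x y. ((\<lambda>\<zeta>. B0 \<omega> \<zeta> x y) \<longlongrightarrow> Bs True \<omega> \<xi> x y) (at \<xi> within {\<zeta> \<in> U0 \<omega>. fst \<xi> < fst \<zeta>}) \<and>
              ((\<lambda>\<zeta>. B0 \<omega> \<zeta> x y) \<longlongrightarrow> Bs False \<omega> \<xi> x y) (at \<xi> within {\<zeta> \<in> U0 \<omega>. fst \<zeta> < fst \<xi>})"
            using Bs_tendsto[OF good d(2,3), of _ _ True] Bs_tendsto[OF good d(2,3), of _ _ False]
            unfolding side_def d(1)[symmetric] by simp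
        qed
      next
        case 5
        show ?case using Bs_cocycle[OF good] dirs_iff by metis
      next
        case 6
        show ?case using Bs_adapted[OF good] dirs_iff by metis
      next
        case 7
        show ?case
        proof (intro ballI impI allI, goal_cases)
          case (1 \<xi> \<zeta> x)
          then obtain t t' where t: "\<xi> = dr t" "\<zeta> = dr t'" "0 < t" "t < t'" "t' < 1" "t < 1" "0 < t'"
            by (auto simp: dirs_iff)
          note m1 = Bs_mono[OF good adj_steps(1)] and m2 = Bs_mono[OF good adj_steps(2)]
          show ?case
            using m1(1)[OF t(3,6), of x] m1(2)[OF t(3,4,5), of x] m2(1)[OF t(3,6), of x] m2(2)[OF t(3,4,5), of x]
              Bs_sym[OF good t(3,6), of _ x "x + e2"] Bs_sym[OF good t(7,5), of _ x "x + e2"]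
            unfolding t(1,2) padd_eq by simp
        qed
      next
        case 8
        show ?case
        proof (intro ballI allI impI, elim conjE, goal_cases)
          case (1 \<xi> \<zeta> s x y)
          note d = dirsD[OF 1(1)]
          have e: "\<zeta> n = dr (fst (\<zeta> n))" "fst (\<zeta> n) < 1" for n using 1 dirs_iff by blast+
          have "(\<lambda>n. Bs s \<omega> (dr (fst (\<zeta> n))) x y) \<longlonglongrightarrow> Bs True \<omega> (dr (fst \<xi>)) x y"
            using 1 e(2) by (intro Bs_right_continuous[OF good d(2,3)]) auto
          then show ?case unfolding e(1)[symmetric] d(1)[symmetric] .
        qed
      next
        case 9
        show ?case
        proof (intro ballI allI impI, elim conjE, goal_cases)
          case (1 \<xi> \<zeta> s x y)
          note d = dirsD[OF 1(1)]
          have e: "\<zeta> n = dr (fst (\<zeta> n))" "0 < fst (\<zeta> n)" for n using 1 dirs_iff by blast+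
          have "(\<lambda>n. Bs s \<omega> (dr (fst (\<zeta> n))) x y) \<longlonglongrightarrow> Bs False \<omega> (dr (fst \<xi>)) x y"
            using 1 e(2) by (intro Bs_left_continuous[OF good d(2,3)]) auto
          then show ?case unfolding e(1)[symmetric] d(1)[symmetric] .
        qed
      next
        case 10
        show ?case
          using Bs_eq_B0[OF good] B0_continuous[OF good] by (simp add: continuous_within)
      qed
    qed
  next
    case 2
    show ?case using U0_AE by blast
  next
    case 3
    show ?case by (rule psi_measurable)
  next
    case 4
    show ?case using psi_stationary by blast
  next
    case 5
    show ?case using psi_ergodic by blast
  next
    case 6
    show ?case
    proof (intro ballI allI conjI Bs_measurable)
      show "\<exists>g \<in> borel_measurable (quadrant_sigma \<mu> x y). AE \<omega> in weight_space \<mu>. Bs s \<omega> \<xi> x y = g \<omega>"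
        for \<xi> s x y
        by (rule bexI[OF _ Bs_measurable_quadrant[of s \<xi> x y]]) simp
    qed
  next
    case 7
    show ?case
    proof (intro ballI allI, goal_cases)
      case (1 \<xi> s)
      then obtain t where t: "\<xi> = dr t" "0 < t" "t < 1" by (auto simp: dirs_iff)
      show ?case using Bs_mean[OF t(2,3), of s] mean_gradient[OF t(2,3)] by (simp add: t(1))
    qed
  next
    case 8
    show ?case
    proof (intro ballI allI impI, goal_cases)
      case (1 \<xi> \<zeta> s s')
      then have "fst \<xi> \<noteq> fst \<zeta>" using dirs_iff by metis
      then obtain t t' where t: "\<xi> = dr t" "\<zeta> = dr t'" "0 < t" "t < 1" "0 < t'" "t' < 1" "t \<noteq> t'"
        using 1 dirs_iff by metis
      show ?case
        unfolding t(1,2) Bs_mean[OF t(3,4)] Bs_mean[OF t(5,6)] by (rule mean_distinct[OF t(3-7)])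
    qed
  qed
qed

end
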